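(* Let $\Pi=\Pi(\Gamma,\lambda,\mathcal{G})$ be a periagroup. Every subgroup of $\Pi$ generated by a collection of conjugates of vertex-groups is (isomorphic to) a periagroup $\Pi(\Gamma',\lambda',\mathcal{G}')$ all of whose vertex-groups belong to $\mathcal{G}$ (as abstract groups, a same group of $\mathcal{G}$ being possibly used for several vertices of $\Gamma'$).
   Context: Let $\Gamma$ be a simplicial graph (possibly infinite), $\lambda:E(\Gamma)\to\mathbb{N}_{\geq 2}$ a labelling of its edges, and $\mathcal{G}=\{G_u\mid u\in V(\Gamma)\}$ a collection of groups indexed by the vertices of $\Gamma$ (the vertex-groups) such that for every edge $\{u,v\}$, if $\lambda(u,v)>2$ then $G_u,G_v$ have order two. The periagroup $\Pi(\Gamma,\lambda,\mathcal{G})$ is the quotient of the free product of the $G_u$ by the relations $\langle a,b\rangle^{\lambda(u,v)}=\langle b,a\rangle^{\lambda(u,v)}$ for all $\{u,v\}\in E(\Gamma)$ and all non-trivial $a\in G_u$, $b\in G_v$, where $\langle a,b\rangle^k$ is the word formed by the first $k$ letters of $ababab\cdots$. A conjugate of a vertex-group is a subgroup of $\Pi$ of the form $gG_ug^{-1}$ with $g\in\Pi$, $u\in V(\Gamma)$. *)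

theory Defs
  imports "HOL-Algebra.Algebra"
begin

text \<open>Edges are two-element sets of vertices; no finiteness is required.\<close>

definition simplicial_graph :: "'v set \<Rightarrow> 'v set set \<Rightarrow> bool" where
  "simplicial_graph V E \<longleftrightarrow> (\<forall>e\<in>E. \<exists>u\<in>V. \<exists>v\<in>V. u \<noteq> v \<and> e = {u, v})"

text \<open>The free product of the groups \<open>G u\<close> (\<open>u \<in> V\<close>) consists of the words in letters \<open>(u, a)\<close>,
  \<open>a \<in> carrier (G u)\<close>, modulo the least congruence \<open>fp_eq\<close> that deletes trivial letters and
  multiplies adjacent letters of the same group.\<close>

definition fp_words :: "'v set \<Rightarrow> ('v \<Rightarrow> 'a monoid) \<Rightarrow> ('v \<times> 'a) list set" where
  "fp_words V G = lists (SIGMA u:V. carrier (G u))"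

inductive fp_eq :: "'v set \<Rightarrow> ('v \<Rightarrow> 'a monoid) \<Rightarrow> ('v \<times> 'a) list \<Rightarrow> ('v \<times> 'a) list \<Rightarrow> bool"
  for V G where
  refl: "w \<in> fp_words V G \<Longrightarrow> fp_eq V G w w"
| sym: "fp_eq V G w w' \<Longrightarrow> fp_eq V G w' w"
| trans: "fp_eq V G w w' \<Longrightarrow> fp_eq V G w' w'' \<Longrightarrow> fp_eq V G w w''"
| one: "\<lbrakk>x \<in> fp_words V G; y \<in> fp_words V G; u \<in> V\<rbrakk>
    \<Longrightarrow> fp_eq V G (x @ [(u, \<one>\<^bsub>G u\<^esub>)] @ y) (x @ y)"
| mult: "\<lbrakk>x \<in> fp_words V G; y \<in> fp_words V G; u \<in> V; a \<in> carrier (G u); b \<in> carrier (G u)\<rbrakk>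
    \<Longrightarrow> fp_eq V G (x @ [(u, a), (u, b)] @ y) (x @ [(u, a \<otimes>\<^bsub>G u\<^esub> b)] @ y)"

definition fp_class :: "'v set \<Rightarrow> ('v \<Rightarrow> 'a monoid) \<Rightarrow> ('v \<times> 'a) list \<Rightarrow> ('v \<times> 'a) list set" where
  "fp_class V G w = {w'. fp_eq V G w w'}"

definition free_product :: "'v set \<Rightarrow> ('v \<Rightarrow> 'a monoid) \<Rightarrow> ('v \<times> 'a) list set monoid" where
  "free_product V G =
    \<lparr>carrier = fp_class V G ` fp_words V G,
     monoid.mult = (\<lambda>A B. \<Union>x\<in>A. \<Union>y\<in>B. fp_class V G (x @ y)),
     one = fp_class V G []\<rparr>"

definition normal_closure :: "('a, 'b) monoid_scheme \<Rightarrow> 'a set \<Rightarrow> 'a set" where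
  "normal_closure K S = \<Inter>{N. N \<lhd> K \<and> S \<subseteq> N}"

text \<open>The word \<open>\<langle>a, b\<rangle>\<close> of length \<open>k\<close>: the first \<open>k\<close> letters of \<open>a b a b \<dots>\<close>.\<close>

fun alternating :: "nat \<Rightarrow> 'l \<Rightarrow> 'l \<Rightarrow> 'l list" where
  "alternating 0 a b = []"
| "alternating (Suc k) a b = a # alternating k b a"

text \<open>The label of an edge \<open>{u, v}\<close> is \<open>lab {u, v}\<close>; values of \<open>lab\<close> off \<open>E\<close> and of \<open>G\<close> off \<open>V\<close>
  are irrelevant.\<close>

locale periagroup_data =
  fixes V :: "'v set" and E :: "'v set set" and lab :: "'v set \<Rightarrow> nat"
    and G :: "'v \<Rightarrow> 'a monoid"
  assumes graph: "simplicial_graph V E"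
    and label_ge_2: "e \<in> E \<Longrightarrow> 2 \<le> lab e"
    and vertex_group: "u \<in> V \<Longrightarrow> group (G u)"
    and order_2: "{u, v} \<in> E \<Longrightarrow> 2 < lab {u, v} \<Longrightarrow> order (G u) = 2 \<and> order (G v) = 2"

definition periagroup_relators ::
  "'v set \<Rightarrow> 'v set set \<Rightarrow> ('v set \<Rightarrow> nat) \<Rightarrow> ('v \<Rightarrow> 'a monoid) \<Rightarrow> ('v \<times> 'a) list set set" where
  "periagroup_relators V E lab G =
    {fp_class V G (alternating (lab {u, v}) (u, a) (v, b)) \<otimes>\<^bsub>free_product V G\<^esub>
       inv\<^bsub>free_product V G\<^esub> (fp_class V G (alternating (lab {u, v}) (v, b) (u, a)))
     | u v a b. {u, v} \<in> E \<and> a \<in> carrier (G u) - {\<one>\<^bsub>G u\<^esub>} \<and> b \<in> carrier (G v) - {\<one>\<^bsub>G v\<^esub>}}"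

type_synonym ('v, 'a) periagroup_elem = "('v \<times> 'a) list set set"

definition periagroup_kernel ::
  "'v set \<Rightarrow> 'v set set \<Rightarrow> ('v set \<Rightarrow> nat) \<Rightarrow> ('v \<Rightarrow> 'a monoid) \<Rightarrow> ('v \<times> 'a) list set set" where
  "periagroup_kernel V E lab G = normal_closure (free_product V G) (periagroup_relators V E lab G)"

definition periagroup ::
  "'v set \<Rightarrow> 'v set set \<Rightarrow> ('v set \<Rightarrow> nat) \<Rightarrow> ('v \<Rightarrow> 'a monoid) \<Rightarrow> ('v, 'a) periagroup_elem monoid" where
  "periagroup V E lab G = free_product V G Mod periagroup_kernel V E lab G"

text \<open>Elements of the periagroup are cosets of the kernel, so this is the image of \<open>G u\<close> under
  the canonical map \<open>G u \<rightarrow> free product \<rightarrow> periagroup\<close>.\<close>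

definition vertex_subgroup ::
  "'v set \<Rightarrow> 'v set set \<Rightarrow> ('v set \<Rightarrow> nat) \<Rightarrow> ('v \<Rightarrow> 'a monoid) \<Rightarrow> 'v \<Rightarrow> ('v, 'a) periagroup_elem set"
where
  "vertex_subgroup V E lab G u =
    (\<lambda>a. periagroup_kernel V E lab G #>\<^bsub>free_product V G\<^esub> fp_class V G [(u, a)]) ` carrier (G u)"

definition vertex_conjugates ::
  "'v set \<Rightarrow> 'v set set \<Rightarrow> ('v set \<Rightarrow> nat) \<Rightarrow> ('v \<Rightarrow> 'a monoid) \<Rightarrow> ('v, 'a) periagroup_elem set set"
where
  "vertex_conjugates V E lab G =
    (let P = periagroup V E lab G in
      {(g <#\<^bsub>P\<^esub> vertex_subgroup V E lab G u) #>\<^bsub>P\<^esub> inv\<^bsub>P\<^esub> g | g u. g \<in> carrier P \<and> u \<in> V})"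

end

theory Submission
  imports Defs
begin

text \<open>
  The proof transports Dyer's argument for reflection subgroups of Coxeter groups. Conjugates of
  vertex-groups play the role of reflections: each conjugate \<open>R\<close> has a hyperplane, whose sectors
  are permuted simply transitively by \<open>R\<close>, and \<open>\<sigma> R x \<in> R\<close> records in which sector \<open>x\<close> lies relative
  to the identity. The identity \<open>\<sigma> (x R x\<inverse>) (x y) = (x \<cdot> \<sigma> R y \<cdot> x\<inverse>) \<cdot> \<sigma> (x R x\<inverse>) x\<close> makes \<open>\<sigma>\<close> a
  cocycle, and such a cocycle can be read off the presentation without any normal form.

  A cocycle on a group \<open>W\<close> with values in a family of subgroups, for which every generating subgroup
  \<open>R \<in> \<Delta>\<close> crosses only its own hyperplane, has a strong exchange property; as in the proof of
  Matsumoto's theorem, this gives a periagroup presentation of \<open>W\<close> over \<open>\<Delta>\<close>.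

  For the subgroup \<open>W'\<close> generated by a set of conjugates, restrict the cocycle to the \<open>W'\<close>-translates
  of these conjugates and let \<open>D\<close> be the set of elements separated from the identity by none of
  them. The translates of the form \<open>g G\<^sub>u g\<inverse>\<close> with \<open>g \<in> D\<close> are the walls of \<open>D\<close>; they generate \<open>W'\<close> and
  satisfy the hypothesis above.
\<close>

section \<open>Presentations\<close>

text \<open>No normal form for periagroups is at hand, so even the injectivity of vertex-groups has
  to come from maps out of the presentation, and wall crossings come from an action of the presented
  group. The universal property is stated for monoids so that a relation can be checked as an
  equality of self-maps. The graph of the subgroup is not visible in its generators either. It is
  recovered from the cocycle alone: vertices are the walls of \<open>D\<close>, two walls span an
  edge when some element crosses both, and the label is the least length of such an element, which
  in a Coxeter group is the length of the longest element of the dihedral subgroup. The obstacle is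
  that a wall may have many sectors, so a relation found for one pair of letters must be spread to
  all pairs. At label two, one commuting pair forces the two subgroups to normalise each other;
  above two, a minimality argument leaves only one nontrivial element in each. That the walls
  generate the whole subgroup comes from writing every element of the periagroup as a product of
  wall letters followed by an element of \<open>D\<close>.\<close>

fun alt_prod :: "('a, 'b) monoid_scheme \<Rightarrow> nat \<Rightarrow> 'a \<Rightarrow> 'a \<Rightarrow> 'a" where
  "alt_prod M 0 a b = \<one>\<^bsub>M\<^esub>"
| "alt_prod M (Suc k) a b = a \<otimes>\<^bsub>M\<^esub> alt_prod M k b a"

lemma (in monoid) alt_prod_closed [simp]:
  "a \<in> carrier G \<Longrightarrow> b \<in> carrier G \<Longrightarrow> alt_prod G k a b \<in> carrier G"
  by (induction k arbitrary: a b) auto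

lemma hom_alt_prod:
  assumes "h \<in> hom M N" "h \<one>\<^bsub>M\<^esub> = \<one>\<^bsub>N\<^esub>" "monoid M" "a \<in> carrier M" "b \<in> carrier M"
  shows "h (alt_prod M k a b) = alt_prod N k (h a) (h b)"
  using assms(4,5)
  by (induction k arbitrary: a b)
     (simp_all add: assms(2) hom_mult[OF assms(1)] monoid.alt_prod_closed[OF assms(3)])

text \<open>The target is only a monoid because the universal properties below are applied to
  self-maps under composition and to integers under multiplication. \<open>hi\<close> stands in for
  inverses in \<open>H\<close>.\<close>

lemma (in group) normal_hom_kernel:
  assumes "monoid H" "h \<in> hom G H" "h \<one> = \<one>\<^bsub>H\<^esub>"
  shows "{x \<in> carrier G. h x = \<one>\<^bsub>H\<^esub>} \<lhd> G"
proof -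
  interpret H: monoid H by fact
  have hc: "h x \<in> carrier H" if "x \<in> carrier G" for x using assms(2) that by (rule hom_in_carrier)
  have hm: "h (x \<otimes> y) = h x \<otimes>\<^bsub>H\<^esub> h y" if "x \<in> carrier G" "y \<in> carrier G" for x y
    using assms(2) that by (rule hom_mult)
  have hi: "h x \<otimes>\<^bsub>H\<^esub> h (inv x) = \<one>\<^bsub>H\<^esub>" if "x \<in> carrier G" for x
    using hm[of x "inv x"] that assms(3) by simp
  show ?thesis
    unfolding normal_inv_iff
  proof (intro conjI ballI subgroupI)
    show "{x \<in> carrier G. h x = \<one>\<^bsub>H\<^esub>} \<noteq> {}" using assms(3) by blast
  next
    fix a assume "a \<in> {x \<in> carrier G. h x = \<one>\<^bsub>H\<^esub>}"
    then show "inv a \<in> {x \<in> carrier G. h x = \<one>\<^bsub>H\<^esub>}" using hi[of a] hc[of "inv a"] by simp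
  qed (auto simp: hm hi hc)
qed

lemma fp_words_Nil [simp]: "[] \<in> fp_words V G"
  and fp_words_Cons [simp]: "(p # w) \<in> fp_words V G \<longleftrightarrow> fst p \<in> V \<and> snd p \<in> carrier (G (fst p)) \<and> w \<in> fp_words V G"
  and fp_words_append [simp]: "(w @ w') \<in> fp_words V G \<longleftrightarrow> w \<in> fp_words V G \<and> w' \<in> fp_words V G"
  by (cases p; auto simp: fp_words_def)+

section \<open>Free products and their universal property\<close>

locale group_family =
  fixes V :: "'v set" and G :: "'v \<Rightarrow> 'a monoid"
  assumes groups: "u \<in> V \<Longrightarrow> group (G u)"
begin

abbreviation "F \<equiv> free_product V G"

lemma fp_eq_words: "fp_eq V G w w' \<Longrightarrow> w \<in> fp_words V G \<and> w' \<in> fp_words V G"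
proof (induction rule: fp_eq.induct)
  case (one x y u)
  then show ?case using group.is_monoid[OF groups] by (simp add: monoid.one_closed)
next
  case (mult x y u a b)
  then show ?case using group.is_monoid[OF groups] by (simp add: monoid.m_closed)
qed auto

lemma fp_eq_append:
  assumes "fp_eq V G w w'" "x \<in> fp_words V G" "y \<in> fp_words V G"
  shows "fp_eq V G (x @ w @ y) (x @ w' @ y)"
  using assms(1)
proof (induction rule: fp_eq.induct)
  case (refl w)
  then show ?case using assms by (intro fp_eq.refl) simp
next
  case (one x' y' u)
  then show ?case using assms fp_eq.one[of "x @ x'" V G "y' @ y" u] by simp
next
  case (mult x' y' u a b)
  then show ?case using assms fp_eq.mult[of "x @ x'" V G "y' @ y" u a b] by simp
qed (blast intro: fp_eq.sym fp_eq.trans)+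

lemma fp_eq_append2:
  assumes "fp_eq V G w w'" "fp_eq V G x x'"
  shows "fp_eq V G (w @ x) (w' @ x')"
proof -
  have "fp_eq V G (w @ x) (w' @ x)"
    using fp_eq_append[OF assms(1), of "[]" x] fp_eq_words[OF assms(2)] by simp
  moreover have "fp_eq V G (w' @ x) (w' @ x')"
    using fp_eq_append[OF assms(2), of w' "[]"] fp_eq_words[OF assms(1)] by simp
  ultimately show ?thesis by (rule fp_eq.trans)
qed

lemma fp_class_eq_iff:
  assumes "w \<in> fp_words V G" shows "fp_class V G w = fp_class V G w' \<longleftrightarrow> fp_eq V G w w'"
  unfolding fp_class_def using assms by (blast intro: fp_eq.refl fp_eq.sym fp_eq.trans)

lemma fp_class_memI: "w \<in> fp_words V G \<Longrightarrow> w \<in> fp_class V G w"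
  unfolding fp_class_def by (simp add: fp_eq.refl)

lemma carrier_free_product: "carrier F = fp_class V G ` fp_words V G"
  and one_free_product: "\<one>\<^bsub>F\<^esub> = fp_class V G []"
  by (simp_all add: free_product_def)

lemma fp_class_closed [simp]: "w \<in> fp_words V G \<Longrightarrow> fp_class V G w \<in> carrier F"
  by (simp add: carrier_free_product)

lemma mult_free_product:
  assumes "w \<in> fp_words V G" "w' \<in> fp_words V G"
  shows "fp_class V G w \<otimes>\<^bsub>F\<^esub> fp_class V G w' = fp_class V G (w @ w')"
proof -
  have "fp_class V G (x @ y) = fp_class V G (w @ w')"
    if "x \<in> fp_class V G w" "y \<in> fp_class V G w'" for x y
    using that fp_eq_append2[of w x w' y] fp_class_eq_iff[of "w @ w'" "x @ y"] assms
    by (simp add: fp_class_def)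
  then have "(\<Union>x\<in>fp_class V G w. \<Union>y\<in>fp_class V G w'. fp_class V G (x @ y)) = fp_class V G (w @ w')"
    using fp_class_memI assms by blast
  then show ?thesis by (simp add: free_product_def)
qed

lemma fp_class_left_inverse:
  assumes "w \<in> fp_words V G"
  shows "\<exists>w'\<in>fp_words V G. fp_eq V G (w' @ w) []"
  using assms
proof (induction w)
  case Nil
  have "fp_eq V G [] []" by (rule fp_eq.refl) simp
  then show ?case by (intro bexI[of _ "[]"]) simp_all
next
  case (Cons p w)
  obtain u a where p: "p = (u, a)" by fastforce
  have u: "u \<in> V" "a \<in> carrier (G u)" "w \<in> fp_words V G" using Cons.prems p by auto
  interpret Gu: group "G u" by (rule groups) fact
  obtain w' where w': "w' \<in> fp_words V G" "fp_eq V G (w' @ w) []" using Cons.IH u by blast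
  have "fp_eq V G (w' @ [(u, inv\<^bsub>G u\<^esub> a), (u, a)] @ w) (w' @ [(u, inv\<^bsub>G u\<^esub> a \<otimes>\<^bsub>G u\<^esub> a)] @ w)"
    using u w' by (intro fp_eq.mult) simp_all
  moreover have "fp_eq V G (w' @ [(u, \<one>\<^bsub>G u\<^esub>)] @ w) (w' @ w)"
    using u w' by (intro fp_eq.one) simp_all
  ultimately have "fp_eq V G ((w' @ [(u, inv\<^bsub>G u\<^esub> a)]) @ p # w) []"
    using u w' p by (auto intro: fp_eq.trans)
  then show ?case using u w' by (intro bexI[of _ "w' @ [(u, inv\<^bsub>G u\<^esub> a)]"]) simp_all
qed

lemma group_free_product: "group F"
proof (rule groupI)
  fix x y assume "x \<in> carrier F" "y \<in> carrier F"
  then show "x \<otimes>\<^bsub>F\<^esub> y \<in> carrier F" by (auto simp: carrier_free_product mult_free_product)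
next
  fix x y z assume "x \<in> carrier F" "y \<in> carrier F" "z \<in> carrier F"
  then show "x \<otimes>\<^bsub>F\<^esub> y \<otimes>\<^bsub>F\<^esub> z = x \<otimes>\<^bsub>F\<^esub> (y \<otimes>\<^bsub>F\<^esub> z)"
    by (auto simp: carrier_free_product mult_free_product)
next
  fix x assume "x \<in> carrier F"
  then obtain w where w: "w \<in> fp_words V G" "x = fp_class V G w" by (auto simp: carrier_free_product)
  then show "\<one>\<^bsub>F\<^esub> \<otimes>\<^bsub>F\<^esub> x = x" by (simp add: one_free_product mult_free_product)
  obtain w' where w': "w' \<in> fp_words V G" "fp_eq V G (w' @ w) []" using fp_class_left_inverse w by blast
  then have "fp_class V G w' \<otimes>\<^bsub>F\<^esub> x = \<one>\<^bsub>F\<^esub>"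
    using w by (simp add: one_free_product mult_free_product fp_class_eq_iff)
  then show "\<exists>y\<in>carrier F. y \<otimes>\<^bsub>F\<^esub> x = \<one>\<^bsub>F\<^esub>" using w' by (blast intro: fp_class_closed)
qed (simp add: one_free_product)

lemma free_product_universal:
  assumes "monoid H"
    and hom: "\<And>u. u \<in> V \<Longrightarrow> f u \<in> hom (G u) H"
    and one: "\<And>u. u \<in> V \<Longrightarrow> f u \<one>\<^bsub>G u\<^esub> = \<one>\<^bsub>H\<^esub>"
  obtains \<phi> where "\<phi> \<in> hom F H" "\<phi> \<one>\<^bsub>F\<^esub> = \<one>\<^bsub>H\<^esub>"
    "\<And>u a. u \<in> V \<Longrightarrow> a \<in> carrier (G u) \<Longrightarrow> \<phi> (fp_class V G [(u, a)]) = f u a"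
proof -
  interpret H: monoid H by fact
  have fc: "f u a \<in> carrier H" if "u \<in> V" "a \<in> carrier (G u)" for u a
    using hom_in_carrier[OF hom] that by blast
  define ev where "ev w = foldr (\<lambda>p h. f (fst p) (snd p) \<otimes>\<^bsub>H\<^esub> h) w \<one>\<^bsub>H\<^esub>" for w
  have ev_Nil: "ev [] = \<one>\<^bsub>H\<^esub>" and ev_Cons: "ev ((u, a) # w) = f u a \<otimes>\<^bsub>H\<^esub> ev w" for u a w
    by (simp_all add: ev_def)
  have ev_closed: "ev w \<in> carrier H" if "w \<in> fp_words V G" for w
    using that by (induction w) (auto simp: ev_Nil ev_Cons fc)
  have ev_append: "ev (w @ w') = ev w \<otimes>\<^bsub>H\<^esub> ev w'" if "w \<in> fp_words V G" "w' \<in> fp_words V G" for w w'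
    using that by (induction w) (auto simp: ev_Nil ev_Cons fc H.m_assoc ev_closed)
  have ev_eq: "ev w = ev w'" if "fp_eq V G w w'" for w w'
    using that
  proof (induction rule: fp_eq.induct)
    case (one x y u)
    interpret Gu: group "G u" by (rule groups) fact
    show ?case using one by (simp add: ev_append ev_Cons assms(3) ev_closed)
  next
    case (mult x y u a b)
    interpret Gu: group "G u" by (rule groups) fact
    show ?case using mult
      by (simp add: ev_append ev_Cons ev_closed hom_mult[OF hom] fc H.m_assoc)
  qed auto
  \<comment> \<open>Any representative serves, because \<open>ev_eq\<close> makes evaluation
    constant on classes.\<close>
  define \<phi> where "\<phi> c = ev (SOME w. w \<in> c)" for c
  have \<phi>: "\<phi> (fp_class V G w) = ev w" if "w \<in> fp_words V G" for w
  proof -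
    have "(SOME w'. w' \<in> fp_class V G w) \<in> fp_class V G w"
      using fp_class_memI[OF that] by (rule someI)
    then show ?thesis using ev_eq by (simp add: \<phi>_def fp_class_def)
  qed
  show thesis
  proof
    show "\<phi> \<in> hom F H"
      by (rule homI) (auto simp: carrier_free_product mult_free_product \<phi> ev_closed ev_append)
    show "\<phi> \<one>\<^bsub>F\<^esub> = \<one>\<^bsub>H\<^esub>" by (simp add: one_free_product \<phi> ev_Nil)
    show "\<phi> (fp_class V G [(u, a)]) = f u a" if "u \<in> V" "a \<in> carrier (G u)" for u a
      using that by (simp add: \<phi> ev_Nil ev_Cons fc)
  qed
qed

end

lemma normal_closure_normal:
  assumes "group K" "S \<subseteq> carrier K"
  shows "normal_closure K S \<lhd> K" "S \<subseteq> normal_closure K S"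
proof -
  interpret K: group K by fact
  let ?\<N> = "{N. N \<lhd> K \<and> S \<subseteq> N}"
  have sub: "subgroup (normal_closure K S) K"
    unfolding normal_closure_def
  proof (rule K.subgroups_Inter)
    have "carrier K \<lhd> K" using K.normal_inv_iff K.subgroup_self by simp
    then show "?\<N> \<noteq> {}" using assms(2) by blast
  qed (auto simp: K.normal_inv_iff)
  then show "normal_closure K S \<lhd> K"
    unfolding K.normal_inv_iff unfolding normal_closure_def by (auto simp: K.normal_inv_iff)
  show "S \<subseteq> normal_closure K S" by (auto simp: normal_closure_def)
qed

definition vertex_emb ::
  "'v set \<Rightarrow> 'v set set \<Rightarrow> ('v set \<Rightarrow> nat) \<Rightarrow> ('v \<Rightarrow> 'a monoid) \<Rightarrow> 'v \<Rightarrow> 'a \<Rightarrow> ('v, 'a) periagroup_elem"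
where
  "vertex_emb V E lab G u a =
    periagroup_kernel V E lab G #>\<^bsub>free_product V G\<^esub> fp_class V G [(u, a)]"

section \<open>The periagroup as a quotient: generators, relations, induction and universal
  property\<close>

context periagroup_data
begin

sublocale group_family V G
  by (rule group_family.intro) (rule vertex_group)

sublocale F: group F
  by (rule group_free_product)

abbreviation "P \<equiv> periagroup V E lab G"
abbreviation "K \<equiv> periagroup_kernel V E lab G"
abbreviation "\<iota> \<equiv> vertex_emb V E lab G"

lemma edge_vertices: "{u, v} \<in> E \<Longrightarrow> u \<in> V \<and> v \<in> V \<and> u \<noteq> v"
  using graph unfolding simplicial_graph_def by (metis doubleton_eq_iff)

lemma alternating_words:
  "u \<in> V \<Longrightarrow> v \<in> V \<Longrightarrow> a \<in> carrier (G u) \<Longrightarrow> b \<in> carrier (G v)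
    \<Longrightarrow> alternating k (u, a) (v, b) \<in> fp_words V G"
  by (induction k arbitrary: u v a b) auto

lemma fp_class_alternating:
  "u \<in> V \<Longrightarrow> v \<in> V \<Longrightarrow> a \<in> carrier (G u) \<Longrightarrow> b \<in> carrier (G v)
    \<Longrightarrow> fp_class V G (alternating k (u, a) (v, b))
      = alt_prod F k (fp_class V G [(u, a)]) (fp_class V G [(v, b)])"
proof (induction k arbitrary: u v a b)
  case (Suc k)
  have "fp_class V G (alternating (Suc k) (u, a) (v, b))
      = fp_class V G [(u, a)] \<otimes>\<^bsub>F\<^esub> fp_class V G (alternating k (v, b) (u, a))"
    using Suc.prems alternating_words by (simp add: mult_free_product)
  then show ?case using Suc by simp
qed (simp add: one_free_product)

lemma relators_closed: "periagroup_relators V E lab G \<subseteq> carrier F"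
  by (auto simp: periagroup_relators_def dest!: edge_vertices
      intro!: F.m_closed F.inv_closed fp_class_closed alternating_words)

lemma kernel_normal: "K \<lhd> F" and relators_kernel: "periagroup_relators V E lab G \<subseteq> K"
  unfolding periagroup_kernel_def
  using normal_closure_normal[OF F.is_group relators_closed] by auto

sublocale K: normal K F
  by (rule kernel_normal)

sublocale P: group P
  unfolding periagroup_def by (rule K.factorgroup_is_group)

lemma proj_hom: "(\<lambda>x. K #>\<^bsub>F\<^esub> x) \<in> hom F P"
  unfolding periagroup_def by (rule K.r_coset_hom_Mod)

lemma proj_one: "K #>\<^bsub>F\<^esub> \<one>\<^bsub>F\<^esub> = \<one>\<^bsub>P\<^esub>"
  using group_hom.hom_one[of F P "\<lambda>x. K #>\<^bsub>F\<^esub> x"] proj_hom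
  by (simp add: group_hom_def group_hom_axioms_def F.is_group P.is_group)

lemma \<iota>_closed [simp]: "u \<in> V \<Longrightarrow> a \<in> carrier (G u) \<Longrightarrow> \<iota> u a \<in> carrier P"
  unfolding vertex_emb_def using hom_in_carrier[OF proj_hom] by simp

lemma \<iota>_mult:
  assumes "u \<in> V" "a \<in> carrier (G u)" "b \<in> carrier (G u)"
  shows "\<iota> u (a \<otimes>\<^bsub>G u\<^esub> b) = \<iota> u a \<otimes>\<^bsub>P\<^esub> \<iota> u b"
proof -
  interpret Gu: group "G u" by (rule groups) fact
  have "fp_eq V G [(u, a), (u, b)] [(u, a \<otimes>\<^bsub>G u\<^esub> b)]"
    using fp_eq.mult[of "[]" V G "[]" u a b] assms by simp
  then have "fp_class V G [(u, a \<otimes>\<^bsub>G u\<^esub> b)] = fp_class V G [(u, a)] \<otimes>\<^bsub>F\<^esub> fp_class V G [(u, b)]"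
    using assms by (simp add: mult_free_product fp_class_eq_iff fp_eq.sym)
  then show ?thesis
    unfolding vertex_emb_def using assms by (simp add: hom_mult[OF proj_hom])
qed

lemma \<iota>_hom: "u \<in> V \<Longrightarrow> \<iota> u \<in> hom (G u) P"
  by (rule homI) (simp_all add: \<iota>_mult)

lemma \<iota>_one [simp]:
  assumes "u \<in> V" shows "\<iota> u \<one>\<^bsub>G u\<^esub> = \<one>\<^bsub>P\<^esub>"
  using group_hom.hom_one[of "G u" P "\<iota> u"] \<iota>_hom[OF assms]
  by (simp add: group_hom_def group_hom_axioms_def groups assms P.is_group)

lemma \<iota>_relation:
  assumes "{u, v} \<in> E" "a \<in> carrier (G u) - {\<one>\<^bsub>G u\<^esub>}" "b \<in> carrier (G v) - {\<one>\<^bsub>G v\<^esub>}"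
  shows "alt_prod P (lab {u, v}) (\<iota> u a) (\<iota> v b) = alt_prod P (lab {u, v}) (\<iota> v b) (\<iota> u a)"
proof -
  let ?x = "fp_class V G (alternating (lab {u, v}) (u, a) (v, b))"
  let ?y = "fp_class V G (alternating (lab {u, v}) (v, b) (u, a))"
  have uv: "u \<in> V" "v \<in> V" using edge_vertices assms by auto
  have xy: "?x \<in> carrier F" "?y \<in> carrier F" using uv assms alternating_words by auto
  have "?x \<otimes>\<^bsub>F\<^esub> inv\<^bsub>F\<^esub> ?y \<in> K"
    using relators_kernel assms unfolding periagroup_relators_def by blast
  then have "K #>\<^bsub>F\<^esub> ?x = K #>\<^bsub>F\<^esub> ?y"
    using xy K.subgroup_axioms
    by (metis F.coset_join2 F.coset_mult_inv1 F.inv_closed F.m_closed K.subset)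
  then show ?thesis
    using uv assms unfolding vertex_emb_def
    by (simp add: fp_class_alternating hom_alt_prod[OF proj_hom proj_one F.is_monoid])
qed

lemma P_induct [consumes 1, case_names one step]:
  assumes "x \<in> carrier P" "Q \<one>\<^bsub>P\<^esub>"
    and "\<And>u a x. u \<in> V \<Longrightarrow> a \<in> carrier (G u) \<Longrightarrow> x \<in> carrier P \<Longrightarrow> Q x \<Longrightarrow> Q (\<iota> u a \<otimes>\<^bsub>P\<^esub> x)"
  shows "Q x"
proof -
  have "Q (K #>\<^bsub>F\<^esub> fp_class V G w)" if "w \<in> fp_words V G" for w
    using that
  proof (induction w)
    case Nil
    then show ?case using assms(2) proj_one by (simp add: one_free_product)
  next
    case (Cons p w)
    obtain u a where p: "p = (u, a)" by fastforce
    have "fp_class V G (p # w) = fp_class V G [(u, a)] \<otimes>\<^bsub>F\<^esub> fp_class V G w"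
      using Cons p by (simp add: mult_free_product)
    then show ?case
      using Cons p assms(3)[of u a "K #>\<^bsub>F\<^esub> fp_class V G w"]
      by (simp add: hom_mult[OF proj_hom] hom_in_carrier[OF proj_hom] vertex_emb_def)
  qed
  then show ?thesis
    using assms(1) by (auto simp: periagroup_def carrier_FactGroup carrier_free_product)
qed

lemma P_rev_induct [consumes 1, case_names one step]:
  assumes "x \<in> carrier P" "Q \<one>\<^bsub>P\<^esub>"
    and "\<And>u a x. u \<in> V \<Longrightarrow> a \<in> carrier (G u) \<Longrightarrow> x \<in> carrier P \<Longrightarrow> Q x \<Longrightarrow> Q (x \<otimes>\<^bsub>P\<^esub> \<iota> u a)"
  shows "Q x"
proof -
  \<comment> \<open>Strengthening to all \<open>y\<close> allows left induction on \<open>x\<close>: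
    its first letter is moved onto \<open>y\<close>.\<close>
  have "\<forall>y\<in>carrier P. Q y \<longrightarrow> Q (y \<otimes>\<^bsub>P\<^esub> x)"
    using assms(1)
  proof (induction rule: P_induct)
    case (step u a x)
    then show ?case using assms(3) by (simp flip: P.m_assoc)
  qed simp
  then show ?thesis using assms(1,2) P.l_one by force
qed

lemma periagroup_universal:
  assumes "monoid H"
    and hom: "\<And>u. u \<in> V \<Longrightarrow> f u \<in> hom (G u) H"
    and one: "\<And>u. u \<in> V \<Longrightarrow> f u \<one>\<^bsub>G u\<^esub> = \<one>\<^bsub>H\<^esub>"
    and rel: "\<And>u v a b. {u, v} \<in> E \<Longrightarrow> a \<in> carrier (G u) - {\<one>\<^bsub>G u\<^esub>} \<Longrightarrow> b \<in> carrier (G v) - {\<one>\<^bsub>G v\<^esub>}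
      \<Longrightarrow> alt_prod H (lab {u, v}) (f u a) (f v b) = alt_prod H (lab {u, v}) (f v b) (f u a)"
  obtains \<phi> where "\<phi> \<in> hom P H" "\<phi> \<one>\<^bsub>P\<^esub> = \<one>\<^bsub>H\<^esub>"
    "\<And>u a. u \<in> V \<Longrightarrow> a \<in> carrier (G u) \<Longrightarrow> \<phi> (\<iota> u a) = f u a"
proof -
  interpret H: monoid H by fact
  obtain h where h: "h \<in> hom F H" "h \<one>\<^bsub>F\<^esub> = \<one>\<^bsub>H\<^esub>"
    "\<And>u a. u \<in> V \<Longrightarrow> a \<in> carrier (G u) \<Longrightarrow> h (fp_class V G [(u, a)]) = f u a"
    using free_product_universal[OF assms(1-3)] by blast
  have hc: "h x \<in> carrier H" if "x \<in> carrier F" for x using h(1) that by (rule hom_in_carrier)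
  have hm: "h (x \<otimes>\<^bsub>F\<^esub> y) = h x \<otimes>\<^bsub>H\<^esub> h y" if "x \<in> carrier F" "y \<in> carrier F" for x y
    using h(1) that by (rule hom_mult)
  let ?N = "{x \<in> carrier F. h x = \<one>\<^bsub>H\<^esub>}"
  have "periagroup_relators V E lab G \<subseteq> ?N"
  proof
    fix r assume "r \<in> periagroup_relators V E lab G"
    then obtain u v a b where r:
      "r = fp_class V G (alternating (lab {u, v}) (u, a) (v, b)) \<otimes>\<^bsub>F\<^esub>
         inv\<^bsub>F\<^esub> (fp_class V G (alternating (lab {u, v}) (v, b) (u, a)))" (is "r = ?x \<otimes>\<^bsub>F\<^esub> inv\<^bsub>F\<^esub> ?y")
      and e: "{u, v} \<in> E" "a \<in> carrier (G u) - {\<one>\<^bsub>G u\<^esub>}" "b \<in> carrier (G v) - {\<one>\<^bsub>G v\<^esub>}"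
      unfolding periagroup_relators_def by blast
    have uv: "u \<in> V" "v \<in> V" using edge_vertices e by auto
    have xy: "?x \<in> carrier F" "?y \<in> carrier F" using uv e alternating_words by auto
    have "h ?x = h ?y"
      using uv e rel[OF e] by (simp add: fp_class_alternating hom_alt_prod[OF h(1,2) F.is_monoid] h(3))
    \<comment> \<open>In a monoid the value on an inverse cannot be rewritten as an inverse, so
      \<open>r\<close> is compared with the product of \<open>?y\<close> and its own
      inverse.\<close>
    then have "h r = h (?y \<otimes>\<^bsub>F\<^esub> inv\<^bsub>F\<^esub> ?y)"
      unfolding r using xy hm[of _ "inv\<^bsub>F\<^esub> ?y"] by (metis F.inv_closed)
    then show "r \<in> ?N" using xy h(2) by (simp add: r)
  qed
  then have KN: "K \<subseteq> ?N"
    using F.normal_hom_kernel[OF assms(1) h(1,2)] unfolding periagroup_kernel_def normal_closure_def by blast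
  define \<phi> where "\<phi> c = h (SOME x. x \<in> c)" for c
  have \<phi>: "\<phi> (K #>\<^bsub>F\<^esub> x) = h x" if "x \<in> carrier F" for x
  proof -
    have "(SOME y. y \<in> K #>\<^bsub>F\<^esub> x) \<in> K #>\<^bsub>F\<^esub> x"
      using F.rcos_self[OF that K.subgroup_axioms] by (rule someI)
    then obtain k where "k \<in> K" "(SOME y. y \<in> K #>\<^bsub>F\<^esub> x) = k \<otimes>\<^bsub>F\<^esub> x"
      by (auto simp: r_coset_def)
    then show ?thesis using KN that hc by (auto simp: \<phi>_def hm)
  qed
  have carr: "carrier P = (\<lambda>x. K #>\<^bsub>F\<^esub> x) ` carrier F"
    by (simp add: periagroup_def carrier_FactGroup)
  show thesis
  proof
    show "\<phi> \<in> hom P H"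
    proof (rule homI)
      fix x y assume "x \<in> carrier P" "y \<in> carrier P"
      then obtain x' y' where *: "x' \<in> carrier F" "y' \<in> carrier F" "x = K #>\<^bsub>F\<^esub> x'" "y = K #>\<^bsub>F\<^esub> y'"
        using carr by auto
      then have "x \<otimes>\<^bsub>P\<^esub> y = K #>\<^bsub>F\<^esub> (x' \<otimes>\<^bsub>F\<^esub> y')" by (simp add: hom_mult[OF proj_hom])
      then show "\<phi> (x \<otimes>\<^bsub>P\<^esub> y) = \<phi> x \<otimes>\<^bsub>H\<^esub> \<phi> y" using * by (simp add: \<phi> hm)
    qed (auto simp: carr \<phi> hc)
    show "\<phi> \<one>\<^bsub>P\<^esub> = \<one>\<^bsub>H\<^esub>" using \<phi>[of "\<one>\<^bsub>F\<^esub>"] h(2) by (simp add: proj_one)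
    show "\<phi> (\<iota> u a) = f u a" if "u \<in> V" "a \<in> carrier (G u)" for u a
      unfolding vertex_emb_def using that by (simp add: \<phi> h(3))
  qed
qed

end

section \<open>Cocycles and reflection systems\<close>

definition conj_by :: "('a, 'b) monoid_scheme \<Rightarrow> 'a \<Rightarrow> 'a \<Rightarrow> 'a" where
  "conj_by M x r = x \<otimes>\<^bsub>M\<^esub> r \<otimes>\<^bsub>M\<^esub> inv\<^bsub>M\<^esub> x"

definition conj_set :: "('a, 'b) monoid_scheme \<Rightarrow> 'a \<Rightarrow> 'a set \<Rightarrow> 'a set" where
  "conj_set M x R = conj_by M x ` R"

context group
begin

lemma cancel_inv [simp]:
  assumes "x \<in> carrier G" "y \<in> carrier G"
  shows "inv x \<otimes> (x \<otimes> y) = y" "x \<otimes> (inv x \<otimes> y) = y"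
  using assms by (simp_all flip: m_assoc)

lemma conj_by_closed [simp]:
  "x \<in> carrier G \<Longrightarrow> r \<in> carrier G \<Longrightarrow> conj_by G x r \<in> carrier G"
  by (simp add: conj_by_def)

lemma conj_by_mult:
  "x \<in> carrier G \<Longrightarrow> r \<in> carrier G \<Longrightarrow> s \<in> carrier G
    \<Longrightarrow> conj_by G x (r \<otimes> s) = conj_by G x r \<otimes> conj_by G x s"
  by (simp add: conj_by_def m_assoc)

lemma conj_by_comp:
  "x \<in> carrier G \<Longrightarrow> y \<in> carrier G \<Longrightarrow> r \<in> carrier G
    \<Longrightarrow> conj_by G (x \<otimes> y) r = conj_by G x (conj_by G y r)"
  by (simp add: conj_by_def m_assoc inv_mult_group)

lemma conj_by_one [simp]: "r \<in> carrier G \<Longrightarrow> conj_by G \<one> r = r"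
  "x \<in> carrier G \<Longrightarrow> conj_by G x \<one> = \<one>"
  by (simp_all add: conj_by_def)

lemma conj_by_inv_cancel [simp]:
  assumes "x \<in> carrier G" "r \<in> carrier G"
  shows "conj_by G (inv x) (conj_by G x r) = r" "conj_by G x (conj_by G (inv x) r) = r"
  using assms by (simp_all flip: conj_by_comp)

lemma conj_by_inj: "x \<in> carrier G \<Longrightarrow> inj_on (conj_by G x) (carrier G)"
  by (metis conj_by_inv_cancel(1) inj_onI)

lemma conj_by_eq_one [simp]:
  "x \<in> carrier G \<Longrightarrow> r \<in> carrier G \<Longrightarrow> conj_by G x r = \<one> \<longleftrightarrow> r = \<one>"
  by (metis conj_by_inv_cancel(1) conj_by_one(2) inv_closed)

lemma conj_by_mult_right:
  "x \<in> carrier G \<Longrightarrow> r \<in> carrier G \<Longrightarrow> conj_by G x r \<otimes> x = x \<otimes> r"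
  by (simp add: conj_by_def m_assoc)

lemma conj_set_closed: "x \<in> carrier G \<Longrightarrow> R \<subseteq> carrier G \<Longrightarrow> conj_set G x R \<subseteq> carrier G"
  by (auto simp: conj_set_def)

lemma conj_set_comp:
  assumes "x \<in> carrier G" "y \<in> carrier G" "R \<subseteq> carrier G"
  shows "conj_set G (x \<otimes> y) R = conj_set G x (conj_set G y R)"
  using assms by (force simp: conj_set_def conj_by_comp)

lemma conj_set_one [simp]: "R \<subseteq> carrier G \<Longrightarrow> conj_set G \<one> R = R"
  by (force simp: conj_set_def)

lemma conj_set_inv_cancel [simp]:
  assumes "x \<in> carrier G" "R \<subseteq> carrier G"
  shows "conj_set G (inv x) (conj_set G x R) = R" "conj_set G x (conj_set G (inv x) R) = R"
  using assms by (simp_all flip: conj_set_comp)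

lemma conj_set_eq_iff:
  assumes "x \<in> carrier G" "R \<subseteq> carrier G" "Q \<subseteq> carrier G"
  shows "conj_set G (inv x) R = Q \<longleftrightarrow> R = conj_set G x Q"
  using assms by auto

lemma conj_set_subgroup:
  assumes "x \<in> carrier G" "subgroup R G" shows "subgroup (conj_set G x R) G"
proof (rule subgroupI)
  interpret R: subgroup R G by fact
  have sub: "R \<subseteq> carrier G" by (rule R.subset)
  show "conj_set G x R \<subseteq> carrier G" using assms(1) sub by (rule conj_set_closed)
  show "conj_set G x R \<noteq> {}" using R.one_closed unfolding conj_set_def by blast
  fix a assume "a \<in> conj_set G x R"
  then obtain r where r: "r \<in> R" "a = conj_by G x r" by (auto simp: conj_set_def)
  have "inv a = conj_by G x (inv r)"
    using assms(1) r by (simp add: conj_by_def inv_mult_group m_assoc)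
  then show "inv a \<in> conj_set G x R" using r by (simp add: conj_set_def)
  fix b assume "b \<in> conj_set G x R"
  then obtain s where s: "s \<in> R" "b = conj_by G x s" by (auto simp: conj_set_def)
  have "a \<otimes> b = conj_by G x (r \<otimes> s)" using assms(1) r s by (simp add: conj_by_mult)
  then show "a \<otimes> b \<in> conj_set G x R" using r s by (auto simp: conj_set_def)
qed

lemma conj_set_self:
  assumes "subgroup R G" "r \<in> R" shows "conj_set G r R = R"
proof -
  interpret R: subgroup R G by fact
  have *: "conj_set G s R \<subseteq> R" if "s \<in> R" for s
    using that by (auto simp: conj_set_def conj_by_def)
  have "R = conj_set G r (conj_set G (inv r) R)" using assms R.subset by simp
  also have "\<dots> \<subseteq> conj_set G r R" using *[of "inv r"] assms(2) by (auto simp: conj_set_def)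
  finally show ?thesis using *[OF assms(2)] by blast
qed

lemma conj_set_trivial:
  assumes "x \<in> carrier G" "R \<subseteq> carrier G" "conj_set G x R = {\<one>}" shows "R = {\<one>}"
  using conj_set_inv_cancel(1)[OF assms(1,2)] assms by (simp add: conj_set_def)

lemma alt_prod_snoc:
  assumes "a \<in> carrier G" "b \<in> carrier G"
  shows "alt_prod G (Suc k) a b = alt_prod G k a b \<otimes> (if even k then a else b)"
  using assms
proof (induction k arbitrary: a b)
  case (Suc k)
  have "alt_prod G (Suc (Suc k)) a b = a \<otimes> alt_prod G (Suc k) b a" by simp
  also have "\<dots> = a \<otimes> (alt_prod G k b a \<otimes> (if even k then b else a))"
    using Suc by simp
  also have "\<dots> = alt_prod G (Suc k) a b \<otimes> (if even (Suc k) then a else b)"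
    using Suc.prems by (simp add: m_assoc)
  finally show ?case .
qed simp

lemma alt_prod_add:
  assumes "a \<in> carrier G" "b \<in> carrier G"
  shows "alt_prod G (j + k) a b = alt_prod G j a b \<otimes> (if even j then alt_prod G k a b else alt_prod G k b a)"
  using assms by (induction j arbitrary: a b) (simp_all add: m_assoc)

end

text \<open>\<open>T\<close> is any conjugation-stable family, so that the same development serves
  the periagroup with all conjugates and the subgroup with its own hyperplanes. The cocycle law
  splits a path from the identity to the product at \<open>x\<close>; the second half is the
  translate by \<open>x\<close> of the path to \<open>y\<close> and crosses translated
  hyperplanes.\<close>

locale cocycle_group = group W for W (structure) +
  fixes T :: "'a set set" and \<sigma> :: "'a set \<Rightarrow> 'a \<Rightarrow> 'a"
  assumes T_subgroup: "R \<in> T \<Longrightarrow> subgroup R W"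
    and T_conj: "R \<in> T \<Longrightarrow> x \<in> carrier W \<Longrightarrow> conj_set W x R \<in> T"
    and cocycle_in: "R \<in> T \<Longrightarrow> x \<in> carrier W \<Longrightarrow> \<sigma> R x \<in> R"
    and cocycle: "R \<in> T \<Longrightarrow> x \<in> carrier W \<Longrightarrow> y \<in> carrier W \<Longrightarrow>
      \<sigma> (conj_set W x R) (x \<otimes> y) = conj_by W x (\<sigma> R y) \<otimes> \<sigma> (conj_set W x R) x"
begin

lemma T_sub: "R \<in> T \<Longrightarrow> R \<subseteq> carrier W"
  using T_subgroup subgroup.subset by blast

lemma cocycle_closed [simp]: "R \<in> T \<Longrightarrow> x \<in> carrier W \<Longrightarrow> \<sigma> R x \<in> carrier W"
  using cocycle_in T_sub by blast

lemma cocycle_one [simp]: assumes "R \<in> T" shows "\<sigma> R \<one> = \<one>"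
proof -
  have "\<sigma> R \<one> = \<sigma> R \<one> \<otimes> \<sigma> R \<one>"
    using cocycle[OF assms, of \<one> \<one>] assms T_sub[OF assms] by simp
  then show ?thesis using assms cocycle_closed[of R \<one>] by (metis l_cancel_one one_closed)
qed

lemma cocycle_mult:
  assumes "Q \<in> T" "x \<in> carrier W" "y \<in> carrier W"
  shows "\<sigma> Q (x \<otimes> y) = conj_by W x (\<sigma> (conj_set W (inv x) Q) y) \<otimes> \<sigma> Q x"
  using cocycle[of "conj_set W (inv x) Q" x y] T_conj assms T_sub by simp

definition N :: "'a \<Rightarrow> 'a set set" where
  "N x = {R \<in> T. \<sigma> R x \<noteq> \<one>}"

text \<open>The analogue of counting inversions in a Coxeter group. An infinite set would receive
  \<open>card\<close> zero; \<open>finite_N\<close> rules this out for reflection systems.\<close>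

definition len :: "'a \<Rightarrow> nat" where
  "len x = card (N x)"

lemma N_one [simp]: "N \<one> = {}"
  by (auto simp: N_def)

lemma len_one [simp]: "len \<one> = 0"
  by (simp add: len_def)

lemma N_mult:
  assumes "x \<in> carrier W" "y \<in> carrier W"
  shows "N (x \<otimes> y) \<subseteq> N x \<union> conj_set W x ` N y"
proof
  fix Q assume Q: "Q \<in> N (x \<otimes> y)"
  show "Q \<in> N x \<union> conj_set W x ` N y"
  proof (rule ccontr)
    assume *: "Q \<notin> N x \<union> conj_set W x ` N y"
    have QT: "Q \<in> T" using Q by (simp add: N_def)
    have "Q = conj_set W x (conj_set W (inv x) Q)" using QT T_sub assms by simp
    then have "conj_set W (inv x) Q \<notin> N y" using * by blast
    then have "\<sigma> (conj_set W (inv x) Q) y = \<one>" using QT T_conj assms by (simp add: N_def)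
    moreover have "\<sigma> Q x = \<one>" using * QT by (simp add: N_def)
    ultimately have "\<sigma> Q (x \<otimes> y) = \<one>" using QT assms by (simp add: cocycle_mult)
    then show False using Q by (simp add: N_def)
  qed
qed

lemma conj_set_inj_on_T: "x \<in> carrier W \<Longrightarrow> inj_on (conj_set W x) T"
  by (rule inj_on_inverseI[of _ "conj_set W (inv x)"]) (simp add: T_sub)

text \<open>Applied to \<open>x\<close> times its inverse, the cocycle law makes the value of the
  inverse on the translated hyperplane trivial exactly when the value of \<open>x\<close> on the
  original one is.\<close>

lemma N_inv: assumes "x \<in> carrier W" shows "N (inv x) = conj_set W (inv x) ` N x"
proof -
  have *: "conj_set W (inv x) ` N x \<subseteq> N (inv x)" if "x \<in> carrier W" for x
  proof
    fix Q assume "Q \<in> conj_set W (inv x) ` N x"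
    then obtain R where R: "R \<in> T" "\<sigma> R x \<noteq> \<one>" "Q = conj_set W (inv x) R" by (auto simp: N_def)
    have *: "conj_by W x (\<sigma> Q (inv x)) \<otimes> \<sigma> R x = \<one>"
      using cocycle_mult[of R x "inv x"] R that by simp
    have QT: "Q \<in> T" using R that T_conj by simp
    have "\<sigma> Q (inv x) \<noteq> \<one>"
    proof
      assume "\<sigma> Q (inv x) = \<one>"
      then show False using * R(1,2) that by simp
    qed
    then show "Q \<in> N (inv x)" using QT by (simp add: N_def)
  qed
  have "N (inv x) \<subseteq> conj_set W (inv x) ` N x"
  proof
    fix Q assume Q: "Q \<in> N (inv x)"
    then have "conj_set W x Q \<in> N x" using *[of "inv x"] assms by auto
    moreover have "Q = conj_set W (inv x) (conj_set W x Q)"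
      using Q T_sub assms by (simp add: N_def)
    ultimately show "Q \<in> conj_set W (inv x) ` N x" by blast
  qed
  then show ?thesis using *[OF assms] by blast
qed

lemma len_inv: "x \<in> carrier W \<Longrightarrow> len (inv x) = len x"
  unfolding len_def
  by (subst N_inv) (auto intro!: card_image inj_on_subset[OF conj_set_inj_on_T] simp: N_def)

end

text \<open>The members of \<Delta> are the walls of the chamber of the identity. Demanding the
  value \<open>r\<close> itself on the own wall, and not merely a nontrivial one, identifies a
  crossed sector with the letter crossing it.\<close>

locale reflection_system = cocycle_group W T \<sigma> for W (structure) and T \<sigma> +
  fixes \<Delta> :: "'a set set"
  assumes \<Delta>_T: "\<Delta> \<subseteq> T"
    and \<Delta>_nontrivial: "R \<in> \<Delta> \<Longrightarrow> R \<noteq> {\<one>}"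
    and cocycle_gen: "R \<in> \<Delta> \<Longrightarrow> r \<in> R \<Longrightarrow> Q \<in> T \<Longrightarrow> \<sigma> Q r = (if Q = R then r else \<one>)"
    and generated: "generate W (\<Union>\<Delta>) = carrier W"
begin

lemma gen_T: "R \<in> \<Delta> \<Longrightarrow> R \<in> T"
  using \<Delta>_T by blast

lemma gen_closed: "R \<in> \<Delta> \<Longrightarrow> r \<in> R \<Longrightarrow> r \<in> carrier W"
  using gen_T T_sub by blast

lemma gen_inv: "R \<in> \<Delta> \<Longrightarrow> r \<in> R \<Longrightarrow> inv r \<in> R"
  using gen_T T_subgroup subgroup.m_inv_closed by fastforce

lemma gen_mult: "R \<in> \<Delta> \<Longrightarrow> r \<in> R \<Longrightarrow> s \<in> R \<Longrightarrow> r \<otimes> s \<in> R"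
  using gen_T T_subgroup subgroup.m_closed by fastforce

lemma gen_nontrivial: "R \<in> \<Delta> \<Longrightarrow> \<exists>r\<in>R. r \<noteq> \<one>"
  using \<Delta>_nontrivial gen_T T_subgroup subgroup.one_closed by blast

text \<open>Membership in both subgroups gives the value \<open>r\<close> and the trivial value for
  the same \<sigma>.\<close>

lemma gen_inter: "R \<in> \<Delta> \<Longrightarrow> Q \<in> \<Delta> \<Longrightarrow> R \<noteq> Q \<Longrightarrow> r \<in> R \<Longrightarrow> r \<in> Q \<Longrightarrow> r = \<one>"
  using cocycle_gen[of R r Q] cocycle_gen[of Q r Q] gen_T by simp

lemma W_induct [consumes 1, case_names one step]:
  assumes "x \<in> carrier W" "P \<one>"
    and step: "\<And>R s x. R \<in> \<Delta> \<Longrightarrow> s \<in> R \<Longrightarrow> x \<in> carrier W \<Longrightarrow> P x \<Longrightarrow> P (s \<otimes> x)"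
  shows "P x"
proof -
  have "x \<in> generate W (\<Union>\<Delta>)" using assms(1) generated by simp
  then have "\<forall>y\<in>carrier W. P y \<longrightarrow> P (x \<otimes> y)"
  proof (induction rule: generate.induct)
    case (inv h)
    then show ?case using gen_inv step by blast
  next
    case (eng h1 h2)
    then have "h1 \<in> carrier W" "h2 \<in> carrier W" using generated by auto
    then show ?case using eng by (simp add: m_assoc)
  qed (use step in auto)
  then show ?thesis using assms(1,2) by fastforce
qed

text \<open>A letter of \<open>R\<close> fixes its own wall and moves the sectors there by left
  translation; every other hyperplane is merely conjugated.\<close>

lemma cocycle_letter_same:
  assumes "R \<in> \<Delta>" "s \<in> R" "x \<in> carrier W"
  shows "\<sigma> R (s \<otimes> x) = s \<otimes> \<sigma> R x"
proof -
  have R: "R \<in> T" and s: "s \<in> carrier W" using assms gen_T gen_closed by auto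
  have "conj_set W (inv s) R = R"
    using conj_set_self[OF T_subgroup[OF R], of "inv s"] gen_inv assms by simp
  then have "\<sigma> R (s \<otimes> x) = conj_by W s (\<sigma> R x) \<otimes> s"
    using R s assms by (simp add: cocycle_mult cocycle_gen)
  then show ?thesis using R s assms by (simp add: conj_by_mult_right)
qed

lemma cocycle_letter_other:
  assumes "R \<in> \<Delta>" "s \<in> R" "x \<in> carrier W" "Q \<in> T" "Q \<noteq> R"
  shows "\<sigma> Q (s \<otimes> x) = conj_by W s (\<sigma> (conj_set W (inv s) Q) x)"
  using assms gen_closed[of R s] T_conj[of Q "inv s"]
  by (simp add: cocycle_mult cocycle_gen)

lemma conj_set_eq_gen:
  assumes "R \<in> \<Delta>" "s \<in> R" "Q \<in> T"
  shows "conj_set W s Q = R \<longleftrightarrow> Q = R"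
proof -
  have s: "s \<in> carrier W" using assms gen_closed by auto
  have "conj_set W s R = R" using conj_set_self[OF T_subgroup] gen_T assms by simp
  then show ?thesis
    using inj_onD[OF conj_set_inj_on_T[OF s], of Q R] gen_T assms by auto
qed

text \<open>Away from its own wall, a letter only relabels hyperplanes by an injective conjugation.
  Hence it changes the length by at most one, and \<sigma> on that wall decides how.\<close>

lemma N_letter:
  assumes "R \<in> \<Delta>" "s \<in> R" "x \<in> carrier W"
  shows "N (s \<otimes> x) - {R} = conj_set W s ` (N x - {R})"
proof -
  have s: "s \<in> carrier W" using assms gen_closed by auto
  have *: "Q \<in> N (s \<otimes> x) \<longleftrightarrow> conj_set W (inv s) Q \<in> N x" if "Q \<in> T" "Q \<noteq> R" for Q
    using that s assms T_conj[of Q "inv s"] cocycle_closed[of "conj_set W (inv s) Q" x]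
    by (simp add: N_def cocycle_letter_other)
  have **: "conj_set W (inv s) Q \<noteq> R \<longleftrightarrow> Q \<noteq> R" if "Q \<in> T" for Q
    using conj_set_eq_gen[OF assms(1) gen_inv[OF assms(1,2)] that] by simp
  have NT: "N y \<subseteq> T" for y by (auto simp: N_def)
  show ?thesis
  proof (intro subset_antisym subsetI)
    fix Q assume Q: "Q \<in> N (s \<otimes> x) - {R}"
    then have QT: "Q \<in> T" "Q \<noteq> R" using NT by auto
    then have "conj_set W (inv s) Q \<in> N x - {R}" using Q * ** by auto
    moreover have "Q = conj_set W s (conj_set W (inv s) Q)" using QT T_sub s by simp
    ultimately show "Q \<in> conj_set W s ` (N x - {R})" by blast
  next
    fix Q assume "Q \<in> conj_set W s ` (N x - {R})"
    then obtain Q' where Q': "Q' \<in> N x" "Q' \<noteq> R" "Q = conj_set W s Q'" by auto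
    then have "Q' \<in> T" using NT by auto
    then have "Q \<in> T" "Q \<noteq> R" "conj_set W (inv s) Q = Q'"
      using Q' T_conj s conj_set_eq_gen assms T_sub by auto
    then show "Q \<in> N (s \<otimes> x) - {R}" using * Q' by simp
  qed
qed

lemma finite_N: "x \<in> carrier W \<Longrightarrow> finite (N x)"
proof (induction rule: W_induct)
  case (step R s x)
  then have "finite (N (s \<otimes> x) - {R})" by (simp add: N_letter)
  then show ?case by simp
qed simp

lemma card_N_letter:
  assumes "R \<in> \<Delta>" "s \<in> R" "x \<in> carrier W"
  shows "card (N (s \<otimes> x) - {R}) = card (N x - {R})"
  unfolding N_letter[OF assms] using gen_closed[OF assms(1,2)]
  by (intro card_image inj_on_subset[OF conj_set_inj_on_T]) (auto simp: N_def)

lemma in_N_gen: "R \<in> \<Delta> \<Longrightarrow> R \<in> N x \<longleftrightarrow> \<sigma> R x \<noteq> \<one>"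
  using gen_T by (simp add: N_def)

lemma len_split:
  assumes "R \<in> \<Delta>" "x \<in> carrier W"
  shows "len x = card (N x - {R}) + (if \<sigma> R x = \<one> then 0 else 1)"
proof (cases "\<sigma> R x = \<one>")
  case True
  then have "N x - {R} = N x" using in_N_gen[OF assms(1)] by blast
  then show ?thesis using True by (simp add: len_def)
next
  case False
  then have "Suc (card (N x - {R})) = card (N x)"
    using finite_N[OF assms(2)] in_N_gen[OF assms(1)] by (intro card_Suc_Diff1) simp_all
  then show ?thesis using False by (simp add: len_def)
qed

lemma len_up:
  assumes "R \<in> \<Delta>" "s \<in> R" "x \<in> carrier W" "s \<noteq> \<one>" "\<sigma> R x = \<one>"
  shows "len (s \<otimes> x) = Suc (len x)"
  using assms gen_closed[OF assms(1,2)] card_N_letter[OF assms(1-3)]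
  by (simp add: len_split[OF assms(1)] cocycle_letter_same)

lemma len_letter_le:
  assumes "R \<in> \<Delta>" "s \<in> R" "x \<in> carrier W"
  shows "len (s \<otimes> x) \<le> Suc (len x)"
  using assms gen_closed[OF assms(1,2)] card_N_letter[OF assms(1-3)]
  by (simp add: len_split[OF assms(1)])

lemma len_letter_eq:
  assumes "R \<in> \<Delta>" "s \<in> R" "x \<in> carrier W" "len (s \<otimes> x) = Suc (len x)"
  shows "\<sigma> R x = \<one>" "\<sigma> R (s \<otimes> x) = s" "s \<noteq> \<one>"
proof -
  have s: "s \<in> carrier W" using assms gen_closed by auto
  show *: "\<sigma> R x = \<one>"
    using assms(4) card_N_letter[OF assms(1-3)] len_split[OF assms(1), of x]
      len_split[OF assms(1), of "s \<otimes> x"] s assms(3)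
    by (cases "\<sigma> R x = \<one>"; cases "\<sigma> R (s \<otimes> x) = \<one>") simp_all
  then show "\<sigma> R (s \<otimes> x) = s" using assms s by (simp add: cocycle_letter_same)
  show "s \<noteq> \<one>" using assms by auto
qed

text \<open>Left division by the value of \<sigma> on \<open>R\<close> moves \<open>x\<close> into
  the identity's sector of \<open>R\<close>; this is the only letter of \<open>R\<close> that
  shortens \<open>x\<close>.\<close>

lemma len_down:
  assumes "R \<in> \<Delta>" "x \<in> carrier W" "\<sigma> R x \<noteq> \<one>"
  shows "len x = Suc (len (inv (\<sigma> R x) \<otimes> x))" "\<sigma> R (inv (\<sigma> R x) \<otimes> x) = \<one>"
proof -
  have a: "inv (\<sigma> R x) \<in> R" "\<sigma> R x \<in> carrier W"
    using assms gen_T cocycle_in gen_inv by auto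
  then show *: "\<sigma> R (inv (\<sigma> R x) \<otimes> x) = \<one>" using assms by (simp add: cocycle_letter_same)
  show "len x = Suc (len (inv (\<sigma> R x) \<otimes> x))"
    using card_N_letter[OF assms(1) a(1) assms(2)] * a assms by (simp add: len_split[OF assms(1)])
qed

lemma len_mult:
  assumes "x \<in> carrier W" "y \<in> carrier W" shows "len (x \<otimes> y) \<le> len x + len y"
proof -
  have "len (x \<otimes> y) \<le> card (N x \<union> conj_set W x ` N y)"
    unfolding len_def using assms by (intro card_mono N_mult) (auto intro: finite_N)
  also have "\<dots> \<le> card (N x) + card (conj_set W x ` N y)" by (rule card_Un_le)
  also have "\<dots> \<le> len x + len y" unfolding len_def using finite_N assms by (simp add: card_image_le)
  finally show ?thesis .
qed

lemma len_gen_le: "R \<in> \<Delta> \<Longrightarrow> s \<in> R \<Longrightarrow> len s \<le> 1"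
  using len_letter_le[of R s \<one>] gen_closed[of R s] by simp

text \<open>Words need not be reduced and may contain trivial letters, so \<open>n\<close> only
  bounds the length from above.\<close>

inductive word_prod :: "nat \<Rightarrow> 'a \<Rightarrow> bool" where
  one: "word_prod 0 \<one>"
| step: "word_prod n x \<Longrightarrow> R \<in> \<Delta> \<Longrightarrow> s \<in> R \<Longrightarrow> word_prod (Suc n) (s \<otimes> x)"

lemma word_prod_closed: "word_prod n x \<Longrightarrow> x \<in> carrier W"
  by (induction rule: word_prod.induct) (auto simp: gen_closed)

lemma word_prod_exists: "x \<in> carrier W \<Longrightarrow> \<exists>n. word_prod n x"
  by (induction rule: W_induct) (blast intro: word_prod.intros)+

text \<open>Induction from the front. If the first letter belongs to another subgroup,
  \<open>Q\<close> is conjugated into the tail. If it belongs to \<open>Q\<close>, the correcting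
  element absorbs it and the question passes to the tail. Several letters may cross the same
  hyperplane, so more than one can disappear and only \<open>j < n\<close> is claimed.\<close>

lemma strong_exchange:
  "word_prod n x \<Longrightarrow> Q \<in> T \<Longrightarrow> \<sigma> Q x \<noteq> \<one> \<Longrightarrow> \<exists>j<n. word_prod j (inv (\<sigma> Q x) \<otimes> x)"
proof (induction arbitrary: Q rule: word_prod.induct)
  case (step n x R s)
  have x: "x \<in> carrier W" and s: "s \<in> carrier W"
    using step word_prod_closed gen_closed by auto
  show ?case
  proof (cases "Q = R")
    case True
    have *: "inv (\<sigma> Q (s \<otimes> x)) \<otimes> (s \<otimes> x) = inv (\<sigma> Q x) \<otimes> x"
      using True step x s cocycle_closed[of Q x] by (simp add: cocycle_letter_same inv_mult_group m_assoc)
    show ?thesis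
    proof (cases "\<sigma> Q x = \<one>")
      case True
      then show ?thesis using step.hyps(1) x unfolding * by auto
    next
      case False
      then show ?thesis using step.IH[OF step.prems(1)] unfolding * by (meson less_SucI)
    qed
  next
    case False
    let ?Q = "conj_set W (inv s) Q"
    have Q: "?Q \<in> T" using step s T_conj by simp
    have \<sigma>: "\<sigma> Q (s \<otimes> x) = conj_by W s (\<sigma> ?Q x)"
      using step False x by (simp add: cocycle_letter_other)
    then have "\<sigma> ?Q x \<noteq> \<one>" using step s by auto
    then obtain j where j: "j < n" "word_prod j (inv (\<sigma> ?Q x) \<otimes> x)" using step.IH Q by blast
    have "inv (\<sigma> Q (s \<otimes> x)) \<otimes> (s \<otimes> x) = s \<otimes> (inv (\<sigma> ?Q x) \<otimes> x)"
      unfolding \<sigma> conj_by_def using s x Q by (simp add: inv_mult_group m_assoc)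
    then show ?thesis using j word_prod.step step.hyps by (metis Suc_mono)
  qed
qed simp

text \<open>The first letter \<open>s\<close> of a shortest word keeps its crossing: if the rest
  crossed the same wall, exchange would shorten the rest, and the element removed there would merge
  with \<open>s\<close> into a single letter of \<open>R\<close>.\<close>

lemma descent:
  assumes "x \<in> carrier W" "x \<noteq> \<one>"
  shows "\<exists>R\<in>\<Delta>. \<sigma> R x \<noteq> \<one>"
proof -
  define n where "n = (LEAST n. word_prod n x)"
  have n: "word_prod n x" unfolding n_def using word_prod_exists[OF assms(1)] by (rule LeastI_ex)
  have min: "\<not> word_prod j x" if "j < n" for j using that unfolding n_def by (rule not_less_Least)
  from n show ?thesis
  proof cases
    case (step m y R s)
    have ys: "y \<in> carrier W" "s \<in> carrier W" using step word_prod_closed gen_closed by auto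
    have "\<sigma> R y = \<one>"
    proof (rule ccontr)
      assume "\<sigma> R y \<noteq> \<one>"
      then obtain j where j: "j < m" "word_prod j (inv (\<sigma> R y) \<otimes> y)"
        using strong_exchange step gen_T by blast
      have "word_prod (Suc j) ((s \<otimes> \<sigma> R y) \<otimes> (inv (\<sigma> R y) \<otimes> y))"
        using j step cocycle_in[OF gen_T ys(1)] by (intro word_prod.step gen_mult) auto
      moreover have "(s \<otimes> \<sigma> R y) \<otimes> (inv (\<sigma> R y) \<otimes> y) = x"
        using step ys gen_T by (simp add: m_assoc)
      ultimately show False using min[of "Suc j"] j step by simp
    qed
    moreover have "s \<noteq> \<one>" using step min[of m] ys by auto
    ultimately show ?thesis using step ys by (intro bexI[of _ R]) (simp_all add: cocycle_letter_same)
  qed (use assms in simp)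
qed

lemma len_eq_0: "x \<in> carrier W \<Longrightarrow> len x = 0 \<longleftrightarrow> x = \<one>"
  using descent[of x] finite_N[of x] gen_T by (auto simp: len_def N_def)

lemma right_descent:
  assumes "x \<in> carrier W" "len x > 0"
  shows "\<exists>y R s. y \<in> carrier W \<and> R \<in> \<Delta> \<and> s \<in> R \<and> x = y \<otimes> s \<and> len x = Suc (len y)"
proof -
  have "inv x \<noteq> \<one>" using assms by auto
  then obtain R where R: "R \<in> \<Delta>" "\<sigma> R (inv x) \<noteq> \<one>" using descent[of "inv x"] assms by blast
  let ?a = "\<sigma> R (inv x)"
  let ?y = "inv (inv ?a \<otimes> inv x)"
  have a: "?a \<in> R" "?a \<in> carrier W" using cocycle_in gen_T R assms by auto
  have y: "?y = x \<otimes> ?a" using a assms by (simp add: inv_mult_group)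
  have "len x = Suc (len ?y)"
    using len_down(1)[OF R(1) _ R(2)] a assms by (simp only: len_inv inv_closed m_closed)
  then show ?thesis
    using a assms R gen_inv y by (intro exI[of _ "x \<otimes> ?a"] exI[of _ R] exI[of _ "inv ?a"]) (simp add: m_assoc)
qed

section \<open>Alternating words and dihedral prefixes\<close>

lemma len_alt_prod_mult_le:
  "R \<in> \<Delta> \<Longrightarrow> Q \<in> \<Delta> \<Longrightarrow> a \<in> R \<Longrightarrow> b \<in> Q \<Longrightarrow> w \<in> carrier W
    \<Longrightarrow> len (alt_prod W k a b \<otimes> w) \<le> k + len w"
proof (induction k arbitrary: R Q a b)
  case (Suc k)
  have ab: "a \<in> carrier W" "b \<in> carrier W" using Suc.prems gen_closed by auto
  have "len (a \<otimes> (alt_prod W k b a \<otimes> w)) \<le> Suc (len (alt_prod W k b a \<otimes> w))"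
    using Suc.prems(1,3,5) ab by (intro len_letter_le) auto
  also have "\<dots> \<le> Suc (k + len w)" using Suc.IH[of Q R b a] Suc.prems by simp
  finally show ?case using Suc.prems ab by (simp add: m_assoc)
qed simp

lemma len_alt_prod_le:
  "R \<in> \<Delta> \<Longrightarrow> Q \<in> \<Delta> \<Longrightarrow> a \<in> R \<Longrightarrow> b \<in> Q \<Longrightarrow> len (alt_prod W k a b) \<le> k"
  using len_alt_prod_mult_le[of R Q a b \<one> k] gen_closed[of R a] gen_closed[of Q b] by simp

lemma two_gens_len:
  assumes "R \<in> N x" "Q \<in> N x" "R \<noteq> Q" "x \<in> carrier W" shows "2 \<le> len x"
proof -
  have "card {R, Q} \<le> card (N x)" using assms by (intro card_mono finite_N) auto
  then show ?thesis using assms by (simp add: len_def)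
qed

text \<open>Only length-additive factorisations count as prefixes. An element that crosses both
  walls and is minimal in this sense replaces the longest element of a dihedral Coxeter
  group.\<close>

definition prefix_minimal :: "'a set \<Rightarrow> 'a set \<Rightarrow> 'a \<Rightarrow> bool" where
  "prefix_minimal A B x \<longleftrightarrow> (\<forall>y\<in>carrier W. \<forall>z\<in>carrier W.
    x = y \<otimes> z \<longrightarrow> len x = len y + len z \<longrightarrow> len y < len x \<longrightarrow> A \<in> N y \<longrightarrow> B \<notin> N y)"

text \<open>If no proper prefix of \<open>x\<close> crosses both \<open>A\<close> and \<open>B\<close>, then \<open>B\<close> is crossed only by the last
  letter \<open>s\<close>, which can therefore be moved to the front.\<close>

lemma move_last_to_front:
  assumes AB: "A \<in> \<Delta>" "B \<in> \<Delta>" and \<sigma>: "\<sigma> A x \<noteq> \<one>" "\<sigma> B x \<noteq> \<one>"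
    and min: "prefix_minimal A B x"
    and xc: "x \<in> carrier W" and x: "x = \<sigma> A x \<otimes> (t \<otimes> s)" "len x = Suc (Suc (len t))"
    and ts: "t \<in> carrier W" "S \<in> \<Delta>" "s \<in> S"
  shows "x = \<sigma> B x \<otimes> (\<sigma> A x \<otimes> t)"
proof -
  define a where "a = \<sigma> A x"
  define b where "b = \<sigma> B x"
  have s: "s \<in> carrier W" using ts gen_closed by auto
  have a: "a \<in> A" "a \<in> carrier W" and b: "b \<in> B" "b \<in> carrier W"
    unfolding a_def b_def using cocycle_in gen_T AB xc by auto
  let ?y = "a \<otimes> t"
  have y: "?y \<in> carrier W" using a ts by simp
  have xy: "x = ?y \<otimes> s" using x(1) a ts s unfolding a_def[symmetric] by (simp add: m_assoc)
  have le: "len x \<le> len ?y + len s" unfolding xy using y s by (rule len_mult)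
  have leny: "len ?y \<le> Suc (len t)" using len_letter_le AB a ts by blast
  have lens: "len s \<le> 1" using len_gen_le ts by blast
  have eq: "len ?y = Suc (len t)" "len s = 1" using le leny lens x(2) by auto
  have "\<sigma> A ?y = a" using len_letter_eq(2)[OF AB(1) a(1) ts(1) eq(1)] .
  then have "A \<in> N ?y" using \<sigma> AB by (simp add: in_N_gen a_def)
  then have "B \<notin> N ?y" using min y s xy eq x(2) unfolding prefix_minimal_def by auto
  then have "\<sigma> B ?y = \<one>" using AB by (simp add: in_N_gen)
  then have b_eq: "b = conj_by W ?y (\<sigma> (conj_set W (inv ?y) B) s)"
    unfolding b_def using AB gen_T T_conj y s by (subst xy) (simp add: cocycle_mult)
  have "\<sigma> (conj_set W (inv ?y) B) s = s"
  proof (rule ccontr)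
    assume "\<not> ?thesis"
    then have "\<sigma> (conj_set W (inv ?y) B) s = \<one>"
      using cocycle_gen[OF ts(2,3)] T_conj gen_T AB y by (metis inv_closed)
    then show False using b_eq \<sigma>(2) y by (simp add: b_def)
  qed
  then have "b \<otimes> ?y = ?y \<otimes> s" using b_eq y s by (simp add: conj_by_mult_right)
  then show ?thesis using xy unfolding a_def b_def by simp
qed

text \<open>The last letter of \<open>z\<close> goes to the front and turns there into the letter of
  the wall with which the alternating word did not start. So one letter passes from the tail to the
  alternating part.\<close>

lemma shift_step:
  assumes AB: "A \<in> \<Delta>" "B \<in> \<Delta>" and \<sigma>: "\<sigma> A x \<noteq> \<one>" "\<sigma> B x \<noteq> \<one>"
    and min: "prefix_minimal A B x"
    and xc: "x \<in> carrier W" and zc: "z \<in> carrier W"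
    and x: "x = alt_prod W (Suc k) (\<sigma> A x) (\<sigma> B x) \<otimes> z" "len x = Suc (k + len z)" "len z > 0"
  shows "\<exists>z'\<in>carrier W. len z = Suc (len z') \<and> x = alt_prod W (Suc (Suc k)) (\<sigma> B x) (\<sigma> A x) \<otimes> z'"
proof -
  obtain z' S s where z': "z' \<in> carrier W" "S \<in> \<Delta>" "s \<in> S" "z = z' \<otimes> s" "len z = Suc (len z')"
    using right_descent[OF zc x(3)] by blast
  define a where "a = \<sigma> A x"
  define b where "b = \<sigma> B x"
  have a: "a \<in> A" "a \<in> carrier W" and b: "b \<in> B" "b \<in> carrier W"
    unfolding a_def b_def using cocycle_in gen_T AB xc by auto
  have s: "s \<in> carrier W" using z' gen_closed by auto
  let ?t = "alt_prod W k b a \<otimes> z'"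
  have t: "?t \<in> carrier W" using a b z' by simp
  have xt: "x = a \<otimes> (?t \<otimes> s)"
    using x(1) a b z' s unfolding a_def[symmetric] b_def[symmetric] by (simp add: m_assoc)
  \<comment> \<open>Chained together, these bounds are tight because \<open>len x\<close> attains
    their sum; this forces the exact length of \<open>?t\<close>.\<close>
  have "len ?t \<le> k + len z'" using len_alt_prod_mult_le AB a b z' by blast
  moreover have "len x \<le> Suc (len (?t \<otimes> s))"
    by (subst xt) (use len_letter_le[OF AB(1) a(1)] t s in simp)
  moreover have "len (?t \<otimes> s) \<le> len ?t + len s" using t s by (rule len_mult)
  moreover have "len s \<le> 1" using len_gen_le z' by blast
  ultimately have "len x = Suc (Suc (len ?t))" using x(2) z'(5) by linarith
  then have "x = b \<otimes> (a \<otimes> ?t)"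
    using move_last_to_front[OF AB \<sigma> min xc, folded a_def b_def, OF xt _ t z'(2,3)] by simp
  then have "x = alt_prod W (Suc (Suc k)) b a \<otimes> z'" using a b z' by (simp add: m_assoc)
  then show ?thesis using z' unfolding a_def b_def by blast
qed

text \<open>Shifting letters exhausts the tail, so \<open>x\<close> is one of the two alternating
  words. Moving the last letter of that word to the front once more gives the other one.\<close>

lemma alternating_of_minimal:
  assumes AB: "A \<in> \<Delta>" "B \<in> \<Delta>" "A \<noteq> B" and \<sigma>: "\<sigma> A x \<noteq> \<one>" "\<sigma> B x \<noteq> \<one>"
    and min: "prefix_minimal A B x"
    and xc: "x \<in> carrier W"
  shows "x = alt_prod W (len x) (\<sigma> A x) (\<sigma> B x)" "x = alt_prod W (len x) (\<sigma> B x) (\<sigma> A x)"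
proof -
  define a where "a = \<sigma> A x"
  define b where "b = \<sigma> B x"
  have a: "a \<in> A" "a \<in> carrier W" and b: "b \<in> B" "b \<in> carrier W"
    unfolding a_def b_def using cocycle_in gen_T AB xc by auto
  have AB2: "2 \<le> len x" using two_gens_len[of A x B] \<sigma> AB xc by (simp add: in_N_gen)
  have min': "prefix_minimal B A x" using min unfolding prefix_minimal_def by blast
  note stepA = shift_step[OF AB(1,2) \<sigma> min xc, folded a_def b_def]
  note stepB = shift_step[OF AB(2,1) \<sigma>(2,1) min' xc, folded a_def b_def]
  have claim: "\<exists>z\<in>carrier W. len x = Suc (k + len z) \<and>
      (x = alt_prod W (Suc k) a b \<otimes> z \<or> x = alt_prod W (Suc k) b a \<otimes> z)" if "k < len x" for k
    using that
  proof (induction k)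
    case 0
    have "len x = Suc (len (inv a \<otimes> x))" using len_down AB xc \<sigma> unfolding a_def by blast
    moreover have "x = alt_prod W (Suc 0) a b \<otimes> (inv a \<otimes> x)" using a xc by simp
    ultimately show ?case using a xc by (intro bexI[of _ "inv a \<otimes> x"]) simp_all
  next
    case (Suc k)
    then obtain z where z: "z \<in> carrier W" "len x = Suc (k + len z)"
      "x = alt_prod W (Suc k) a b \<otimes> z \<or> x = alt_prod W (Suc k) b a \<otimes> z" by auto
    then have "len z > 0" using Suc.prems by simp
    then obtain z' where "z' \<in> carrier W" "len z = Suc (len z')"
      "x = alt_prod W (Suc (Suc k)) b a \<otimes> z' \<or> x = alt_prod W (Suc (Suc k)) a b \<otimes> z'"
      using stepA[OF z(1), of k] stepB[OF z(1), of k] z by blast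
    then show ?case using z by auto
  qed
  obtain k where k: "len x = Suc (Suc k)" using AB2 by (metis add_2_eq_Suc le_Suc_ex)
  obtain z where z: "z \<in> carrier W" "len x = Suc (k + len z)"
      "x = alt_prod W (Suc k) a b \<otimes> z \<or> x = alt_prod W (Suc k) b a \<otimes> z"
    using claim[of k] k by auto
  have full: "x = alt_prod W (len x) a b \<or> x = alt_prod W (len x) b a"
  proof -
    have "len z > 0" using z k by simp
    then obtain z' where "z' \<in> carrier W" "len z = Suc (len z')"
      "x = alt_prod W (Suc (Suc k)) b a \<otimes> z' \<or> x = alt_prod W (Suc (Suc k)) a b \<otimes> z'"
      using stepA[OF z(1), of k] stepB[OF z(1), of k] z by blast
    then show ?thesis using z k a b len_eq_0[of z'] by auto
  qed
  have swap: "x = alt_prod W (len x) d c"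
    if x: "x = alt_prod W (len x) c d" and CD: "C \<in> \<Delta>" "D \<in> \<Delta>" "c \<in> C" "d \<in> D"
      and move: "\<And>t s S. t \<in> carrier W \<Longrightarrow> x = c \<otimes> (t \<otimes> s) \<Longrightarrow> len x = Suc (Suc (len t))
        \<Longrightarrow> S \<in> \<Delta> \<Longrightarrow> s \<in> S \<Longrightarrow> x = d \<otimes> (c \<otimes> t)" for c d C D
  proof -
    have cd: "c \<in> carrier W" "d \<in> carrier W" using CD gen_closed by auto
    \<comment> \<open>Of the \<open>k + 2\<close> letters of \<open>x\<close>, \<open>?s\<close> is
      the last and \<open>?t\<close> collects the inner ones.\<close>
    let ?s = "if even k then d else c"
    let ?t = "alt_prod W k d c"
    have xt: "x = c \<otimes> (?t \<otimes> ?s)"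
      using x unfolding k using cd alt_prod_snoc[of d c k] by simp
    have s: "?s \<in> (if even k then D else C)" "(if even k then D else C) \<in> \<Delta>" "?s \<in> carrier W"
      using CD cd by auto
    have t: "?t \<in> carrier W" using cd by simp
    have "len x \<le> Suc (len (?t \<otimes> ?s))"
      by (subst xt) (use len_letter_le[OF CD(1,3)] t s in simp)
    moreover have "len (?t \<otimes> ?s) \<le> len ?t + len ?s" using t s by (intro len_mult)
    moreover have "len ?s \<le> 1" using len_gen_le s by blast
    moreover have "len ?t \<le> k" using len_alt_prod_le CD by blast
    ultimately have "len x = Suc (Suc (len ?t))" using k by linarith
    then have "x = d \<otimes> (c \<otimes> ?t)" using move[OF t xt] s by blast
    then show ?thesis unfolding k by simp
  qed
  have "x = alt_prod W (len x) a b \<and> x = alt_prod W (len x) b a"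
    using full
  proof
    assume "x = alt_prod W (len x) a b"
    then show ?thesis
      using swap[OF _ AB(1,2) a(1) b(1)] move_last_to_front[OF AB(1,2) \<sigma> min xc, folded a_def b_def]
      by blast
  next
    assume "x = alt_prod W (len x) b a"
    then show ?thesis
      using swap[OF _ AB(2,1) b(1) a(1)] move_last_to_front[OF AB(2,1) \<sigma>(2,1) min' xc, folded a_def b_def]
      by blast
  qed
  then show "x = alt_prod W (len x) (\<sigma> A x) (\<sigma> B x)" "x = alt_prod W (len x) (\<sigma> B x) (\<sigma> A x)"
    unfolding a_def b_def by auto
qed

text \<open>Descending through prefixes ends at a minimal one, which is alternating by
  \<open>alternating_of_minimal\<close>. The equality of its two spellings is what lets reduced
  expressions starting in \<open>A\<close> and in \<open>B\<close> be compared.\<close>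

lemma dihedral_prefix:
  assumes "A \<in> \<Delta>" "B \<in> \<Delta>" "A \<noteq> B" "x \<in> carrier W" "A \<in> N x" "B \<in> N x"
  shows "\<exists>k a b w. a \<in> A - {\<one>} \<and> b \<in> B - {\<one>} \<and> w \<in> carrier W \<and> x = alt_prod W k a b \<otimes> w
    \<and> alt_prod W k a b = alt_prod W k b a \<and> len x = k + len w
    \<and> A \<in> N (alt_prod W k a b) \<and> B \<in> N (alt_prod W k a b)"
  using assms(4-6)
proof (induction "len x" arbitrary: x rule: less_induct)
  case less
  show ?case
  proof (cases "prefix_minimal A B x")
    case False
    then obtain y z where yz: "y \<in> carrier W" "z \<in> carrier W" "x = y \<otimes> z" "len x = len y + len z"
      "len y < len x" "A \<in> N y" "B \<in> N y"
      unfolding prefix_minimal_def by blast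
    obtain k a b w where *: "a \<in> A - {\<one>}" "b \<in> B - {\<one>}" "w \<in> carrier W" "y = alt_prod W k a b \<otimes> w"
      "alt_prod W k a b = alt_prod W k b a" "len y = k + len w"
      "A \<in> N (alt_prod W k a b)" "B \<in> N (alt_prod W k a b)"
      using less.hyps[OF yz(5,1,6,7)] by blast
    have ab: "a \<in> carrier W" "b \<in> carrier W" using * assms gen_closed by auto
    have "x = alt_prod W k a b \<otimes> (w \<otimes> z)" using yz * ab by (simp add: m_assoc)
    moreover have "len x = k + len (w \<otimes> z)"
    proof -
      have "len (alt_prod W k a b \<otimes> (w \<otimes> z)) \<le> k + len (w \<otimes> z)"
        using * yz by (intro len_alt_prod_mult_le[OF assms(1,2)]) auto
      then have "len x \<le> k + len (w \<otimes> z)" by (simp only: calculation)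
      then show ?thesis using len_mult[OF *(3) yz(2)] yz(4) *(6) by linarith
    qed
    ultimately show ?thesis using * yz by (metis m_closed)
  next
    case True
    have \<sigma>: "\<sigma> A x \<noteq> \<one>" "\<sigma> B x \<noteq> \<one>" using less.prems assms by (simp_all add: in_N_gen)
    have "x = alt_prod W (len x) (\<sigma> A x) (\<sigma> B x)" "x = alt_prod W (len x) (\<sigma> B x) (\<sigma> A x)"
      using alternating_of_minimal[OF assms(1-3) \<sigma> True less.prems(1)] by blast+
    then have "x = alt_prod W (len x) (\<sigma> A x) (\<sigma> B x) \<otimes> \<one>"
      "alt_prod W (len x) (\<sigma> A x) (\<sigma> B x) = alt_prod W (len x) (\<sigma> B x) (\<sigma> A x)"
      "A \<in> N (alt_prod W (len x) (\<sigma> A x) (\<sigma> B x))" "B \<in> N (alt_prod W (len x) (\<sigma> A x) (\<sigma> B x))"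
      using less.prems by auto
    moreover have "\<sigma> A x \<in> A - {\<one>}" "\<sigma> B x \<in> B - {\<one>}"
      using \<sigma> cocycle_in gen_T assms less.prems by auto
    moreover have "len x = len x + len \<one>" by simp
    ultimately show ?thesis using one_closed by blast
  qed
qed

section \<open>Commuting walls and the order-two condition\<close>

lemma reduced_alt_prod:
  assumes AB: "A \<in> \<Delta>" "B \<in> \<Delta>" and ab: "a \<in> A" "b \<in> B" and w: "w \<in> carrier W"
    and len: "len (alt_prod W (Suc k) a b \<otimes> w) = Suc k + len w"
  shows "len (alt_prod W k b a \<otimes> w) = k + len w" "\<sigma> A (alt_prod W k b a \<otimes> w) = \<one>"
    "\<sigma> A (alt_prod W (Suc k) a b \<otimes> w) = a" "a \<noteq> \<one>"
proof -
  have cl: "a \<in> carrier W" "b \<in> carrier W" using AB ab gen_closed by auto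
  let ?y = "alt_prod W k b a \<otimes> w"
  have y: "?y \<in> carrier W" using cl w by simp
  have ay: "alt_prod W (Suc k) a b \<otimes> w = a \<otimes> ?y" using cl w by (simp add: m_assoc)
  have "len ?y \<le> k + len w" using len_alt_prod_mult_le[OF AB(2,1) ab(2,1) w] .
  moreover have "len (a \<otimes> ?y) \<le> Suc (len ?y)" using len_letter_le[OF AB(1) ab(1) y] .
  ultimately show leny: "len ?y = k + len w" using len unfolding ay by linarith
  have "len (a \<otimes> ?y) = Suc (len ?y)" using len leny unfolding ay by simp
  from len_letter_eq[OF AB(1) ab(1) y this]
  show "\<sigma> A ?y = \<one>" "\<sigma> A (alt_prod W (Suc k) a b \<otimes> w) = a" "a \<noteq> \<one>"
    unfolding ay by auto
qed

text \<open>Evaluate \<sigma> on \<open>B\<close> on both sides of \<open>eq\<close>: the left side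
  gives \<open>b\<close>, while the right side can be nontrivial only if conjugation by the inverse
  of \<open>a\<close> fixes \<open>B\<close>.\<close>

lemma normalises_if:
  assumes AB: "A \<in> \<Delta>" "B \<in> \<Delta>" "A \<noteq> B" and b: "b \<in> B" "b \<noteq> \<one>" and a: "a \<in> A" and a': "a' \<in> A"
    and eq: "b \<otimes> a' = a \<otimes> b"
  shows "conj_set W a B = B"
proof -
  have cl: "a \<in> carrier W" "b \<in> carrier W" using AB a b gen_closed by auto
  have sub: "A \<subseteq> carrier W" "B \<subseteq> carrier W" using AB gen_T T_sub by auto
  note eq
  moreover have "\<sigma> B (b \<otimes> a') = b"
    using AB b a' gen_closed gen_T cl by (simp add: cocycle_letter_same cocycle_gen[of A])
  moreover have "\<sigma> B (a \<otimes> b) = conj_by W a (\<sigma> (conj_set W (inv a) B) b)"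
    using AB a cl gen_T by (intro cocycle_letter_other) auto
  ultimately have "\<sigma> (conj_set W (inv a) B) b \<noteq> \<one>" using b cl by auto
  then have "conj_set W (inv a) B = B"
    using cocycle_gen[OF AB(2) b(1)] T_conj gen_T AB cl by (metis inv_closed)
  then show ?thesis using cl sub by (metis conj_set_inv_cancel(2))
qed

text \<open>If \<open>b\<close> normalises \<open>A\<close>, every \<open>a\<close> can be moved
  across \<open>b\<close> at the cost of becoming another element of \<open>A\<close>, which is the
  situation of \<open>normalises_if\<close>.\<close>

lemma normalises_swap:
  assumes AB: "A \<in> \<Delta>" "B \<in> \<Delta>" "A \<noteq> B" and b: "b \<in> B" "b \<noteq> \<one>" "conj_set W b A = A" and a: "a \<in> A"
  shows "conj_set W a B = B"
proof -
  have cl: "a \<in> carrier W" "b \<in> carrier W" using AB a b gen_closed by auto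
  define a' where "a' = conj_by W (inv b) a"
  have "conj_set W (inv b) A = A"
    using b(3) cl AB gen_T T_sub by (metis conj_set_inv_cancel(1))
  then have a': "a' \<in> A" unfolding a'_def using a by (auto simp: conj_set_def)
  have "b \<otimes> a' = a \<otimes> b" unfolding a'_def conj_by_def using cl by (simp add: m_assoc)
  then show ?thesis using normalises_if AB b(1,2) a a' by blast
qed

text \<open>One nontrivial normalising element makes the two subgroups normalise each other;
  commutators then lie in the trivial intersection of \<open>A\<close> and \<open>B\<close>.\<close>

lemma commute_if_normalises:
  assumes AB: "A \<in> \<Delta>" "B \<in> \<Delta>" "A \<noteq> B" and b: "b \<in> B" "b \<noteq> \<one>" "conj_set W b A = A"
    and xy: "x \<in> A" "y \<in> B"
  shows "x \<otimes> y = y \<otimes> x"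
proof -
  obtain a where a: "a \<in> A" "a \<noteq> \<one>" using gen_nontrivial AB by blast
  have nB: "conj_set W u B = B" if "u \<in> A" for u using normalises_swap[OF AB b that] .
  have nA: "conj_set W v A = A" if "v \<in> B" for v
    using normalises_swap[OF AB(2,1) AB(3)[symmetric] a nB[OF a(1)] that] .
  have cl: "x \<in> carrier W" "y \<in> carrier W" using AB xy gen_closed by auto
  have "conj_by W x y \<in> B" using nB[OF xy(1)] xy unfolding conj_set_def by blast
  then have 1: "conj_by W x y \<otimes> inv y \<in> B" using gen_mult gen_inv AB xy by blast
  have "conj_by W y (inv x) \<in> A" using nA[OF xy(2)] gen_inv AB xy unfolding conj_set_def by blast
  then have "x \<otimes> conj_by W y (inv x) \<in> A" using gen_mult AB xy by blast
  moreover have "x \<otimes> conj_by W y (inv x) = conj_by W x y \<otimes> inv y"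
    using cl by (simp add: conj_by_def m_assoc)
  ultimately have "conj_by W x y \<otimes> inv y = \<one>" using 1 gen_inter AB by metis
  then have "conj_by W x y = y" using cl by (metis conj_by_closed inv_closed inv_equality inv_inv)
  then show ?thesis using conj_by_mult_right[OF cl] by simp
qed

text \<open>The bound \<open>m\<close> is the least length of an element crossing both \<open>A\<close> and \<open>B\<close>. For nontrivial \<open>c\<close> in
  \<open>A\<close>, the conjugate of \<open>B\<close> by \<open>c\<close> is crossed by \<open>p\<close> but, by minimality of \<open>m\<close>, not by \<open>p\<^sub>0\<close>; so it is
  the hyperplane of the last letter of \<open>p\<close>, whatever \<open>c\<close> is.\<close>

lemma order_two_of_long_label:
  assumes AB: "A \<in> \<Delta>" "B \<in> \<Delta>" "A \<noteq> B" and ab: "a \<in> A" "b \<in> B"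
    and m: "3 \<le> m" and alt: "alt_prod W m a b = alt_prod W m b a" "len (alt_prod W m a b) = m"
    and least: "\<And>x. x \<in> carrier W \<Longrightarrow> A \<in> N x \<Longrightarrow> B \<in> N x \<Longrightarrow> m \<le> len x"
    and cd: "c \<in> A" "c \<noteq> \<one>" "d \<in> A" "d \<noteq> \<one>"
  shows "c = d"
proof -
  have cl: "a \<in> carrier W" "b \<in> carrier W" "c \<in> carrier W" "d \<in> carrier W"
    using AB ab cd gen_closed by auto
  have AT: "A \<in> T" "B \<in> T" using AB gen_T by auto
  obtain i where i: "m = Suc (Suc (Suc i))" using m by (auto simp: numeral_3_eq_3 dest!: le_Suc_ex)
  \<comment> \<open>The intended factorisations are \<open>y = a p = p s\<close> and
    \<open>p = p0 s'\<close>; \<open>s'\<close> and \<open>s\<close> are the last letters of the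
    alternating words starting with \<open>b\<close> of lengths \<open>m - 1\<close> and
    \<open>m\<close>.\<close>
  define y where "y = alt_prod W m a b"
  define p where "p = alt_prod W (Suc (Suc i)) b a"
  define p0 where "p0 = alt_prod W (Suc i) b a"
  define s' where "s' = (if even (Suc i) then b else a)"
  define S' where "S' = (if even (Suc i) then B else A)"
  define s where "s = (if even (Suc (Suc i)) then b else a)"
  define S where "S = (if even (Suc (Suc i)) then B else A)"
  have s': "s' \<in> S'" "S' \<in> \<Delta>" and s: "s \<in> S" "S \<in> \<Delta>"
    using AB ab by (auto simp: s'_def S'_def s_def S_def)
  have scl: "s \<in> carrier W" "s' \<in> carrier W" using s s' gen_closed by auto
  have pcl: "p \<in> carrier W" "p0 \<in> carrier W" using cl by (simp_all add: p_def p0_def)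
  have yap: "y = a \<otimes> p" unfolding y_def i p_def by simp
  have "y = alt_prod W m b a" using alt(1) by (simp add: y_def)
  then have yps: "y = p \<otimes> s"
    unfolding i p_def s_def using cl by (simp only: alt_prod_snoc)
  have pp0: "p = p0 \<otimes> s'" unfolding p_def p0_def s'_def using cl by (intro alt_prod_snoc)
  have leny: "len y = m" using alt by (simp add: y_def)
  have "len p \<le> Suc (Suc i)" unfolding p_def using len_alt_prod_le AB ab by blast
  moreover have "len y \<le> Suc (len p)" unfolding yap using len_letter_le[OF AB(1) ab(1) pcl(1)] .
  ultimately have lenp: "len p = Suc (Suc i)" "len (a \<otimes> p) = Suc (len p)" using leny i yap by auto
  have lenp0: "len p0 \<le> Suc i" unfolding p0_def using len_alt_prod_le AB ab by blast
  have \<sigma>Ap: "\<sigma> A p = \<one>" "\<sigma> A y = a" "a \<noteq> \<one>"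
    using len_letter_eq[OF AB(1) ab(1) pcl(1) lenp(2)] by (simp_all add: yap)
  have \<sigma>Bp: "\<sigma> B p = b" "b \<noteq> \<one>"
    using reduced_alt_prod[OF AB(2,1) ab(2,1) one_closed, of "Suc i"] lenp(1) pcl unfolding p_def by simp_all
  have "len p \<le> len p0 + len s'" unfolding pp0 using pcl scl by (intro len_mult)
  then have lenp0': "len p0 = Suc i" using lenp lenp0 len_gen_le[OF s'(2,1)] by simp
  have "\<sigma> B p0 = b"
    using reduced_alt_prod[OF AB(2,1) ab(2,1) one_closed, of i] lenp0' pcl unfolding p0_def by simp
  then have "B \<in> N p0" using \<sigma>Bp AT by (simp add: N_def)
  then have "A \<notin> N p0" using least[OF pcl(2)] lenp0 i by auto
  then have \<sigma>Ap0: "\<sigma> A p0 = \<one>" using AT by (simp add: N_def)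
  \<comment> \<open>As \<open>y = p s\<close> crosses \<open>A\<close> and \<open>p\<close> does
    not, the letter \<open>s\<close> must cross the translate of \<open>A\<close>; this identifies
    \<open>S\<close>.\<close>
  have "a = conj_by W p (\<sigma> (conj_set W (inv p) A) s)"
    using \<sigma>Ap cocycle_mult[OF AT(1) pcl(1) scl(1)] AT T_conj pcl scl by (simp add: yps)
  then have "\<sigma> (conj_set W (inv p) A) s \<noteq> \<one>" using \<sigma>Ap(3) pcl by auto
  then have S: "conj_set W (inv p) A = S"
    using cocycle_gen[OF s(2,1)] T_conj AT pcl by (metis inv_closed)
  have key: "conj_set W c B = conj_set W p0 S'" if c: "c \<in> A" "c \<noteq> \<one>" for c
  proof -
    let ?B = "conj_set W c B"
    have ccl: "c \<in> carrier W" using c AB gen_closed by auto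
    have BT: "?B \<in> T" using AT ccl T_conj by simp
    have BA: "?B \<noteq> A" using conj_set_eq_gen[OF AB(1) c(1) AT(2)] AB by blast
    have invB: "conj_set W (inv c) ?B = B" using ccl AT T_sub by simp
    define c' where "c' = conj_by W (inv p) c"
    have c': "c' \<in> S" using c S unfolding c'_def conj_set_def by blast
    have c'cl: "c' \<in> carrier W" unfolding c'_def using ccl pcl by simp
    have pc': "p \<otimes> c' = c \<otimes> p" unfolding c'_def conj_by_def using ccl pcl by (simp add: m_assoc)
    \<comment> \<open>The element \<open>c p = p c'\<close> is evaluated in both orders:
      \<open>c\<close> carries the crossing of \<open>B\<close> to \<open>?B\<close>, and
      \<open>c'\<close> lies in \<open>S\<close> and cannot contribute to it.\<close>
    have 1: "\<sigma> ?B (c \<otimes> p) = conj_by W c b"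
      using cocycle_letter_other[OF AB(1) c(1) pcl(1) BT BA] invB \<sigma>Bp by simp
    have "conj_set W (inv p) ?B \<noteq> S"
      using BA inj_onD[OF conj_set_inj_on_T[of "inv p"] _ BT AT(1)] S pcl by auto
    then have "\<sigma> (conj_set W (inv p) ?B) c' = \<one>"
      using cocycle_gen[OF s(2) c'] T_conj BT pcl by simp
    then have "\<sigma> ?B (p \<otimes> c') = \<sigma> ?B p" using cocycle_mult[OF BT pcl(1) c'cl] BT pcl by simp
    then have "\<sigma> ?B p = conj_by W c b" using 1 pc' by simp
    then have \<sigma>p: "\<sigma> ?B p \<noteq> \<one>" using \<sigma>Bp ccl cl by simp
    have \<sigma>p0: "\<sigma> ?B p0 = \<one>"
    proof (rule ccontr)
      assume *: "\<sigma> ?B p0 \<noteq> \<one>"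
      let ?x = "inv c \<otimes> p0"
      have ic: "inv c \<in> A" "inv c \<noteq> \<one>" using c gen_inv AB ccl by auto
      have "\<sigma> A ?x = inv c" using ic AB pcl \<sigma>Ap0 ccl by (simp add: cocycle_letter_same)
      then have "A \<in> N ?x" using ic AT by (simp add: N_def)
      moreover have "\<sigma> B ?x = conj_by W (inv c) (\<sigma> ?B p0)"
        using cocycle_letter_other[OF AB(1) ic(1) pcl(2) AT(2)] AB ccl by simp
      then have "B \<in> N ?x" using * AT BT ccl pcl by (simp add: N_def)
      ultimately have "m \<le> len ?x" using least ccl pcl by simp
      moreover have "len ?x \<le> Suc (len p0)" using len_letter_le[OF AB(1) ic(1) pcl(2)] .
      ultimately show False using lenp0 i by simp
    qed
    have "\<sigma> ?B p = conj_by W p0 (\<sigma> (conj_set W (inv p0) ?B) s')"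
      using cocycle_mult[OF BT pcl(2) scl(2)] \<sigma>p0 BT T_conj pcl scl by (simp add: pp0)
    then have "\<sigma> (conj_set W (inv p0) ?B) s' \<noteq> \<one>" using \<sigma>p pcl by auto
    then have "conj_set W (inv p0) ?B = S'"
      using cocycle_gen[OF s'(2,1)] T_conj BT pcl by (metis inv_closed)
    then show ?thesis using pcl BT T_sub by (metis conj_set_inv_cancel(2))
  qed
  show "c = d"
  proof (rule ccontr)
    assume ne: "c \<noteq> d"
    \<comment> \<open>Two distinct choices give a nontrivial element normalising \<open>B\<close>.
      Then \<open>a\<close> and \<open>b\<close> commute, and their product, of length at most two,
      crosses both walls although \<open>3 \<le> m\<close>.\<close>
    let ?e = "inv c \<otimes> d"
    have e: "?e \<in> A" "?e \<noteq> \<one>" using cd AB gen_inv gen_mult ne cl by (auto dest!: inv_equality)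
    have "conj_set W c B = conj_set W d B" using key cd by metis
    then have "conj_set W ?e B = B" using cl AT T_sub by (simp add: conj_set_comp flip: \<open>conj_set W c B = conj_set W d B\<close>)
    then have comm: "b \<otimes> a = a \<otimes> b"
      using commute_if_normalises[OF AB(2,1) AB(3)[symmetric] e] ab by blast
    have "A \<in> N (a \<otimes> b)"
      using AB ab cl AT \<sigma>Ap by (simp add: N_def cocycle_letter_same cocycle_gen[of B])
    moreover have "B \<in> N (b \<otimes> a)"
      using AB ab cl AT \<sigma>Bp by (simp add: N_def cocycle_letter_same cocycle_gen[of A])
    ultimately have "m \<le> len (a \<otimes> b)" using least[of "a \<otimes> b"] cl comm by simp
    moreover have "len (a \<otimes> b) \<le> 2"
      using len_mult[OF cl(1,2)] len_gen_le[OF AB(1) ab(1)] len_gen_le[OF AB(2) ab(2)] by simp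
    ultimately show False using m by simp
  qed
qed

text \<open>In a Coxeter group this recovers the order of the product of two simple reflections, as
  the least length of an element having both as left descents.\<close>

definition refl_label :: "'a set set \<Rightarrow> nat" where
  "refl_label e = (LEAST n. \<exists>x\<in>carrier W. e \<subseteq> N x \<and> len x = n)"

text \<open>A pair that no element crosses together corresponds to an infinite Coxeter label and
  gets no edge. On edges the \<open>LEAST\<close> in \<open>refl_label\<close> therefore ranges over
  a nonempty set.\<close>

definition refl_edges :: "'a set set set" where
  "refl_edges = {{A, B} | A B. A \<in> \<Delta> \<and> B \<in> \<Delta> \<and> A \<noteq> B \<and> (\<exists>x\<in>carrier W. {A, B} \<subseteq> N x)}"

lemma refl_edge_gens: "{A, B} \<in> refl_edges \<Longrightarrow> A \<in> \<Delta> \<and> B \<in> \<Delta> \<and> A \<noteq> B"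
  unfolding refl_edges_def by (auto simp: doubleton_eq_iff)

lemma refl_edgeI:
  "A \<in> \<Delta> \<Longrightarrow> B \<in> \<Delta> \<Longrightarrow> A \<noteq> B \<Longrightarrow> x \<in> carrier W \<Longrightarrow> A \<in> N x \<Longrightarrow> B \<in> N x \<Longrightarrow> {A, B} \<in> refl_edges"
  unfolding refl_edges_def by blast

lemma refl_label_le: "x \<in> carrier W \<Longrightarrow> A \<in> N x \<Longrightarrow> B \<in> N x \<Longrightarrow> refl_label {A, B} \<le> len x"
  unfolding refl_label_def by (rule Least_le) auto

lemma refl_label_attained:
  assumes "{A, B} \<in> refl_edges"
  obtains x where "x \<in> carrier W" "A \<in> N x" "B \<in> N x" "len x = refl_label {A, B}"
proof -
  have "\<exists>x0\<in>carrier W. {A, B} \<subseteq> N x0" using assms unfolding refl_edges_def mem_Collect_eq by metis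
  then have "\<exists>n. \<exists>x\<in>carrier W. {A, B} \<subseteq> N x \<and> len x = n" by blast
  from LeastI_ex[OF this] obtain x where "x \<in> carrier W" "{A, B} \<subseteq> N x" "len x = refl_label {A, B}"
    unfolding refl_label_def by blast
  then show thesis using that[of x] by simp
qed

lemma refl_label_ge_2: assumes "{A, B} \<in> refl_edges" shows "2 \<le> refl_label {A, B}"
proof -
  obtain x where "x \<in> carrier W" "A \<in> N x" "B \<in> N x" "len x = refl_label {A, B}"
    using refl_label_attained[OF assms] .
  then show ?thesis using two_gens_len[of A x B] refl_edge_gens[OF assms] by simp
qed

text \<open>The dihedral prefix of an element attaining the minimum crosses both walls as well, so
  minimality leaves no length for a remainder.\<close>

lemma refl_label_word:
  assumes "{A, B} \<in> refl_edges"
  obtains a b where "a \<in> A - {\<one>}" "b \<in> B - {\<one>}"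
    "alt_prod W (refl_label {A, B}) a b = alt_prod W (refl_label {A, B}) b a"
    "len (alt_prod W (refl_label {A, B}) a b) = refl_label {A, B}"
proof -
  obtain x where x: "x \<in> carrier W" "A \<in> N x" "B \<in> N x" "len x = refl_label {A, B}"
    using refl_label_attained[OF assms] .
  have AB: "A \<in> \<Delta>" "B \<in> \<Delta>" "A \<noteq> B" using refl_edge_gens assms by auto
  obtain k a b w where *: "a \<in> A - {\<one>}" "b \<in> B - {\<one>}" "w \<in> carrier W"
    "alt_prod W k a b = alt_prod W k b a" "len x = k + len w"
    "A \<in> N (alt_prod W k a b)" "B \<in> N (alt_prod W k a b)"
    using dihedral_prefix[OF AB x(1-3)] by blast
  have ab: "a \<in> carrier W" "b \<in> carrier W" using * AB gen_closed by auto
  have "refl_label {A, B} \<le> len (alt_prod W k a b)" using refl_label_le * ab by simp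
  moreover have "len (alt_prod W k a b) \<le> k" using len_alt_prod_le[OF AB(1,2)] * by blast
  ultimately have "k = refl_label {A, B}" "len (alt_prod W k a b) = refl_label {A, B}"
    using * x by linarith+
  then show thesis using that * by blast
qed

lemma refl_label_order_2:
  assumes "{A, B} \<in> refl_edges" "2 < refl_label {A, B}" "c \<in> A - {\<one>}" "d \<in> A - {\<one>}"
  shows "c = d"
proof -
  obtain a b where ab: "a \<in> A - {\<one>}" "b \<in> B - {\<one>}"
    "alt_prod W (refl_label {A, B}) a b = alt_prod W (refl_label {A, B}) b a"
    "len (alt_prod W (refl_label {A, B}) a b) = refl_label {A, B}"
    using refl_label_word[OF assms(1)] .
  have AB: "A \<in> \<Delta>" "B \<in> \<Delta>" "A \<noteq> B" using refl_edge_gens assms by auto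
  have "3 \<le> refl_label {A, B}" using assms(2) by simp
  from order_two_of_long_label[OF AB _ _ this ab(3,4) refl_label_le] ab assms
  show ?thesis by blast
qed

text \<open>\<open>refl_label_word\<close> supplies the relation for one pair only. At label two
  that pair commutes, hence so do the whole subgroups; above two each subgroup has a single
  nontrivial element, so there is no other pair.\<close>

lemma refl_relation:
  assumes "{A, B} \<in> refl_edges" "a \<in> A - {\<one>}" "b \<in> B - {\<one>}"
  shows "alt_prod W (refl_label {A, B}) a b = alt_prod W (refl_label {A, B}) b a"
proof -
  obtain a0 b0 where ab0: "a0 \<in> A - {\<one>}" "b0 \<in> B - {\<one>}"
    "alt_prod W (refl_label {A, B}) a0 b0 = alt_prod W (refl_label {A, B}) b0 a0"
    using refl_label_word[OF assms(1)] by metis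
  have AB: "A \<in> \<Delta>" "B \<in> \<Delta>" "A \<noteq> B" using refl_edge_gens assms by auto
  show ?thesis
  proof (cases "refl_label {A, B} = 2")
    case True
    have cl: "a \<in> carrier W" "b \<in> carrier W" "a0 \<in> carrier W" "b0 \<in> carrier W"
      using AB assms ab0 gen_closed by auto
    have "b0 \<otimes> a0 = a0 \<otimes> b0" using ab0(3) cl by (simp add: True numeral_2_eq_2)
    then have "conj_set W a0 B = B" using normalises_if[OF AB, of b0 a0 a0] ab0 by simp
    then have "b \<otimes> a = a \<otimes> b"
      using commute_if_normalises[OF AB(2,1) AB(3)[symmetric], of a0 b a] ab0 assms by simp
    then show ?thesis using cl by (simp add: True numeral_2_eq_2)
  next
    case False
    then have "2 < refl_label {A, B}" using refl_label_ge_2[OF assms(1)] by simp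
    moreover have "{B, A} = {A, B}" by (rule insert_commute)
    ultimately have "a = a0" "b = b0"
      using refl_label_order_2[of A B a a0] refl_label_order_2[of B A b b0] assms ab0 by simp_all
    then show ?thesis using ab0 by simp
  qed
qed

text \<open>If the word were longer than the label \<open>m\<close>, rewriting its first
  \<open>m\<close> letters by the relation would put two letters of one subgroup side by side, and
  merging them would contradict its length.\<close>

lemma refl_label_unique:
  assumes AB: "A \<in> \<Delta>" "B \<in> \<Delta>" "A \<noteq> B" and ab: "a \<in> A - {\<one>}" "b \<in> B - {\<one>}"
    and N: "A \<in> N (alt_prod W k a b)" "B \<in> N (alt_prod W k a b)"
    and len: "len (alt_prod W k a b) = k"
  shows "{A, B} \<in> refl_edges" "refl_label {A, B} = k"
proof -
  have cl: "a \<in> carrier W" "b \<in> carrier W" using AB ab gen_closed by auto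
  show e: "{A, B} \<in> refl_edges" using refl_edgeI[OF AB _ N] cl by simp
  define m where "m = refl_label {A, B}"
  have "m \<le> k" using refl_label_le[OF _ N] cl len by (simp add: m_def)
  moreover have "\<not> m < k"
  proof
    assume "m < k"
    then obtain j where j: "k = m + Suc j" using less_imp_Suc_add by fastforce
    obtain m' where m': "m = Suc m'" using refl_label_ge_2[OF e] by (cases m) (simp_all add: m_def)
    \<comment> \<open>\<open>c\<close> is the letter after the first \<open>m\<close> ones and also
      the last letter of the rewritten prefix, which starts with \<open>b\<close>; the parity of
      \<open>m\<close> decides which letter that is.\<close>
    define c where "c = (if even m then a else b)"
    define d where "d = (if even m then b else a)"
    define C where "C = (if even m then A else B)"
    define D where "D = (if even m then B else A)"
    have c: "c \<in> C" "C \<in> \<Delta>" "d \<in> D" "D \<in> \<Delta>" "c \<in> carrier W" "d \<in> carrier W"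
      using ab AB cl by (auto simp: c_def d_def C_def D_def)
    have rel: "alt_prod W m a b = alt_prod W m b a"
      unfolding m_def using refl_relation[OF e ab] .
    have "alt_prod W k a b = alt_prod W m a b \<otimes> alt_prod W (Suc j) c d"
      unfolding j alt_prod_add[OF cl] c_def d_def by (cases "even m") (simp_all del: alt_prod.simps)
    also have "alt_prod W m a b = alt_prod W m' b a \<otimes> c"
      unfolding rel unfolding m' using alt_prod_snoc[OF cl(2,1), of m'] by (simp add: c_def m' del: alt_prod.simps)
    finally have "alt_prod W k a b = alt_prod W m' b a \<otimes> ((c \<otimes> c) \<otimes> alt_prod W j d c)"
      using c cl by (simp add: m_assoc)
    moreover have "len (alt_prod W m' b a \<otimes> ((c \<otimes> c) \<otimes> alt_prod W j d c))
        \<le> m' + len ((c \<otimes> c) \<otimes> alt_prod W j d c)"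
      using len_alt_prod_mult_le[OF AB(2,1)] ab c by simp
    moreover have "len ((c \<otimes> c) \<otimes> alt_prod W j d c) \<le> Suc (len (alt_prod W j d c))"
      using len_letter_le[OF c(2) gen_mult[OF c(2,1,1)]] c by simp
    moreover have "len (alt_prod W j d c) \<le> j" using len_alt_prod_le[OF c(4,2,3,1)] .
    ultimately show False using len j m' by simp
  qed
  ultimately show "refl_label {A, B} = k" by (simp add: m_def)
qed

text \<open>A relation and not a function: reduced expressions are not unique, and independence of
  the choice is the content of \<open>ev_unique\<close>. The condition on \<sigma> makes every step
  lengthen the element.\<close>

inductive reduced_eval :: "('c, 'd) monoid_scheme \<Rightarrow> ('a set \<Rightarrow> 'a \<Rightarrow> 'c) \<Rightarrow> 'a \<Rightarrow> 'c \<Rightarrow> bool"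
  for H f where
  one: "reduced_eval H f \<one> \<one>\<^bsub>H\<^esub>"
| step: "reduced_eval H f y h \<Longrightarrow> R \<in> \<Delta> \<Longrightarrow> s \<in> R \<Longrightarrow> s \<noteq> \<one> \<Longrightarrow> \<sigma> R y = \<one>
    \<Longrightarrow> reduced_eval H f (s \<otimes> y) (f R s \<otimes>\<^bsub>H\<^esub> h)"

lemma reduced_eval_closed: "reduced_eval H f x h \<Longrightarrow> x \<in> carrier W"
  by (induction rule: reduced_eval.induct) (auto simp: gen_closed)

lemma reduced_eval_exists:
  assumes "x \<in> carrier W" shows "\<exists>h. reduced_eval H f x h"
  using assms
proof (induction "len x" arbitrary: x rule: less_induct)
  case less
  show ?case
  proof (cases "x = \<one>")
    case True
    then show ?thesis using reduced_eval.one by blast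
  next
    case False
    then obtain R where R: "R \<in> \<Delta>" "\<sigma> R x \<noteq> \<one>" using descent less.prems by blast
    let ?a = "\<sigma> R x"
    have a: "?a \<in> R" "?a \<in> carrier W" using cocycle_in gen_T R less.prems by auto
    note d = len_down[OF R(1) less.prems R(2)]
    obtain h where "reduced_eval H f (inv ?a \<otimes> x) h" using less.hyps[of "inv ?a \<otimes> x"] d a less.prems by auto
    then have "reduced_eval H f (?a \<otimes> (inv ?a \<otimes> x)) (f R ?a \<otimes>\<^bsub>H\<^esub> h)"
      using R a d by (intro reduced_eval.step) auto
    then show ?thesis using a less.prems by auto
  qed
qed

end

section \<open>Extending maps on the walls to the whole group\<close>

locale reflection_system_map = reflection_system W T \<sigma> \<Delta> + H: monoid H
  for W (structure) and T \<sigma> \<Delta> and H :: "('c, 'd) monoid_scheme" +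
  fixes f :: "'a set \<Rightarrow> 'a \<Rightarrow> 'c"
  assumes f_closed: "R \<in> \<Delta> \<Longrightarrow> r \<in> R \<Longrightarrow> f R r \<in> carrier H"
    and f_mult: "R \<in> \<Delta> \<Longrightarrow> r \<in> R \<Longrightarrow> s \<in> R \<Longrightarrow> f R (r \<otimes> s) = f R r \<otimes>\<^bsub>H\<^esub> f R s"
    and f_one: "R \<in> \<Delta> \<Longrightarrow> f R \<one> = \<one>\<^bsub>H\<^esub>"
    and f_relation: "{A, B} \<in> refl_edges \<Longrightarrow> a \<in> A - {\<one>} \<Longrightarrow> b \<in> B - {\<one>}
      \<Longrightarrow> alt_prod H (refl_label {A, B}) (f A a) (f B b) = alt_prod H (refl_label {A, B}) (f B b) (f A a)"
begin

abbreviation "ev \<equiv> reduced_eval H f"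

lemma ev_closed: "ev x h \<Longrightarrow> h \<in> carrier H"
  by (induction rule: reduced_eval.induct) (auto simp: f_closed)

lemma ev_alt_prod:
  assumes "A \<in> \<Delta>" "B \<in> \<Delta>" "a \<in> A" "b \<in> B" "ev w h" "len (alt_prod W k a b \<otimes> w) = k + len w"
  shows "ev (alt_prod W k a b \<otimes> w) (alt_prod H k (f A a) (f B b) \<otimes>\<^bsub>H\<^esub> h)"
  using assms
proof (induction k arbitrary: A B a b)
  case 0
  then show ?case using reduced_eval_closed[OF 0(5)] ev_closed[OF 0(5)] by simp
next
  case (Suc k)
  have w: "w \<in> carrier W" "h \<in> carrier H"
    using reduced_eval_closed[OF Suc.prems(5)] ev_closed[OF Suc.prems(5)] by auto
  note red = reduced_alt_prod[OF Suc.prems(1-4) w(1) Suc.prems(6)]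
  have "ev (alt_prod W k b a \<otimes> w) (alt_prod H k (f B b) (f A a) \<otimes>\<^bsub>H\<^esub> h)"
    using Suc.IH[OF Suc.prems(2,1,4,3,5)] red by simp
  then have "ev (a \<otimes> (alt_prod W k b a \<otimes> w)) (f A a \<otimes>\<^bsub>H\<^esub> (alt_prod H k (f B b) (f A a) \<otimes>\<^bsub>H\<^esub> h))"
    using Suc.prems red by (intro reduced_eval.step)
  moreover have "a \<in> carrier W" "b \<in> carrier W" "f A a \<in> carrier H" "f B b \<in> carrier H"
    using Suc.prems gen_closed f_closed by auto
  ultimately show ?case using w by (simp add: m_assoc H.m_assoc)
qed

text \<open>Induction on length, comparing the first letters of two expressions. On a common wall
  both letters equal the value of \<sigma> there and cancel. On different walls
  \<open>dihedral_prefix\<close> splits off an alternating word in these two letters; the induction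
  hypothesis evaluates both tails through it, and \<open>f_relation\<close> identifies the
  results.\<close>

lemma ev_unique: "ev x h \<Longrightarrow> ev x h' \<Longrightarrow> h = h'"
proof (induction "len x" arbitrary: x h h' rule: less_induct)
  case less
  have x: "x \<in> carrier W" using reduced_eval_closed[OF less.prems(1)] .
  show ?case
  proof (cases "x = \<one>")
    case True
    have "g = \<one>\<^bsub>H\<^esub>" if "ev x g" for g
      using that
    proof cases
      case (step y k R s)
      have "len x = Suc (len y)"
        using len_up[OF step(4,5) reduced_eval_closed[OF step(3)] step(6,7)] step(1) by simp
      then show ?thesis using True by simp
    qed simp
    from this[OF less.prems(1)] this[OF less.prems(2)] show ?thesis by simp
  next
    case False
    have dec: "\<exists>R s y k. g = f R s \<otimes>\<^bsub>H\<^esub> k \<and> x = s \<otimes> y \<and> ev y k \<and> R \<in> \<Delta> \<and> s \<in> R \<and> s \<noteq> \<one>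
        \<and> len x = Suc (len y) \<and> \<sigma> R x = s" if "ev x g" for g
      using that
    proof cases
      case (step y k R s)
      have y: "y \<in> carrier W" using reduced_eval_closed[OF step(3)] .
      have len: "len (s \<otimes> y) = Suc (len y)" using len_up[OF step(4,5) y step(6,7)] .
      show ?thesis
        using step len len_letter_eq(2)[OF step(4,5) y len]
        by (intro exI[of _ R] exI[of _ s] exI[of _ y] exI[of _ k]) simp
    qed (use False in simp)
    obtain A a y k where 1: "h = f A a \<otimes>\<^bsub>H\<^esub> k" "x = a \<otimes> y" "ev y k" "A \<in> \<Delta>" "a \<in> A" "a \<noteq> \<one>"
      "len x = Suc (len y)" "\<sigma> A x = a" using dec[OF less.prems(1)] by blast
    obtain B b z l where 2: "h' = f B b \<otimes>\<^bsub>H\<^esub> l" "x = b \<otimes> z" "ev z l" "B \<in> \<Delta>" "b \<in> B" "b \<noteq> \<one>"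
      "len x = Suc (len z)" "\<sigma> B x = b" using dec[OF less.prems(2)] by blast
    have cl: "a \<in> carrier W" "b \<in> carrier W" "y \<in> carrier W" "z \<in> carrier W"
      using gen_closed[OF 1(4,5)] gen_closed[OF 2(4,5)] reduced_eval_closed[OF 1(3)]
        reduced_eval_closed[OF 2(3)] by auto
    show ?thesis
    proof (cases "A = B")
      case True
      then have "a = b" using 1 2 by simp
      then have "y = z" using 1 2 cl by (metis l_cancel)
      then show ?thesis using less.hyps[of y k l] 1 2 True \<open>a = b\<close> by simp
    next
      case False
      have "A \<in> N x" "B \<in> N x" using 1 2 by (simp_all add: in_N_gen)
      then obtain n a' b' w where *: "a' \<in> A - {\<one>}" "b' \<in> B - {\<one>}" "w \<in> carrier W"
        "x = alt_prod W n a' b' \<otimes> w" "alt_prod W n a' b' = alt_prod W n b' a'" "len x = n + len w"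
        "A \<in> N (alt_prod W n a' b')" "B \<in> N (alt_prod W n a' b')"
        using dihedral_prefix[OF 1(4) 2(4) False x] by blast
      obtain j where j: "n = Suc j" using *(7) by (cases n) auto
      have ab': "a' \<in> A" "b' \<in> B" using *(1,2) by auto
      have len1: "len (alt_prod W (Suc j) a' b' \<otimes> w) = Suc j + len w"
        and len2: "len (alt_prod W (Suc j) b' a' \<otimes> w) = Suc j + len w" using * j by metis+
      note red1 = reduced_alt_prod[OF 1(4) 2(4) ab'(1,2) *(3) len1]
      note red2 = reduced_alt_prod[OF 2(4) 1(4) ab'(2,1) *(3) len2]
      \<comment> \<open>The prefix must use the given first letters, because \<sigma> of
        \<open>x\<close> on the two walls determines them.\<close>
      have aa: "a' = a" using red1(3) 1(8) *(4) j by simp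
      have bb: "b' = b" using red2(3) 2(8) *(4,5) j by simp
      have "len (alt_prod W n a b) \<le> n" using len_alt_prod_le[OF 1(4) 2(4) 1(5) 2(5)] .
      moreover have "len x \<le> len (alt_prod W n a b) + len w"
        using len_mult[of "alt_prod W n a b" w] * cl by (simp add: aa bb)
      ultimately have "len (alt_prod W n a b) = n" using *(6) by simp
      then have e: "{A, B} \<in> refl_edges" "refl_label {A, B} = n"
        using refl_label_unique[OF 1(4) 2(4) False *(1,2,7,8)] unfolding aa bb by simp_all
      obtain g where g: "ev w g" using reduced_eval_exists[OF *(3), of H f] by blast
      have y: "y = alt_prod W j b a \<otimes> w"
        using *(4) 1(2) cl *(3) by (simp add: j aa bb m_assoc)
      have z: "z = alt_prod W j a b \<otimes> w"
      proof -
        have "b \<otimes> z = alt_prod W n b a \<otimes> w" using *(4,5) 2(2) by (simp only: aa bb)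
        then show ?thesis using cl *(3) by (simp add: j m_assoc)
      qed
      have "ev y (alt_prod H j (f B b) (f A a) \<otimes>\<^bsub>H\<^esub> g)"
        unfolding y using ev_alt_prod[OF 2(4) 1(4) 2(5) 1(5) g, of j] red1(1) by (simp add: aa bb)
      then have k: "k = alt_prod H j (f B b) (f A a) \<otimes>\<^bsub>H\<^esub> g"
        using less.hyps[of y k] 1 by simp
      have "ev z (alt_prod H j (f A a) (f B b) \<otimes>\<^bsub>H\<^esub> g)"
        unfolding z using ev_alt_prod[OF 1(4) 2(4) 1(5) 2(5) g, of j] red2(1) by (simp add: aa bb)
      then have l: "l = alt_prod H j (f A a) (f B b) \<otimes>\<^bsub>H\<^esub> g"
        using less.hyps[of z l] 2 by simp
      have fc: "f A a \<in> carrier H" "f B b \<in> carrier H" "g \<in> carrier H"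
        using f_closed[OF 1(4,5)] f_closed[OF 2(4,5)] ev_closed[OF g] by auto
      have "h = alt_prod H n (f A a) (f B b) \<otimes>\<^bsub>H\<^esub> g" using 1(1) k fc by (simp add: j H.m_assoc)
      also have "alt_prod H n (f A a) (f B b) = alt_prod H n (f B b) (f A a)"
        using f_relation[OF e(1), of a b] 1 2 e(2) by simp
      also have "\<dots> \<otimes>\<^bsub>H\<^esub> g = h'" using 2(1) l fc by (simp add: j H.m_assoc)
      finally show ?thesis .
    qed
  qed
qed

definition extension :: "'a \<Rightarrow> 'c" where
  "extension x = (THE h. ev x h)"

lemma extension_eq: "ev x h \<Longrightarrow> extension x = h"
  unfolding extension_def by (rule the_equality) (auto dest: ev_unique)

lemma ev_extension: "x \<in> carrier W \<Longrightarrow> ev x (extension x)"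
  using reduced_eval_exists[of x H f] extension_eq by blast

lemma extension_closed: "x \<in> carrier W \<Longrightarrow> extension x \<in> carrier H"
  by (rule ev_closed[OF ev_extension])

text \<open>If \<open>x\<close> already crosses \<open>R\<close>, the letter is first merged with
  the value of \<sigma>. The remaining factor lies in the identity's sector of \<open>R\<close>,
  where every nontrivial letter of \<open>R\<close> is a reduced step.\<close>

lemma extension_letter:
  assumes "R \<in> \<Delta>" "s \<in> R" "x \<in> carrier W"
  shows "extension (s \<otimes> x) = f R s \<otimes>\<^bsub>H\<^esub> extension x"
proof -
  have *: "extension (t \<otimes> y) = f R t \<otimes>\<^bsub>H\<^esub> extension y"
    if "t \<in> R" "y \<in> carrier W" "\<sigma> R y = \<one>" for t y
  proof (cases "t = \<one>")
    case True
    then show ?thesis using that extension_closed f_one assms by simp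
  next
    case False
    then show ?thesis using that assms by (intro extension_eq reduced_eval.step ev_extension)
  qed
  show ?thesis
  proof (cases "\<sigma> R x = \<one>")
    case True
    then show ?thesis using * assms by blast
  next
    case False
    let ?a = "\<sigma> R x"
    let ?y = "inv ?a \<otimes> x"
    have a: "?a \<in> R" "?a \<in> carrier W" "s \<in> carrier W" using cocycle_in gen_T gen_closed assms by auto
    have y: "?y \<in> carrier W" "\<sigma> R ?y = \<one>" using a assms len_down[OF assms(1,3) False] by auto
    have "extension (s \<otimes> x) = extension ((s \<otimes> ?a) \<otimes> ?y)" using a assms by (simp add: m_assoc)
    also have "\<dots> = f R (s \<otimes> ?a) \<otimes>\<^bsub>H\<^esub> extension ?y"
      using * y gen_mult[OF assms(1,2) a(1)] by blast
    also have "\<dots> = f R s \<otimes>\<^bsub>H\<^esub> (f R ?a \<otimes>\<^bsub>H\<^esub> extension ?y)"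
      using assms a y by (simp add: f_mult H.m_assoc f_closed extension_closed)
    also have "f R ?a \<otimes>\<^bsub>H\<^esub> extension ?y = extension (?a \<otimes> ?y)" using * a y by simp
    also have "?a \<otimes> ?y = x" using a assms by simp
    finally show ?thesis .
  qed
qed

lemma extension_one: "extension \<one> = \<one>\<^bsub>H\<^esub>"
  by (rule extension_eq) (rule reduced_eval.one)

lemma extension_hom: "extension \<in> hom W H"
proof (rule homI)
  fix x y assume "x \<in> carrier W" "y \<in> carrier W"
  then show "extension (x \<otimes> y) = extension x \<otimes>\<^bsub>H\<^esub> extension y"
  proof (induction rule: W_induct)
    case one
    then show ?case by (simp add: extension_one extension_closed)
  next
    case (step R s x)
    have "s \<in> carrier W" using step gen_closed by auto
    then show ?case
      using step by (simp add: m_assoc extension_letter H.m_assoc f_closed extension_closed)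
  qed
qed (rule extension_closed)

end

section \<open>The cocycle of a periagroup\<close>

text \<open>For involutions the inverse is the reversed word, whose first letter depends on the
  parity of \<open>k\<close>.\<close>

lemma (in group) alt_prod_reverse:
  assumes "s \<in> carrier G" "t \<in> carrier G" "s \<otimes> s = \<one>" "t \<otimes> t = \<one>"
  shows "alt_prod G k s t \<otimes> (if even k then alt_prod G k t s else alt_prod G k s t) = \<one>"
  using assms
proof (induction k arbitrary: s t)
  case (Suc k)
  let ?z = "if even k then alt_prod G k s t else alt_prod G k t s"
  have z: "?z \<in> carrier G" using Suc.prems by simp
  have "(if even (Suc k) then alt_prod G (Suc k) t s else alt_prod G (Suc k) s t) = ?z \<otimes> s"
    using alt_prod_snoc[of s t k] alt_prod_snoc[of t s k] Suc.prems by (simp del: alt_prod.simps)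
  moreover have "alt_prod G k t s \<otimes> ?z = \<one>" using Suc.IH[of t s] Suc.prems by simp
  moreover have "alt_prod G (Suc k) s t \<otimes> (?z \<otimes> s) = s \<otimes> (alt_prod G k t s \<otimes> ?z) \<otimes> s"
    using Suc.prems z by (simp add: m_assoc)
  ultimately show ?case using Suc.prems by simp
qed simp

text \<open>Odd alternating words are the reflections of the dihedral group. The relation makes the
  word of length \<open>2 * m\<close> trivial; it splits into two odd words, the second of which is
  its own inverse.\<close>

lemma (in group) alt_prod_reflect:
  assumes st: "s \<in> carrier G" "t \<in> carrier G" "s \<otimes> s = \<one>" "t \<otimes> t = \<one>"
    and m: "alt_prod G m s t = alt_prod G m t s" and ij: "i + j + 1 = m"
  shows "alt_prod G (2 * i + 1) s t = alt_prod G (2 * j + 1) t s"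
proof -
  let ?x = "alt_prod G (2 * i + 1) s t"
  let ?y = "alt_prod G (2 * j + 1) t s"
  have cl: "?x \<in> carrier G" "?y \<in> carrier G" using st by (blast intro: alt_prod_closed)+
  have "2 * m = (2 * i + 1) + (2 * j + 1)" using ij by simp
  then have "alt_prod G (2 * m) s t = ?x \<otimes> ?y"
    using alt_prod_add[OF st(1,2), of "2 * i + 1" "2 * j + 1"] by (simp del: alt_prod.simps)
  moreover have "alt_prod G (2 * m) s t = \<one>"
    using alt_prod_add[OF st(1,2), of m m] alt_prod_reverse[OF st, of m] m
    by (simp add: mult_2 del: alt_prod.simps split: if_splits)
  ultimately have "?x \<otimes> ?y = \<one>" by simp
  moreover have "?y \<otimes> ?y = \<one>" using alt_prod_reverse[of t s "2 * j + 1"] st by (simp del: alt_prod.simps)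
  ultimately show ?thesis using cl by (metis r_cancel)
qed

lemma order_two_elems:
  assumes "group M" "order M = 2" "a \<in> carrier M" "a \<noteq> \<one>\<^bsub>M\<^esub>"
  shows "carrier M = {\<one>\<^bsub>M\<^esub>, a}" "a \<otimes>\<^bsub>M\<^esub> a = \<one>\<^bsub>M\<^esub>"
proof -
  interpret M: group M by fact
  have c: "card (carrier M) = 2" using assms by (simp add: order_def)
  then have "finite (carrier M)" by (simp add: card_ge_0_finite)
  then show *: "carrier M = {\<one>\<^bsub>M\<^esub>, a}"
    using card_subset_eq[of "carrier M" "{\<one>\<^bsub>M\<^esub>, a}"] assms c by simp
  have "a \<otimes>\<^bsub>M\<^esub> a \<noteq> a" using assms M.l_cancel_one' by metis
  then show "a \<otimes>\<^bsub>M\<^esub> a = \<one>\<^bsub>M\<^esub>" using * assms(3) M.m_closed by blast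
qed

context periagroup_data
begin

lemma \<iota>_retraction:
  assumes "monoid H" "u \<in> V" "\<And>v. v \<in> V \<Longrightarrow> f v \<in> hom (G v) H" "\<And>v. v \<in> V \<Longrightarrow> f v \<one>\<^bsub>G v\<^esub> = \<one>\<^bsub>H\<^esub>"
    "\<And>v w a b. {v, w} \<in> E \<Longrightarrow> a \<in> carrier (G v) - {\<one>\<^bsub>G v\<^esub>} \<Longrightarrow> b \<in> carrier (G w) - {\<one>\<^bsub>G w\<^esub>}
      \<Longrightarrow> alt_prod H (lab {v, w}) (f v a) (f w b) = alt_prod H (lab {v, w}) (f w b) (f v a)"
    "a \<in> carrier (G u)" "f u a \<noteq> \<one>\<^bsub>H\<^esub>"
  shows "\<iota> u a \<noteq> \<one>\<^bsub>P\<^esub>"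
proof -
  have "\<exists>\<phi>. \<phi> \<one>\<^bsub>P\<^esub> = \<one>\<^bsub>H\<^esub> \<and> \<phi> (\<iota> u a) = f u a"
    by (rule periagroup_universal[OF assms(1), of f]) (use assms in blast)+
  then show ?thesis using assms(7) by auto
qed

text \<open>A vertex-group of order two is detected by the sign map, any other one by the retraction onto it,
  which exists since all edges at its vertex have label two.\<close>

lemma \<iota>_nontrivial:
  assumes u: "u \<in> V" "a \<in> carrier (G u)" "a \<noteq> \<one>\<^bsub>G u\<^esub>" shows "\<iota> u a \<noteq> \<one>\<^bsub>P\<^esub>"
proof (cases "order (G u) = 2")
  case True
  let ?H = "\<lparr>carrier = UNIV, monoid.mult = (*), one = 1\<rparr> :: int monoid"
  define f where "f v x = (if order (G v) = 2 \<and> x \<noteq> \<one>\<^bsub>G v\<^esub> then -1 else 1 :: int)" for v x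
  have comm: "alt_prod ?H 2 x y = alt_prod ?H 2 y x" for x y by (simp add: numeral_2_eq_2)
  show ?thesis
  proof (rule \<iota>_retraction[of ?H u f])
    show "monoid ?H" by unfold_locales auto
    fix v assume v: "v \<in> V"
    interpret Gv: group "G v" by (rule groups) fact
    show "f v \<one>\<^bsub>G v\<^esub> = \<one>\<^bsub>?H\<^esub>" by (simp add: f_def)
    show "f v \<in> hom (G v) ?H"
    proof (rule homI)
      fix x y assume xy: "x \<in> carrier (G v)" "y \<in> carrier (G v)"
      show "f v (x \<otimes>\<^bsub>G v\<^esub> y) = f v x \<otimes>\<^bsub>?H\<^esub> f v y"
      proof (cases "order (G v) = 2 \<and> x \<noteq> \<one>\<^bsub>G v\<^esub> \<and> y \<noteq> \<one>\<^bsub>G v\<^esub>")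
        case True
        then have "x \<otimes>\<^bsub>G v\<^esub> y = \<one>\<^bsub>G v\<^esub>"
          using order_two_elems[OF Gv.is_group _ xy(1)] xy by auto
        then show ?thesis using True by (simp add: f_def)
      qed (use xy in \<open>auto simp: f_def\<close>)
    qed simp
  next
    fix v w x y
    assume e: "{v, w} \<in> E" "x \<in> carrier (G v) - {\<one>\<^bsub>G v\<^esub>}" "y \<in> carrier (G w) - {\<one>\<^bsub>G w\<^esub>}"
    show "alt_prod ?H (lab {v, w}) (f v x) (f w y) = alt_prod ?H (lab {v, w}) (f w y) (f v x)"
    proof (cases "lab {v, w} = 2")
      case False
      then have "order (G v) = 2 \<and> order (G w) = 2" using order_2 label_ge_2 e by force
      then show ?thesis using e by (simp add: f_def)
    qed (simp only: comm)
  next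
    show "f u a \<noteq> \<one>\<^bsub>?H\<^esub>" using True u by (simp add: f_def)
  qed (use u in auto)
next
  case False
  interpret Gu: group "G u" by (rule groups) fact
  define f where "f v x = (if v = u then x else \<one>\<^bsub>G u\<^esub>)" for v x
  show ?thesis
  proof (rule \<iota>_retraction[of "G u" u f])
    show "monoid (G u)" by (rule Gu.is_monoid)
    show "f v \<in> hom (G v) (G u)" if "v \<in> V" for v
      by (rule homI) (auto simp: f_def)
    fix v w x y
    assume e: "{v, w} \<in> E" "x \<in> carrier (G v) - {\<one>\<^bsub>G v\<^esub>}" "y \<in> carrier (G w) - {\<one>\<^bsub>G w\<^esub>}"
    show "alt_prod (G u) (lab {v, w}) (f v x) (f w y) = alt_prod (G u) (lab {v, w}) (f w y) (f v x)"
    proof (cases "u \<in> {v, w}")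
      case True
      then have "lab {v, w} = 2" using order_2 label_ge_2 e False by force
      moreover have comm: "alt_prod (G u) 2 z \<one>\<^bsub>G u\<^esub> = alt_prod (G u) 2 \<one>\<^bsub>G u\<^esub> z" if "z \<in> carrier (G u)" for z
        using that by (simp add: numeral_2_eq_2)
      moreover have "v \<noteq> w" using edge_vertices e by blast
      ultimately show ?thesis
        using True e(2,3) comm[of x] comm[of y] by (cases "u = v") (simp_all add: f_def)
    qed (auto simp: f_def)
  qed (use u in \<open>auto simp: f_def\<close>)
qed

section \<open>Conjugates of vertex-groups and the action of letters on sectors\<close>

abbreviation "A \<equiv> vertex_subgroup V E lab G"

lemma A_def: "A u = \<iota> u ` carrier (G u)"
  by (simp add: vertex_subgroup_def vertex_emb_def)

lemma A_subgroup: "u \<in> V \<Longrightarrow> subgroup (A u) P"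
  using group_hom.img_is_subgroup[of "G u" P "\<iota> u"] \<iota>_hom[of u] groups[of u]
  by (simp add: A_def group_hom_def group_hom_axioms_def P.is_group)

lemma \<iota>_inj: "u \<in> V \<Longrightarrow> inj_on (\<iota> u) (carrier (G u))"
  using group_hom.inj_iff_trivial_ker[of "G u" P "\<iota> u"] \<iota>_hom[of u] groups[of u] \<iota>_nontrivial[of u]
    \<iota>_one[of u] monoid.one_closed[OF group.is_monoid[OF groups[of u]]]
  by (auto simp: group_hom_def group_hom_axioms_def P.is_group kernel_def)

definition conjugates :: "('v, 'a) periagroup_elem set set" where
  "conjugates = {conj_set P g (A u) | g u. g \<in> carrier P \<and> u \<in> V}"

lemma vertex_conjugates_eq: "vertex_conjugates V E lab G = conjugates"
proof -
  have "(g <#\<^bsub>P\<^esub> B) #>\<^bsub>P\<^esub> inv\<^bsub>P\<^esub> g = conj_set P g B" for g B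
    by (auto simp: l_coset_def r_coset_def conj_set_def conj_by_def)
  then show ?thesis unfolding vertex_conjugates_def conjugates_def Let_def by simp
qed

lemma A_sub: "u \<in> V \<Longrightarrow> A u \<subseteq> carrier P"
  using A_subgroup subgroup.subset by blast

lemma conjugates_subgroup: "R \<in> conjugates \<Longrightarrow> subgroup R P"
  unfolding conjugates_def using A_subgroup P.conj_set_subgroup by blast

lemma conjugates_sub: "R \<in> conjugates \<Longrightarrow> R \<subseteq> carrier P"
  using conjugates_subgroup subgroup.subset by blast

lemma conjugates_conj:
  assumes "R \<in> conjugates" "x \<in> carrier P" shows "conj_set P x R \<in> conjugates"
proof -
  obtain g u where "R = conj_set P g (A u)" "g \<in> carrier P" "u \<in> V"
    using assms(1) unfolding conjugates_def by blast
  then have "conj_set P x R = conj_set P (x \<otimes>\<^bsub>P\<^esub> g) (A u)"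
    using assms(2) A_sub by (simp add: P.conj_set_comp)
  then show ?thesis unfolding conjugates_def using assms(2) \<open>g \<in> carrier P\<close> \<open>u \<in> V\<close> by blast
qed

lemma A_conjugates: assumes "u \<in> V" shows "A u \<in> conjugates"
proof -
  have "A u = conj_set P \<one>\<^bsub>P\<^esub> (A u)" using A_sub[OF assms] by simp
  then show ?thesis unfolding conjugates_def using assms P.one_closed by blast
qed

text \<open>An element \<open>r\<close> of a conjugate \<open>R\<close> labels the sector \<open>r D\<close> of the hyperplane of \<open>R\<close>, where \<open>D\<close> is the
  sector containing the identity; \<open>letter_action\<close> is the action of a letter on these sectors.\<close>

definition letter_action ::
  "'v \<Rightarrow> 'a \<Rightarrow> ('v, 'a) periagroup_elem set \<times> ('v, 'a) periagroup_elem
    \<Rightarrow> ('v, 'a) periagroup_elem set \<times> ('v, 'a) periagroup_elem" where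
  "letter_action u a = (\<lambda>(R, r).
    if R \<in> conjugates \<and> r \<in> R then
      if R = A u then (R, \<iota> u a \<otimes>\<^bsub>P\<^esub> r) else (conj_set P (\<iota> u a) R, conj_by P (\<iota> u a) r)
    else (R, r))"

abbreviation "Fun \<equiv> \<lparr>carrier = UNIV, monoid.mult = (\<circ>), one = id\<rparr>
  :: (('v, 'a) periagroup_elem set \<times> ('v, 'a) periagroup_elem
    \<Rightarrow> ('v, 'a) periagroup_elem set \<times> ('v, 'a) periagroup_elem) monoid"

lemma monoid_Fun: "monoid Fun"
  by unfold_locales (auto simp: comp_assoc)

lemma letter_action_outside:
  "\<not> (R \<in> conjugates \<and> r \<in> R) \<Longrightarrow> letter_action u a (R, r) = (R, r)"
  by (auto simp: letter_action_def)

lemma letter_action_same: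
  "u \<in> V \<Longrightarrow> r \<in> A u \<Longrightarrow> letter_action u a (A u, r) = (A u, \<iota> u a \<otimes>\<^bsub>P\<^esub> r)"
  by (simp add: letter_action_def A_conjugates)

lemma letter_action_other:
  "R \<in> conjugates \<Longrightarrow> r \<in> R \<Longrightarrow> R \<noteq> A u
    \<Longrightarrow> letter_action u a (R, r) = (conj_set P (\<iota> u a) R, conj_by P (\<iota> u a) r)"
  by (simp add: letter_action_def)

lemma \<iota>_A: "a \<in> carrier (G u) \<Longrightarrow> \<iota> u a \<in> A u"
  by (simp add: A_def)

lemma A_mult: "u \<in> V \<Longrightarrow> a \<in> carrier (G u) \<Longrightarrow> r \<in> A u \<Longrightarrow> \<iota> u a \<otimes>\<^bsub>P\<^esub> r \<in> A u"
  using subgroup.m_closed[OF A_subgroup] \<iota>_A by blast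

lemma conj_set_\<iota>_self: "u \<in> V \<Longrightarrow> a \<in> carrier (G u) \<Longrightarrow> conj_set P (\<iota> u a) (A u) = A u"
  using P.conj_set_self[OF A_subgroup] \<iota>_A by blast

lemma conj_set_cancel:
  assumes "R \<in> conjugates" "Q \<in> conjugates" "x \<in> carrier P" "conj_set P x R = conj_set P x Q"
  shows "R = Q"
  using assms conjugates_sub P.conj_set_inv_cancel(1) by metis

lemma conj_by_in_conj_set: "r \<in> R \<Longrightarrow> conj_by M x r \<in> conj_set M x R"
  by (simp add: conj_set_def)

lemma conj_set_\<iota>_eq:
  assumes "u \<in> V" "a \<in> carrier (G u)" "R \<in> conjugates"
  shows "conj_set P (\<iota> u a) R = A u \<longleftrightarrow> R = A u"
  using conj_set_cancel[OF assms(3) A_conjugates[OF assms(1)], of "\<iota> u a"] conj_set_\<iota>_self assms by auto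

lemma letter_action_mult:
  assumes u: "u \<in> V" "a \<in> carrier (G u)" "b \<in> carrier (G u)"
  shows "letter_action u (a \<otimes>\<^bsub>G u\<^esub> b) = letter_action u a \<circ> letter_action u b"
proof (rule ext, clarify)
  fix R r
  interpret Gu: group "G u" by (rule groups) fact
  show "letter_action u (a \<otimes>\<^bsub>G u\<^esub> b) (R, r) = (letter_action u a \<circ> letter_action u b) (R, r)"
  proof (cases "R \<in> conjugates \<and> r \<in> R")
    case R: True
    then have r: "r \<in> carrier P" using conjugates_sub by blast
    show ?thesis
    proof (cases "R = A u")
      case True
      then show ?thesis using R u r by (simp add: letter_action_same A_mult \<iota>_mult P.m_assoc)
    next
      case False
      have *: "conj_set P (\<iota> u b) R \<noteq> A u" using False R u conj_set_\<iota>_eq by blast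
      show ?thesis using False R u r conjugates_sub
        by (simp add: letter_action_other * conjugates_conj conj_by_in_conj_set \<iota>_mult
            P.conj_by_comp P.conj_set_comp)
    qed
  qed (simp add: letter_action_outside)
qed

lemma letter_action_one:
  assumes u: "u \<in> V" shows "letter_action u \<one>\<^bsub>G u\<^esub> = id"
proof (rule ext, clarify)
  fix R r
  show "letter_action u \<one>\<^bsub>G u\<^esub> (R, r) = id (R, r)"
  proof (cases "R \<in> conjugates \<and> r \<in> R")
    case True
    then have "R \<subseteq> carrier P" "r \<in> carrier P" using conjugates_sub by blast+
    then show ?thesis using u by (simp add: letter_action_def)
  qed (simp add: letter_action_outside)
qed

lemma letter_action_commute:
  assumes e: "{u, v} \<in> E" "lab {u, v} = 2" and ab: "a \<in> carrier (G u)" "b \<in> carrier (G v)"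
  shows "letter_action u a \<circ> letter_action v b = letter_action v b \<circ> letter_action u a"
proof (rule ext, clarify)
  fix R r
  have uv: "u \<in> V" "v \<in> V" using edge_vertices e by auto
  interpret Gu: group "G u" by (rule groups) fact
  interpret Gv: group "G v" by (rule groups) fact
  have comm: "\<iota> u x \<otimes>\<^bsub>P\<^esub> \<iota> v y = \<iota> v y \<otimes>\<^bsub>P\<^esub> \<iota> u x" if "x \<in> carrier (G u)" "y \<in> carrier (G v)" for x y
  proof (cases "x = \<one>\<^bsub>G u\<^esub> \<or> y = \<one>\<^bsub>G v\<^esub>")
    case False
    then show ?thesis using \<iota>_relation[OF e(1), of x y] that uv by (simp add: e(2) numeral_2_eq_2)
  qed (use that uv in auto)
  let ?s = "\<iota> u a" let ?t = "\<iota> v b"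
  have st: "?s \<in> carrier P" "?t \<in> carrier P" using uv ab by auto
  have cs: "conj_by P ?s x = x" if "x \<in> A v" for x
    using that comm[OF ab(1)] st uv by (auto simp: A_def conj_by_def P.m_assoc)
  have ct: "conj_by P ?t x = x" if "x \<in> A u" for x
    using that comm[OF _ ab(2), symmetric] st uv by (auto simp: A_def conj_by_def P.m_assoc)
  have sA: "conj_set P ?s (A v) = A v" using cs by (simp add: conj_set_def)
  have tA: "conj_set P ?t (A u) = A u" using ct by (simp add: conj_set_def)
  show "(letter_action u a \<circ> letter_action v b) (R, r) = (letter_action v b \<circ> letter_action u a) (R, r)"
  proof (cases "R \<in> conjugates \<and> r \<in> R")
    case R: True
    then have r: "r \<in> carrier P" using conjugates_sub by blast
    have AA: "A u \<in> conjugates" "A v \<in> conjugates" using A_conjugates uv by auto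
    consider "R = A u" "R = A v" | "R = A u" "R \<noteq> A v" | "R \<noteq> A u" "R = A v" | "R \<noteq> A u" "R \<noteq> A v"
      by blast
    then show ?thesis
    proof cases
      \<comment> \<open>Distinct vertices may have equal images, for instance when both
        vertex-groups are trivial.\<close>
      case 1
      have "?t \<otimes>\<^bsub>P\<^esub> r \<in> A u" "?s \<otimes>\<^bsub>P\<^esub> r \<in> A v" using A_mult uv ab R 1 by metis+
      moreover have "letter_action u a (R, x) = (R, ?s \<otimes>\<^bsub>P\<^esub> x)" "letter_action v b (R, x) = (R, ?t \<otimes>\<^bsub>P\<^esub> x)"
        if "x \<in> R" for x
        using that letter_action_same uv 1 by metis+
      ultimately show ?thesis
        using R 1 comm[OF ab] st r by (simp flip: P.m_assoc)
    next
      case 2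
      then show ?thesis using R uv ab AA
        by (simp add: letter_action_same letter_action_other A_mult ct tA)
    next
      case 3
      then show ?thesis using R uv ab AA
        by (simp add: letter_action_same letter_action_other A_mult cs sA)
    next
      case 4
      have "conj_set P ?t R \<noteq> A u" using conj_set_cancel[OF _ AA(1) st(2)] R 4 tA by metis
      moreover have "conj_set P ?s R \<noteq> A v" using conj_set_cancel[OF _ AA(2) st(1)] R 4 sA by metis
      ultimately show ?thesis using 4 R st r conjugates_sub comm[OF ab]
        by (simp add: letter_action_other conjugates_conj conj_by_in_conj_set
            flip: P.conj_by_comp P.conj_set_comp)
    qed
  qed (simp add: letter_action_outside)
qed

end

section \<open>The action of alternating words of involutions\<close>

lemma (in group) conj_by_pow:
  assumes "x \<in> carrier G" "r \<in> carrier G"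
  shows "conj_by G x (r [^] (n :: nat)) = conj_by G x r [^] n"
  using assms by (induction n) (simp_all add: conj_by_mult)

lemma (in group) subgroup_pow_closed: "subgroup R G \<Longrightarrow> r \<in> R \<Longrightarrow> r [^] (n :: nat) \<in> R"
  by (induction n) (auto simp: subgroup.m_closed subgroup.one_closed)

context periagroup_data
begin

lemma order_two_vertex:
  assumes u: "u \<in> V" "order (G u) = 2" "a \<in> carrier (G u) - {\<one>\<^bsub>G u\<^esub>}"
  shows "A u = {\<one>\<^bsub>P\<^esub>, \<iota> u a}" "\<iota> u a \<otimes>\<^bsub>P\<^esub> \<iota> u a = \<one>\<^bsub>P\<^esub>" "\<iota> u a \<noteq> \<one>\<^bsub>P\<^esub>"
proof -
  have a: "a \<in> carrier (G u)" "a \<noteq> \<one>\<^bsub>G u\<^esub>" using u by auto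
  note o = order_two_elems[OF groups[OF u(1)] u(2) a]
  show "A u = {\<one>\<^bsub>P\<^esub>, \<iota> u a}" unfolding A_def o(1) using \<iota>_one[OF u(1)] by simp
  show "\<iota> u a \<otimes>\<^bsub>P\<^esub> \<iota> u a = \<one>\<^bsub>P\<^esub>" using \<iota>_mult[OF u(1) a(1) a(1)] \<iota>_one[OF u(1)] o(2) by simp
  show "\<iota> u a \<noteq> \<one>\<^bsub>P\<^esub>" using \<iota>_nontrivial[OF u(1) a] .
qed

text \<open>A two-sector hyperplane is conjugated along the word and flipped whenever it meets the
  wall of the next letter. Seen from the end of the word, the flips are the indices whose odd
  alternating word equals the final reflection. Keeping the exponent a natural number avoids parity
  bookkeeping.\<close>

lemma dihedral_action:
  assumes "u \<in> V" "order (G u) = 2" "a \<in> carrier (G u) - {\<one>\<^bsub>G u\<^esub>}"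
    and "v \<in> V" "order (G v) = 2" "b \<in> carrier (G v) - {\<one>\<^bsub>G v\<^esub>}"
    and R: "R \<in> conjugates" "R = {\<one>\<^bsub>P\<^esub>, \<rho>}" "\<rho> \<noteq> \<one>\<^bsub>P\<^esub>"
  shows "alt_prod Fun k (letter_action u a) (letter_action v b) (R, \<rho> [^]\<^bsub>P\<^esub> j)
    = (conj_set P (alt_prod P k (\<iota> u a) (\<iota> v b)) R,
       conj_by P (alt_prod P k (\<iota> u a) (\<iota> v b)) \<rho> [^]\<^bsub>P\<^esub>
         (j + card {i. i < k \<and> conj_by P (alt_prod P k (\<iota> u a) (\<iota> v b)) \<rho>
           = alt_prod P (2 * i + 1) (\<iota> u a) (\<iota> v b)}))"
  using assms(1-6)
proof (induction k arbitrary: u v a b)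
  case 0
  then show ?case using R conjugates_sub[OF R(1)] by simp
next
  case (Suc k)
  let ?s = "\<iota> u a" let ?t = "\<iota> v b"
  note s2 = order_two_vertex[OF Suc.prems(1-3)]
  have st: "?s \<in> carrier P" "?t \<in> carrier P" using Suc.prems by auto
  have \<rho>: "\<rho> \<in> carrier P" using R conjugates_sub by blast
  define y where "y = alt_prod P k ?t ?s"
  define \<rho>' where "\<rho>' = conj_by P y \<rho>"
  define n where "n = j + card {i. i < k \<and> \<rho>' = alt_prod P (2 * i + 1) ?t ?s}"
  have y: "y \<in> carrier P" using st by (simp add: y_def)
  have \<rho>': "\<rho>' \<in> carrier P" "\<rho>' \<noteq> \<one>\<^bsub>P\<^esub>" using y \<rho> R by (simp_all add: \<rho>'_def)
  define R' where "R' = conj_set P y R"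
  have R': "R' \<in> conjugates" "R' = {\<one>\<^bsub>P\<^esub>, \<rho>'}"
    using R y by (simp_all add: R'_def conjugates_conj \<rho>'_def) (simp add: conj_set_def)
  have IH: "alt_prod Fun k (letter_action v b) (letter_action u a) (R, \<rho> [^]\<^bsub>P\<^esub> j) = (R', \<rho>' [^]\<^bsub>P\<^esub> n)"
    using Suc.IH[OF Suc.prems(4-6,1-3)] unfolding y_def \<rho>'_def n_def R'_def .
  have x: "alt_prod P (Suc k) ?s ?t = ?s \<otimes>\<^bsub>P\<^esub> y" by (simp add: y_def)
  have conj_x: "conj_by P (?s \<otimes>\<^bsub>P\<^esub> y) \<rho> = conj_by P ?s \<rho>'"
    using st y \<rho> by (simp add: \<rho>'_def P.conj_by_comp)
  have set_x: "conj_set P (?s \<otimes>\<^bsub>P\<^esub> y) R = conj_set P ?s R'"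
    using st y conjugates_sub[OF R(1)] by (simp add: R'_def P.conj_set_comp)
  have inv_s: "inv\<^bsub>P\<^esub> ?s = ?s" using P.inv_equality[OF s2(2) st(1) st(1)] .
  have conj_s: "conj_by P ?s ?s = ?s" using st s2 by (simp add: conj_by_def inv_s)
  \<comment> \<open>Index 0 records a flip by the new first letter; \<open>reflS\<close> moves the
    earlier flips from \<open>i\<close> to \<open>Suc i\<close> after conjugation by it.\<close>
  have refl0: "conj_by P ?s \<rho>' = alt_prod P (2 * 0 + 1) ?s ?t \<longleftrightarrow> \<rho>' = ?s"
  proof -
    show ?thesis using conj_s inj_onD[OF P.conj_by_inj[OF st(1)], of \<rho>' ?s] st \<rho>' by auto
  qed
  have reflS: "conj_by P ?s \<rho>' = alt_prod P (2 * Suc i + 1) ?s ?t \<longleftrightarrow> \<rho>' = alt_prod P (2 * i + 1) ?t ?s" for i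
  proof -
    let ?z = "alt_prod P (2 * i + 1) ?t ?s"
    have z: "?z \<in> carrier P" using st by (blast intro: P.alt_prod_closed)
    have "alt_prod P (2 * Suc i + 1) ?s ?t = conj_by P ?s ?z"
      using P.alt_prod_snoc[OF st(2,1), of "2 * i + 1"] z st by (simp add: conj_by_def inv_s P.m_assoc)
    then show ?thesis using inj_onD[OF P.conj_by_inj[OF st(1)], of \<rho>' ?z] \<rho>' z by auto
  qed
  have "{i. i < Suc k \<and> conj_by P ?s \<rho>' = alt_prod P (2 * i + 1) ?s ?t}
      = (if \<rho>' = ?s then {0} else {}) \<union> Suc ` {i. i < k \<and> \<rho>' = alt_prod P (2 * i + 1) ?t ?s}" (is "?L = _")
  proof (rule Set.set_eqI)
    fix i
    show "i \<in> ?L \<longleftrightarrow> i \<in> (if \<rho>' = ?s then {0} else {}) \<union> Suc ` {i. i < k \<and> \<rho>' = alt_prod P (2 * i + 1) ?t ?s}"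
      by (cases i) (use refl0 reflS in \<open>auto simp del: alt_prod.simps\<close>)
  qed
  then have card: "card ?L = (if \<rho>' = ?s then 1 else 0) + card {i. i < k \<and> \<rho>' = alt_prod P (2 * i + 1) ?t ?s}"
    by (simp add: card_image del: alt_prod.simps)
  have pow: "\<rho>' [^]\<^bsub>P\<^esub> n \<in> R'" using P.subgroup_pow_closed conjugates_subgroup R' by blast
  have letter: "letter_action u a (R', \<rho>' [^]\<^bsub>P\<^esub> n)
      = (conj_set P ?s R', conj_by P ?s \<rho>' [^]\<^bsub>P\<^esub> (j + card ?L))"
  proof (cases "\<rho>' = ?s")
    case True
    then have RA: "R' = A u" using R' s2 by simp
    have "conj_set P ?s R' = R'" using RA conj_set_\<iota>_self Suc.prems by auto
    moreover have "letter_action u a (R', \<rho>' [^]\<^bsub>P\<^esub> n) = (R', ?s \<otimes>\<^bsub>P\<^esub> \<rho>' [^]\<^bsub>P\<^esub> n)"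
      using pow RA letter_action_same Suc.prems(1) by simp
    moreover have "?s \<otimes>\<^bsub>P\<^esub> ?s [^]\<^bsub>P\<^esub> n = ?s [^]\<^bsub>P\<^esub> (j + card ?L)"
      unfolding card n_def using True st P.nat_pow_Suc2 by simp
    ultimately show ?thesis using True conj_s by simp
  next
    case False
    then have "R' \<noteq> A u" using R' s2 \<rho>' by auto
    then show ?thesis
      using pow R' False st \<rho>' card by (simp add: letter_action_other P.conj_by_pow n_def)
  qed
  have "alt_prod Fun (Suc k) (letter_action u a) (letter_action v b) (R, \<rho> [^]\<^bsub>P\<^esub> j)
      = letter_action u a (R', \<rho>' [^]\<^bsub>P\<^esub> n)" using IH by simp
  then show ?case unfolding x conj_x set_x using letter by (rule HOL.trans)
qed

text \<open>Both letters come from vertex-groups of order two, so a hyperplane with another number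
  of sectors never becomes one of their walls and is only conjugated.\<close>

lemma dihedral_action_other:
  assumes "u \<in> V" "order (G u) = 2" "a \<in> carrier (G u) - {\<one>\<^bsub>G u\<^esub>}"
    and "v \<in> V" "order (G v) = 2" "b \<in> carrier (G v) - {\<one>\<^bsub>G v\<^esub>}"
    and R: "R \<in> conjugates" "r \<in> R" "\<nexists>\<rho>. \<rho> \<noteq> \<one>\<^bsub>P\<^esub> \<and> R = {\<one>\<^bsub>P\<^esub>, \<rho>}"
  shows "alt_prod Fun k (letter_action u a) (letter_action v b) (R, r)
    = (conj_set P (alt_prod P k (\<iota> u a) (\<iota> v b)) R, conj_by P (alt_prod P k (\<iota> u a) (\<iota> v b)) r)"
  using assms(1-6)
proof (induction k arbitrary: u v a b)
  case 0
  then show ?case using R conjugates_sub[OF R(1)] by auto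
next
  case (Suc k)
  let ?s = "\<iota> u a" let ?t = "\<iota> v b"
  note s2 = order_two_vertex[OF Suc.prems(1-3)]
  have st: "?s \<in> carrier P" "?t \<in> carrier P" using Suc.prems by auto
  define y where "y = alt_prod P k ?t ?s"
  have y: "y \<in> carrier P" using st by (simp add: y_def)
  have r: "r \<in> carrier P" "R \<subseteq> carrier P" using R conjugates_sub by auto
  have "conj_set P y R \<noteq> A u"
  proof
    assume "conj_set P y R = A u"
    then have "R = conj_set P (inv\<^bsub>P\<^esub> y) {\<one>\<^bsub>P\<^esub>, ?s}" using s2(1) r y by (metis P.conj_set_inv_cancel(1))
    then have "R = {\<one>\<^bsub>P\<^esub>, conj_by P (inv\<^bsub>P\<^esub> y) ?s}" using y by (simp add: conj_set_def)
    then show False using R(3) s2(3) y st by (metis P.conj_by_eq_one P.inv_closed)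
  qed
  then have "letter_action u a (conj_set P y R, conj_by P y r)
      = (conj_set P (?s \<otimes>\<^bsub>P\<^esub> y) R, conj_by P (?s \<otimes>\<^bsub>P\<^esub> y) r)"
    using R y st r by (simp add: letter_action_other conjugates_conj conj_by_in_conj_set
        P.conj_by_comp P.conj_set_comp)
  then show ?case using Suc.IH[OF Suc.prems(4-6,1-3)] by (simp add: y_def)
qed

lemma alt_prod_Fun_outside:
  "\<not> (R \<in> conjugates \<and> r \<in> R) \<Longrightarrow> alt_prod Fun k (letter_action u a) (letter_action v b) (R, r) = (R, r)"
  by (induction k arbitrary: u v a b) (simp_all add: letter_action_outside)

text \<open>For labels above two, only hyperplanes with two sectors are flipped, and the flips made by
  \<open>s t s \<dots>\<close> and \<open>t s t \<dots>\<close> are the same reflections in opposite order.\<close>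

lemma letter_action_relation:
  assumes e: "{u, v} \<in> E" and ab: "a \<in> carrier (G u) - {\<one>\<^bsub>G u\<^esub>}" "b \<in> carrier (G v) - {\<one>\<^bsub>G v\<^esub>}"
  shows "alt_prod Fun (lab {u, v}) (letter_action u a) (letter_action v b)
    = alt_prod Fun (lab {u, v}) (letter_action v b) (letter_action u a)"
proof (cases "lab {u, v} = 2")
  case True
  then show ?thesis using letter_action_commute[OF e True, of a b] ab by (simp add: numeral_2_eq_2)
next
  case False
  then have o: "order (G u) = 2" "order (G v) = 2" using order_2[OF e] label_ge_2[OF e] by auto
  have uv: "u \<in> V" "v \<in> V" using edge_vertices e by auto
  define m where "m = lab {u, v}"
  let ?s = "\<iota> u a" let ?t = "\<iota> v b"
  have st: "?s \<in> carrier P" "?t \<in> carrier P" using uv ab by auto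
  have inv2: "?s \<otimes>\<^bsub>P\<^esub> ?s = \<one>\<^bsub>P\<^esub>" "?t \<otimes>\<^bsub>P\<^esub> ?t = \<one>\<^bsub>P\<^esub>" using order_two_vertex uv o ab by auto
  have rel: "alt_prod P m ?s ?t = alt_prod P m ?t ?s" unfolding m_def using \<iota>_relation[OF e ab] .
  have count: "card {i. i < m \<and> z = alt_prod P (2 * i + 1) ?s ?t} = card {i. i < m \<and> z = alt_prod P (2 * i + 1) ?t ?s}" for z
  proof (rule bij_betw_same_card[of "\<lambda>i. m - 1 - i"])
    have r1: "alt_prod P (2 * i + 1) ?s ?t = alt_prod P (2 * (m - 1 - i) + 1) ?t ?s" if "i < m" for i
      by (rule P.alt_prod_reflect[OF st inv2 rel]) (use that in simp)
    have r2: "alt_prod P (2 * i + 1) ?t ?s = alt_prod P (2 * (m - 1 - i) + 1) ?s ?t" if "i < m" for i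
      by (rule P.alt_prod_reflect[OF st(2,1) inv2(2,1) rel[symmetric]]) (use that in simp)
    show "bij_betw (\<lambda>i. m - 1 - i) {i. i < m \<and> z = alt_prod P (2 * i + 1) ?s ?t}
        {i. i < m \<and> z = alt_prod P (2 * i + 1) ?t ?s}"
      by (rule bij_betwI[of _ _ _ "\<lambda>i. m - 1 - i"])
        (use r1 r2 in \<open>auto simp del: alt_prod.simps simp: Pi_iff\<close>)
  qed
  have "alt_prod Fun m (letter_action u a) (letter_action v b) = alt_prod Fun m (letter_action v b) (letter_action u a)"
  proof (rule ext, clarify)
    fix R r
    show "alt_prod Fun m (letter_action u a) (letter_action v b) (R, r)
      = alt_prod Fun m (letter_action v b) (letter_action u a) (R, r)"
    proof (cases "R \<in> conjugates \<and> r \<in> R")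
      case R: True
      show ?thesis
      proof (cases "\<exists>\<rho>. \<rho> \<noteq> \<one>\<^bsub>P\<^esub> \<and> R = {\<one>\<^bsub>P\<^esub>, \<rho>}")
        case True
        then obtain \<rho> where \<rho>: "\<rho> \<noteq> \<one>\<^bsub>P\<^esub>" "R = {\<one>\<^bsub>P\<^esub>, \<rho>}" by blast
        have "\<rho> \<in> carrier P" using \<rho> R conjugates_sub by blast
        then have "\<rho> [^]\<^bsub>P\<^esub> (0::nat) = \<one>\<^bsub>P\<^esub>" "\<rho> [^]\<^bsub>P\<^esub> (1::nat) = \<rho>" by simp_all
        \<comment> \<open>Writing \<open>r\<close> as a power brings both sectors into the form
          required by \<open>dihedral_action\<close>.\<close>
        then obtain j :: nat where j: "r = \<rho> [^]\<^bsub>P\<^esub> j" using R \<rho>(2) by (metis insertE singletonD)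
        show ?thesis
          unfolding j dihedral_action[OF uv(1) o(1) ab(1) uv(2) o(2) ab(2) conjunct1[OF R] \<rho>(2,1)]
            dihedral_action[OF uv(2) o(2) ab(2) uv(1) o(1) ab(1) conjunct1[OF R] \<rho>(2,1)]
            rel count ..
      next
        case False
        show ?thesis
          unfolding dihedral_action_other[OF uv(1) o(1) ab(1) uv(2) o(2) ab(2) conjunct1[OF R] conjunct2[OF R] False]
            dihedral_action_other[OF uv(2) o(2) ab(2) uv(1) o(1) ab(1) conjunct1[OF R] conjunct2[OF R] False]
            rel ..
      qed
    qed (simp add: alt_prod_Fun_outside)
  qed
  then show ?thesis by (simp add: m_def)
qed

text \<open>By the universal property the letters define an action on pairs. Each element acts on
  the sectors of a hyperplane by conjugation followed by right multiplication by a constant;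
  \<sigma> is that constant, and the cocycle law is the composition of two such maps.\<close>

lemma cocycle_exists:
  "\<exists>\<sigma>. cocycle_group P conjugates \<sigma> \<and>
    (\<forall>u\<in>V. \<forall>a\<in>carrier (G u). \<forall>Q\<in>conjugates. \<sigma> Q (\<iota> u a) = (if Q = A u then \<iota> u a else \<one>\<^bsub>P\<^esub>))"
proof -
  have "\<exists>\<Phi>. \<Phi> \<in> hom P Fun \<and> \<Phi> \<one>\<^bsub>P\<^esub> = id \<and>
      (\<forall>u\<in>V. \<forall>a\<in>carrier (G u). \<Phi> (\<iota> u a) = letter_action u a)"
  proof (rule periagroup_universal[OF monoid_Fun, of letter_action])
    show "letter_action u \<in> hom (G u) Fun" if "u \<in> V" for u
      using letter_action_mult[OF that] by (intro homI) simp_all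
    show "letter_action u \<one>\<^bsub>G u\<^esub> = \<one>\<^bsub>Fun\<^esub>" if "u \<in> V" for u
      using letter_action_one[OF that] by simp
  qed (use letter_action_relation in auto)
  then obtain \<Phi> where \<Phi>_hom: "\<Phi> \<in> hom P Fun" and \<Phi>_one: "\<Phi> \<one>\<^bsub>P\<^esub> = id"
    and \<Phi>_\<iota>: "\<And>u a. u \<in> V \<Longrightarrow> a \<in> carrier (G u) \<Longrightarrow> \<Phi> (\<iota> u a) = letter_action u a" by blast
  have \<Phi>_mult: "\<Phi> (x \<otimes>\<^bsub>P\<^esub> y) p = \<Phi> x (\<Phi> y p)" if "x \<in> carrier P" "y \<in> carrier P" for x y p
    using hom_mult[OF \<Phi>_hom that] by simp
  \<comment> \<open>The index is the hyperplane reached, so the action starts at its preimage, in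
    the sector of the identity.\<close>
  define \<sigma> where "\<sigma> R x = snd (\<Phi> x (conj_set P (inv\<^bsub>P\<^esub> x) R, \<one>\<^bsub>P\<^esub>))" for R x
  have one_in: "\<one>\<^bsub>P\<^esub> \<in> R" if "R \<in> conjugates" for R
    using conjugates_subgroup[OF that] subgroup.one_closed by blast
  \<comment> \<open>The point is that \<open>c\<close> does not depend on \<open>r\<close>. A letter
    on its own wall keeps this form, since left translation by \<open>?s\<close> is conjugation by
    \<open>?s\<close> followed by right multiplication by \<open>?s\<close>.\<close>
  have ex: "\<exists>c\<in>conj_set P x R. \<forall>r\<in>R. \<Phi> x (R, r) = (conj_set P x R, conj_by P x r \<otimes>\<^bsub>P\<^esub> c)"
    if "x \<in> carrier P" "R \<in> conjugates" for x R
    using that(1)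
  proof (induction rule: P_induct)
    case one
    have "r \<in> carrier P" if "r \<in> R" for r using that conjugates_sub \<open>R \<in> conjugates\<close> by blast
    then show ?case
      using conjugates_sub[OF that(2)] one_in[OF that(2)] by (intro bexI[of _ "\<one>\<^bsub>P\<^esub>"]) (simp_all add: \<Phi>_one)
  next
    case (step u a x)
    let ?s = "\<iota> u a" let ?R = "conj_set P x R"
    have s: "?s \<in> carrier P" using step by simp
    have sub: "R \<subseteq> carrier P" "?R \<in> conjugates" using conjugates_sub conjugates_conj that step by auto
    obtain c where c: "c \<in> ?R" "\<forall>r\<in>R. \<Phi> x (R, r) = (?R, conj_by P x r \<otimes>\<^bsub>P\<^esub> c)" using step by blast
    have ccl: "c \<in> carrier P" using c(1) conjugates_sub[OF sub(2)] by blast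
    have set_sx: "conj_set P (?s \<otimes>\<^bsub>P\<^esub> x) R = conj_set P ?s ?R" using s step sub by (simp add: P.conj_set_comp)
    have in_R: "conj_by P x r \<otimes>\<^bsub>P\<^esub> c \<in> ?R" if "r \<in> R" for r
      using subgroup.m_closed[OF conjugates_subgroup[OF sub(2)] conj_by_in_conj_set[OF that] c(1)] .
    have act: "\<Phi> (?s \<otimes>\<^bsub>P\<^esub> x) (R, r) = letter_action u a (?R, conj_by P x r \<otimes>\<^bsub>P\<^esub> c)" if "r \<in> R" for r
      using step s c(2) that by (simp add: \<Phi>_mult \<Phi>_\<iota>)
    show ?case
    proof (cases "?R = A u")
      case True
      have "?s \<otimes>\<^bsub>P\<^esub> c \<in> conj_set P (?s \<otimes>\<^bsub>P\<^esub> x) R"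
        unfolding set_sx True using conj_set_\<iota>_self A_mult step c True by simp
      moreover have "\<Phi> (?s \<otimes>\<^bsub>P\<^esub> x) (R, r)
          = (conj_set P (?s \<otimes>\<^bsub>P\<^esub> x) R, conj_by P (?s \<otimes>\<^bsub>P\<^esub> x) r \<otimes>\<^bsub>P\<^esub> (?s \<otimes>\<^bsub>P\<^esub> c))" if r: "r \<in> R" for r
      proof -
        have rcl: "r \<in> carrier P" using r sub by blast
        have "conj_by P (?s \<otimes>\<^bsub>P\<^esub> x) r \<otimes>\<^bsub>P\<^esub> (?s \<otimes>\<^bsub>P\<^esub> c) = ?s \<otimes>\<^bsub>P\<^esub> (conj_by P x r \<otimes>\<^bsub>P\<^esub> c)"
          using s step rcl ccl by (simp add: conj_by_def P.m_assoc P.inv_mult_group)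
        moreover have "letter_action u a (A u, conj_by P x r \<otimes>\<^bsub>P\<^esub> c) = (A u, ?s \<otimes>\<^bsub>P\<^esub> (conj_by P x r \<otimes>\<^bsub>P\<^esub> c))"
          using letter_action_same[OF step(1)] in_R[OF r] True by simp
        ultimately show ?thesis
          unfolding act[OF r] set_sx unfolding True using conj_set_\<iota>_self step by simp
      qed
      ultimately show ?thesis by blast
    next
      case False
      have "conj_by P ?s c \<in> conj_set P (?s \<otimes>\<^bsub>P\<^esub> x) R" unfolding set_sx using c(1) by (rule conj_by_in_conj_set)
      moreover have "\<Phi> (?s \<otimes>\<^bsub>P\<^esub> x) (R, r)
          = (conj_set P (?s \<otimes>\<^bsub>P\<^esub> x) R, conj_by P (?s \<otimes>\<^bsub>P\<^esub> x) r \<otimes>\<^bsub>P\<^esub> conj_by P ?s c)" if r: "r \<in> R" for r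
      proof -
        have rcl: "r \<in> carrier P" using r sub by blast
        show ?thesis
          unfolding act[OF r] set_sx
          using letter_action_other[OF sub(2) in_R[OF r] False] s step rcl ccl
          by (simp add: P.conj_by_mult P.conj_by_comp)
      qed
      ultimately show ?thesis by blast
    qed
  qed
  have \<Phi>_\<sigma>: "\<Phi> x (R, r) = (conj_set P x R, conj_by P x r \<otimes>\<^bsub>P\<^esub> \<sigma> (conj_set P x R) x)"
    and \<sigma>_in: "\<sigma> (conj_set P x R) x \<in> conj_set P x R"
    if xRr: "x \<in> carrier P" "R \<in> conjugates" "r \<in> R" for x R r
  proof -
    obtain c where c: "c \<in> conj_set P x R" "\<forall>r\<in>R. \<Phi> x (R, r) = (conj_set P x R, conj_by P x r \<otimes>\<^bsub>P\<^esub> c)"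
      using ex[OF xRr(1,2)] by blast
    have ccl: "c \<in> carrier P" using c(1) conjugates_sub[OF conjugates_conj[OF that(2,1)]] by blast
    have "\<Phi> x (R, \<one>\<^bsub>P\<^esub>) = (conj_set P x R, conj_by P x \<one>\<^bsub>P\<^esub> \<otimes>\<^bsub>P\<^esub> c)" using c(2) one_in[OF that(2)] by blast
    then have eq: "\<sigma> (conj_set P x R) x = c"
      unfolding \<sigma>_def P.conj_set_inv_cancel(1)[OF that(1) conjugates_sub[OF that(2)]]
      using that(1) ccl by simp
    show "\<Phi> x (R, r) = (conj_set P x R, conj_by P x r \<otimes>\<^bsub>P\<^esub> \<sigma> (conj_set P x R) x)"
      unfolding eq using c(2) that(3) by blast
    show "\<sigma> (conj_set P x R) x \<in> conj_set P x R" unfolding eq by (rule c(1))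
  qed
  have \<sigma>_in': "\<sigma> R x \<in> R" if "R \<in> conjugates" "x \<in> carrier P" for R x
  proof -
    have "conj_set P (inv\<^bsub>P\<^esub> x) R \<in> conjugates" using that conjugates_conj by simp
    from \<sigma>_in[OF that(2) this one_in[OF this]] show ?thesis using that conjugates_sub by simp
  qed
  have "cocycle_group P conjugates \<sigma>"
  proof (intro cocycle_group.intro cocycle_group_axioms.intro)
    fix R x y assume R: "R \<in> conjugates" "x \<in> carrier P" "y \<in> carrier P"
    define Q where "Q = conj_set P (inv\<^bsub>P\<^esub> y) R"
    have Q: "Q \<in> conjugates" "Q \<subseteq> carrier P" "conj_set P y Q = R" "R \<subseteq> carrier P"
      using R conjugates_conj conjugates_sub by (auto simp: Q_def)
    have \<sigma>y: "\<sigma> R y \<in> R" "\<sigma> R y \<in> carrier P" using \<sigma>_in' R Q by auto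
    have xyQ: "conj_set P (x \<otimes>\<^bsub>P\<^esub> y) Q = conj_set P x R" using Q R by (simp add: P.conj_set_comp)
    have \<sigma>xy: "\<sigma> (conj_set P x R) (x \<otimes>\<^bsub>P\<^esub> y) \<in> carrier P" "\<sigma> (conj_set P x R) x \<in> carrier P"
      using \<sigma>_in'[OF conjugates_conj[OF R(1,2)]] conjugates_sub[OF conjugates_conj[OF R(1,2)]] R by auto
    have "\<Phi> (x \<otimes>\<^bsub>P\<^esub> y) (Q, \<one>\<^bsub>P\<^esub>) = (conj_set P x R, \<sigma> (conj_set P x R) (x \<otimes>\<^bsub>P\<^esub> y))"
      using \<Phi>_\<sigma>[of "x \<otimes>\<^bsub>P\<^esub> y" Q "\<one>\<^bsub>P\<^esub>"] R Q one_in xyQ \<sigma>xy by simp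
    moreover have "\<Phi> y (Q, \<one>\<^bsub>P\<^esub>) = (R, \<sigma> R y)"
      using \<Phi>_\<sigma>[of y Q "\<one>\<^bsub>P\<^esub>"] R Q one_in \<sigma>y by simp
    ultimately show "\<sigma> (conj_set P x R) (x \<otimes>\<^bsub>P\<^esub> y) = conj_by P x (\<sigma> R y) \<otimes>\<^bsub>P\<^esub> \<sigma> (conj_set P x R) x"
      using \<Phi>_\<sigma>[OF R(2,1) \<sigma>y(1)] R by (simp add: \<Phi>_mult)
  qed (use P.is_group conjugates_subgroup conjugates_conj \<sigma>_in' in auto)
  moreover have "\<sigma> Q (\<iota> u a) = (if Q = A u then \<iota> u a else \<one>\<^bsub>P\<^esub>)"
    if u: "u \<in> V" "a \<in> carrier (G u)" and Q: "Q \<in> conjugates" for u a Q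
  proof -
    let ?R = "conj_set P (inv\<^bsub>P\<^esub> (\<iota> u a)) Q"
    have R: "?R \<in> conjugates" using u Q conjugates_conj by simp
    have QR: "conj_set P (\<iota> u a) ?R = Q" using u Q conjugates_sub by simp
    have iff: "?R = A u \<longleftrightarrow> Q = A u" using conj_set_\<iota>_eq[OF u R] QR by simp
    show ?thesis
    proof (cases "Q = A u")
      case True
      then have "?R = A u" using iff by blast
      then show ?thesis
        using letter_action_same[OF u(1), of "\<one>\<^bsub>P\<^esub>" a] one_in[OF A_conjugates[OF u(1)]] u True
        by (simp add: \<sigma>_def \<Phi>_\<iota>)
    next
      case False
      then have "?R \<noteq> A u" using iff by blast
      then show ?thesis
        using letter_action_other[OF R one_in[OF R], of u a] u False by (simp add: \<sigma>_def \<Phi>_\<iota>)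
    qed
  qed
  ultimately show ?thesis by blast
qed

end

section \<open>Subgroups generated by conjugates of vertex-groups\<close>

lemma (in group) conj_by_consistent:
  "subgroup H G \<Longrightarrow> x \<in> H \<Longrightarrow> conj_by (G\<lparr>carrier := H\<rparr>) x r = conj_by G x r"
  by (simp add: conj_by_def)

lemma (in group) conj_set_consistent:
  "subgroup H G \<Longrightarrow> x \<in> H \<Longrightarrow> conj_set (G\<lparr>carrier := H\<rparr>) x R = conj_set G x R"
  by (simp add: conj_set_def conj_by_consistent)

context periagroup_data
begin

text \<open>Restricting the cocycle to \<open>T'\<close> is harmless, as its members lie in
  \<open>W'\<close>. What needs proof is that the walls of \<open>D\<close> generate
  \<open>W'\<close> and that the elements of a wall cross no other member of
  \<open>T'\<close>.\<close>

lemma reflection_system_of_conjugates: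
  assumes C: "C \<subseteq> conjugates"
  defines "W' \<equiv> generate P (\<Union>C)"
  obtains T' \<sigma> \<Delta> where "reflection_system (P\<lparr>carrier := W'\<rparr>) T' \<sigma> \<Delta>" "\<Delta> \<subseteq> conjugates"
proof -
  obtain \<sigma> where \<sigma>: "cocycle_group P conjugates \<sigma>"
    and \<sigma>_\<iota>: "\<And>u a Q. u \<in> V \<Longrightarrow> a \<in> carrier (G u) \<Longrightarrow> Q \<in> conjugates
      \<Longrightarrow> \<sigma> Q (\<iota> u a) = (if Q = A u then \<iota> u a else \<one>\<^bsub>P\<^esub>)"
    using cocycle_exists by blast
  interpret S: cocycle_group P conjugates \<sigma> by (rule \<sigma>)
  have CP: "\<Union>C \<subseteq> carrier P" using C conjugates_sub by blast
  have W': "subgroup W' P" unfolding W'_def using CP by (rule P.generate_is_subgroup)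
  then have W'P: "W' \<subseteq> carrier P" by (rule subgroup.subset)
  have W'_mult: "x \<otimes>\<^bsub>P\<^esub> y \<in> W'" if "x \<in> W'" "y \<in> W'" for x y
    using W' that by (rule subgroup.m_closed)
  have W'_inv: "inv\<^bsub>P\<^esub> x \<in> W'" if "x \<in> W'" for x
    using W' that by (rule subgroup.m_inv_closed)
  \<comment> \<open>Trivial conjugates are dropped: their hyperplanes have a single sector and
    cannot be walls in a reflection system.\<close>
  define C' where "C' = C - {{\<one>\<^bsub>P\<^esub>}}"
  define T' where "T' = {conj_set P w R | w R. w \<in> W' \<and> R \<in> C'}"
  define D where "D = {x \<in> carrier P. \<forall>R\<in>T'. \<sigma> R x = \<one>\<^bsub>P\<^esub>}"
  define \<Delta> where "\<Delta> = {R \<in> T'. \<exists>g\<in>D. \<exists>u\<in>V. R = conj_set P g (A u)}"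
  have C'_conj: "C' \<subseteq> conjugates" using C by (auto simp: C'_def)
  have T'_conj: "T' \<subseteq> conjugates"
    using C'_conj W'P conjugates_conj by (auto simp: T'_def)
  have T'_W': "R \<subseteq> W'" if R: "R \<in> T'" for R
  proof -
    obtain w Q where wQ: "w \<in> W'" "Q \<in> C'" "R = conj_set P w Q" using R by (auto simp: T'_def)
    have "Q \<subseteq> W'" using wQ(2) generate.incl[of _ "\<Union>C" P] unfolding W'_def C'_def by blast
    then show ?thesis using wQ W'_mult W'_inv by (auto simp: conj_set_def conj_by_def)
  qed
  have T'_closed: "conj_set P x R \<in> T'" if x: "x \<in> W'" and R: "R \<in> T'" for x R
  proof -
    obtain w Q where wQ: "w \<in> W'" "Q \<in> C'" "R = conj_set P w Q" using R by (auto simp: T'_def)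
    have "conj_set P x R = conj_set P (x \<otimes>\<^bsub>P\<^esub> w) Q"
      using P.conj_set_comp[of x w Q] wQ x W'P C'_conj conjugates_sub by blast
    then show ?thesis using W'_mult x wQ unfolding T'_def by blast
  qed
  have T'_nontriv: "R \<noteq> {\<one>\<^bsub>P\<^esub>}" if R: "R \<in> T'" for R
  proof
    assume triv: "R = {\<one>\<^bsub>P\<^esub>}"
    obtain w Q where wQ: "w \<in> W'" "Q \<in> C'" "R = conj_set P w Q" using R by (auto simp: T'_def)
    have "w \<in> carrier P" "Q \<subseteq> carrier P" using wQ(1,2) W'P C'_conj conjugates_sub by blast+
    moreover have "conj_set P w Q = {\<one>\<^bsub>P\<^esub>}" using wQ(3) triv by simp
    ultimately have "Q = {\<one>\<^bsub>P\<^esub>}" by (rule P.conj_set_trivial)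
    then show False using wQ by (simp add: C'_def)
  qed
  have \<Delta>T': "\<Delta> \<subseteq> T'" by (auto simp: \<Delta>_def)
  \<comment> \<open>For a wall given by \<open>g\<close> in \<open>D\<close>, the product of
    \<open>r\<close> and \<open>g\<close> equals \<open>g\<close> times a letter of
    \<open>A u\<close>. When \<sigma> is evaluated on both sides, \<open>g\<close> contributes
    nothing and the letter crosses only \<open>A u\<close>.\<close>
  have \<sigma>_gen: "\<sigma> Q r = (if Q = R then r else \<one>\<^bsub>P\<^esub>)" if R: "R \<in> \<Delta>" "r \<in> R" and Q: "Q \<in> T'" for R r Q
  proof -
    obtain g u where g: "g \<in> D" "u \<in> V" "R = conj_set P g (A u)" and RT: "R \<in> T'"
      using R(1) by (auto simp: \<Delta>_def)
    obtain a where a: "a \<in> carrier (G u)" "r = conj_by P g (\<iota> u a)"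
      using R(2) g(3) by (auto simp: conj_set_def A_def)
    have \<sigma>g: "\<sigma> S g = \<one>\<^bsub>P\<^esub>" if "S \<in> T'" for S using g(1) that by (auto simp: D_def)
    have gP: "g \<in> carrier P" using g(1) by (simp add: D_def)
    have s: "\<iota> u a \<in> carrier P" using g a by simp
    have r: "r \<in> W'" "r \<in> carrier P" using T'_W'[OF RT] R(2) W'P by auto
    have QP: "Q \<in> conjugates" using Q T'_conj by blast
    have rg: "r \<otimes>\<^bsub>P\<^esub> g = g \<otimes>\<^bsub>P\<^esub> \<iota> u a" using a gP s by (simp add: P.conj_by_mult_right)
    have "conj_set P (inv\<^bsub>P\<^esub> g) Q = A u \<longleftrightarrow> Q = R"
      using P.conj_set_eq_iff[OF gP conjugates_sub[OF QP] A_sub[OF g(2)]] g(3) by simp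
    then have "\<sigma> Q (g \<otimes>\<^bsub>P\<^esub> \<iota> u a) = (if Q = R then r else \<one>\<^bsub>P\<^esub>)"
      using S.cocycle_mult[OF QP gP s] \<sigma>_\<iota>[OF g(2) a(1) conjugates_conj[OF QP, of "inv\<^bsub>P\<^esub> g"]] \<sigma>g[OF Q] gP s a(2)
      by simp
    moreover have "\<sigma> Q (r \<otimes>\<^bsub>P\<^esub> g) = \<sigma> Q r"
      using S.cocycle_mult[OF QP r(2) gP] \<sigma>g[OF T'_closed[OF W'_inv[OF r(1)] Q]] r QP by simp
    ultimately show ?thesis using rg by simp
  qed
  \<comment> \<open>A priori smaller than \<open>W'\<close>; equality is reached only through
    \<open>decomp\<close>.\<close>
  define L where "L = generate P (\<Union>\<Delta>)"
  have \<Delta>P: "\<Union>\<Delta> \<subseteq> W'" using \<Delta>T' T'_W' by blast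
  have L: "subgroup L P" unfolding L_def using \<Delta>P W'P by (intro P.generate_is_subgroup) blast
  have LW': "L \<subseteq> W'" unfolding L_def using \<Delta>P W' by (rule P.generate_subgroup_incl)
  \<comment> \<open>A gallery argument: appending a letter to \<open>d\<close> either stays in
    \<open>D\<close> or passes a wall of \<open>D\<close>, and in the latter case the conjugate of
    the letter by \<open>d\<close> lies in \<open>L\<close> and is absorbed into
    \<open>w\<close>.\<close>
  have decomp: "\<exists>w\<in>L. \<exists>d\<in>D. x = w \<otimes>\<^bsub>P\<^esub> d" if "x \<in> carrier P" for x
    using that
  proof (induction rule: P_rev_induct)
    case one
    have "\<one>\<^bsub>P\<^esub> \<in> D" using T'_conj by (auto simp: D_def)
    moreover have "\<one>\<^bsub>P\<^esub> \<in> L" using L by (rule subgroup.one_closed)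
    ultimately show ?case by (metis P.l_one P.one_closed)
  next
    case (step u a x)
    then obtain w d where wd: "w \<in> L" "d \<in> D" "x = w \<otimes>\<^bsub>P\<^esub> d" by blast
    let ?s = "\<iota> u a"
    have cl: "w \<in> carrier P" "d \<in> carrier P" "?s \<in> carrier P"
      using wd LW' W'P step by (auto simp: D_def)
    let ?R = "conj_set P d (A u)"
    show ?case
    proof (cases "?R \<in> T'")
      case True
      then have "?R \<in> \<Delta>" using wd step by (auto simp: \<Delta>_def)
      moreover have "conj_by P d ?s \<in> ?R" using \<iota>_A step by (simp add: conj_by_in_conj_set)
      ultimately have "conj_by P d ?s \<in> L" unfolding L_def by (blast intro: generate.incl)
      then have "w \<otimes>\<^bsub>P\<^esub> conj_by P d ?s \<in> L" using L wd(1) by (simp add: subgroup.m_closed)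
      moreover have "x \<otimes>\<^bsub>P\<^esub> ?s = (w \<otimes>\<^bsub>P\<^esub> conj_by P d ?s) \<otimes>\<^bsub>P\<^esub> d"
        using wd cl by (simp add: P.m_assoc P.conj_by_mult_right)
      ultimately show ?thesis using wd by blast
    next
      case False
      have "\<sigma> Q (d \<otimes>\<^bsub>P\<^esub> ?s) = \<one>\<^bsub>P\<^esub>" if Q: "Q \<in> T'" for Q
      proof -
        have QP: "Q \<in> conjugates" using Q T'_conj by blast
        have "conj_set P (inv\<^bsub>P\<^esub> d) Q \<noteq> A u"
          using P.conj_set_eq_iff[OF cl(2) conjugates_sub[OF QP] A_sub[OF step(1)]] False Q by blast
        then have "\<sigma> (conj_set P (inv\<^bsub>P\<^esub> d) Q) ?s = \<one>\<^bsub>P\<^esub>"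
          using \<sigma>_\<iota>[OF step(1,2) conjugates_conj[OF QP, of "inv\<^bsub>P\<^esub> d"]] cl by simp
        then show ?thesis using S.cocycle_mult[OF QP cl(2,3)] wd Q cl by (simp add: D_def)
      qed
      then have "d \<otimes>\<^bsub>P\<^esub> ?s \<in> D" using cl by (simp add: D_def)
      moreover have "x \<otimes>\<^bsub>P\<^esub> ?s = w \<otimes>\<^bsub>P\<^esub> (d \<otimes>\<^bsub>P\<^esub> ?s)" using wd cl by (simp add: P.m_assoc)
      ultimately show ?thesis using wd by blast
    qed
  qed
  \<comment> \<open>Translating a member of \<open>T'\<close> by the inverse of \<open>w\<close>
    makes it a wall of \<open>D\<close>, so it is an \<open>L\<close>-conjugate of a member of
    \<Delta>.\<close>
  have T'_L: "R \<subseteq> L" if R: "R \<in> T'" for R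
  proof -
    obtain g u where g: "g \<in> carrier P" "u \<in> V" "R = conj_set P g (A u)"
      using R T'_conj unfolding conjugates_def by blast
    obtain w d where wd: "w \<in> L" "d \<in> D" "g = w \<otimes>\<^bsub>P\<^esub> d" using decomp g(1) by blast
    have cl: "w \<in> carrier P" "d \<in> carrier P" using wd LW' W'P by (auto simp: D_def)
    let ?R = "conj_set P d (A u)"
    have Rsub: "?R \<subseteq> carrier P" using cl A_sub[OF g(2)] by (intro P.conj_set_closed)
    have R_eq: "R = conj_set P w ?R" unfolding g(3) wd(3) using cl A_sub[OF g(2)] by (rule P.conj_set_comp)
    then have "?R = conj_set P (inv\<^bsub>P\<^esub> w) R" using cl Rsub by simp
    then have "?R \<in> T'" using T'_closed R W'_inv wd(1) LW' by auto
    then have "?R \<in> \<Delta>" using wd g by (auto simp: \<Delta>_def)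
    then have RL: "?R \<subseteq> L" unfolding L_def by (blast intro: generate.incl)
    show ?thesis
    proof
      fix r assume "r \<in> R"
      then obtain q where q: "q \<in> ?R" "r = conj_by P w q" using R_eq by (auto simp: conj_set_def)
      then show "r \<in> L"
        using RL L wd(1) by (auto simp: conj_by_def intro!: subgroup.m_closed subgroup.m_inv_closed)
    qed
  qed
  have "\<Union>C \<subseteq> L"
  proof
    fix r assume "r \<in> \<Union>C"
    then obtain R where R: "R \<in> C" "r \<in> R" by blast
    show "r \<in> L"
    proof (cases "R = {\<one>\<^bsub>P\<^esub>}")
      case True
      then show ?thesis using R L subgroup.one_closed by fastforce
    next
      case False
      then have "R \<in> C'" using R by (simp add: C'_def)
      moreover have "R = conj_set P \<one>\<^bsub>P\<^esub> R" using R C conjugates_sub by force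
      moreover have "\<one>\<^bsub>P\<^esub> \<in> W'" using W' by (rule subgroup.one_closed)
      ultimately have "R \<in> T'" unfolding T'_def by blast
      then show ?thesis using T'_L R by blast
    qed
  qed
  then have W'L: "W' = L" using LW' P.generate_subgroup_incl[OF _ L] unfolding W'_def by blast
  let ?W = "P\<lparr>carrier := W'\<rparr>"
  interpret W: group ?W using W' P.is_group by (rule subgroup.subgroup_is_group)
  have "reflection_system ?W T' \<sigma> \<Delta>"
  proof (intro reflection_system.intro cocycle_group.intro cocycle_group_axioms.intro
      reflection_system_axioms.intro)
    show "group ?W" by (rule W.is_group)
    show "subgroup R ?W" if "R \<in> T'" for R
      using conjugates_subgroup T'_conj that W' T'_W' by (intro P.subgroup_incl) auto
    show "conj_set ?W x R \<in> T'" if "R \<in> T'" "x \<in> carrier ?W" for x R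
      using that T'_closed W' by (simp add: P.conj_set_consistent)
    show "\<sigma> R x \<in> R" if "R \<in> T'" "x \<in> carrier ?W" for x R
      using that S.cocycle_in T'_conj W'P by auto
    show "\<sigma> (conj_set ?W x R) (x \<otimes>\<^bsub>?W\<^esub> y) = conj_by ?W x (\<sigma> R y) \<otimes>\<^bsub>?W\<^esub> \<sigma> (conj_set ?W x R) x"
      if "R \<in> T'" "x \<in> carrier ?W" "y \<in> carrier ?W" for x y R
      using that S.cocycle[of R x y] T'_conj W'P W'
      by (auto simp: P.conj_set_consistent P.conj_by_consistent)
    show "\<Delta> \<subseteq> T'" by (rule \<Delta>T')
    show "R \<noteq> {\<one>\<^bsub>?W\<^esub>}" if "R \<in> \<Delta>" for R using that \<Delta>T' T'_nontriv by auto
    show "\<sigma> Q r = (if Q = R then r else \<one>\<^bsub>?W\<^esub>)" if "R \<in> \<Delta>" "r \<in> R" "Q \<in> T'" for R r Q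
      using \<sigma>_gen[OF that] by simp
    show "generate ?W (\<Union>\<Delta>) = carrier ?W"
      using P.generate_consistent[OF \<Delta>P W'] W'L by (simp add: L_def)
  qed
  then show thesis using that \<Delta>T' T'_conj by blast
qed

end

text \<open>The universal property of the periagroup gives one map and \<open>K.extension\<close>
  the other; induction on letters shows them inverse. The groups \<open>G' R\<close> are abstract
  copies of the walls, so that the original vertex-groups themselves can be inserted.\<close>

lemma (in reflection_system) presentation:
  assumes G': "\<And>R. R \<in> \<Delta> \<Longrightarrow> group (G' R)"
    and f: "\<And>R. R \<in> \<Delta> \<Longrightarrow> f R \<in> hom (G' R) W" "\<And>R. R \<in> \<Delta> \<Longrightarrow> bij_betw (f R) (carrier (G' R)) R"
  shows "periagroup_data \<Delta> refl_edges refl_label G'"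
    and "W \<cong> periagroup \<Delta> refl_edges refl_label G'"
proof -
  have f_one: "f R \<one>\<^bsub>G' R\<^esub> = \<one>" if "R \<in> \<Delta>" for R
    using group_hom.hom_one[of "G' R" W "f R"] f(1)[OF that] G'[OF that]
    by (simp add: group_hom_def group_hom_axioms_def is_group)
  have f_in: "f R x \<in> R" if "R \<in> \<Delta>" "x \<in> carrier (G' R)" for R x
    using bij_betwE[OF f(2)] that by blast
  have f_nontriv: "f R x \<in> R - {\<one>}" if "R \<in> \<Delta>" "x \<in> carrier (G' R) - {\<one>\<^bsub>G' R\<^esub>}" for R x
  proof -
    interpret GR: group "G' R" using G' that by blast
    have "inj_on (f R) (carrier (G' R))" using f(2)[OF that(1)] by (rule bij_betw_imp_inj_on)
    then have "f R x \<noteq> f R \<one>\<^bsub>G' R\<^esub>" using inj_onD that(2) GR.one_closed by fastforce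
    then show ?thesis using f_one f_in that by simp
  qed
  show data: "periagroup_data \<Delta> refl_edges refl_label G'"
  proof (rule periagroup_data.intro)
    show "simplicial_graph \<Delta> refl_edges"
      unfolding simplicial_graph_def
    proof
      fix e assume "e \<in> refl_edges"
      then obtain B C where "B \<in> \<Delta>" "C \<in> \<Delta>" "B \<noteq> C" "e = {B, C}" unfolding refl_edges_def by auto
      then show "\<exists>u\<in>\<Delta>. \<exists>v\<in>\<Delta>. u \<noteq> v \<and> e = {u, v}" by metis
    qed
    show "2 \<le> refl_label e" if e: "e \<in> refl_edges" for e
    proof -
      obtain B C where "e = {B, C}" using e unfolding refl_edges_def by auto
      then show ?thesis using refl_label_ge_2 e by simp
    qed
    show "group (G' R)" if "R \<in> \<Delta>" for R using G' that by blast
    have order2: "order (G' B) = 2" if e: "{B, C} \<in> refl_edges" "2 < refl_label {B, C}" for B C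
    proof -
      have B: "B \<in> \<Delta>" using refl_edge_gens e by blast
      obtain r where r: "r \<in> B" "r \<noteq> \<one>" using gen_nontrivial B by blast
      have "B \<subseteq> {\<one>, r}" using refl_label_order_2[OF e, of _ r] r by blast
      moreover have "\<one> \<in> B" using T_subgroup[OF gen_T[OF B]] subgroup.one_closed by blast
      ultimately have "B = {\<one>, r}" using r by blast
      then have "card B = 2" using r by simp
      then show ?thesis using bij_betw_same_card[OF f(2)[OF B]] by (simp add: order_def)
    qed
    show "order (G' B) = 2 \<and> order (G' C) = 2" if e: "{B, C} \<in> refl_edges" "2 < refl_label {B, C}" for B C
      using order2[OF e] order2[of C B] e insert_commute[of C B "{}"] by simp
  qed
  interpret G': periagroup_data \<Delta> refl_edges refl_label G' by (rule data)
  let ?\<Pi> = "periagroup \<Delta> refl_edges refl_label G'"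
  let ?\<iota> = "vertex_emb \<Delta> refl_edges refl_label G'"
  have "\<exists>\<phi>. \<phi> \<in> hom ?\<Pi> W \<and> \<phi> \<one>\<^bsub>?\<Pi>\<^esub> = \<one> \<and> (\<forall>R\<in>\<Delta>. \<forall>x\<in>carrier (G' R). \<phi> (?\<iota> R x) = f R x)"
  proof (rule G'.periagroup_universal[OF is_monoid, of f])
    show "alt_prod W (refl_label {B, C}) (f B b) (f C c) = alt_prod W (refl_label {B, C}) (f C c) (f B b)"
      if "{B, C} \<in> refl_edges" "b \<in> carrier (G' B) - {\<one>\<^bsub>G' B\<^esub>}" "c \<in> carrier (G' C) - {\<one>\<^bsub>G' C\<^esub>}" for B C b c
      using that refl_relation f_nontriv refl_edge_gens by blast
  qed (use f(1) f_one in auto)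
  then obtain \<phi> where \<phi>: "\<phi> \<in> hom ?\<Pi> W" "\<phi> \<one>\<^bsub>?\<Pi>\<^esub> = \<one>"
    "\<And>R x. R \<in> \<Delta> \<Longrightarrow> x \<in> carrier (G' R) \<Longrightarrow> \<phi> (?\<iota> R x) = f R x" by blast
  \<comment> \<open>\<open>K.extension\<close> takes maps out of the walls, hence the inverse of
    \<open>f\<close>.\<close>
  define k where "k R = inv_into (carrier (G' R)) (f R)" for R
  have k_in: "k R r \<in> carrier (G' R)" and f_k: "f R (k R r) = r" if "R \<in> \<Delta>" "r \<in> R" for R r
    using f(2)[OF that(1)] that(2) unfolding k_def
    by (auto simp: bij_betw_def inv_into_into f_inv_into_f)
  have k_f: "k R (f R x) = x" if "R \<in> \<Delta>" "x \<in> carrier (G' R)" for R x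
    using bij_betw_inv_into_left[OF f(2)[OF that(1)] that(2)] by (simp add: k_def)
  have k_mult: "k R (r \<otimes> s) = k R r \<otimes>\<^bsub>G' R\<^esub> k R s" if R: "R \<in> \<Delta>" "r \<in> R" "s \<in> R" for R r s
  proof -
    interpret GR: group "G' R" using G' R by blast
    have "f R (k R r \<otimes>\<^bsub>G' R\<^esub> k R s) = r \<otimes> s"
      using hom_mult[OF f(1)[OF R(1)]] k_in f_k R by simp
    then show ?thesis using k_f[OF R(1), of "k R r \<otimes>\<^bsub>G' R\<^esub> k R s"] k_in R by simp
  qed
  have k_one: "k R \<one> = \<one>\<^bsub>G' R\<^esub>" if "R \<in> \<Delta>" for R
    using k_f[OF that, of "\<one>\<^bsub>G' R\<^esub>"] f_one[OF that] group.is_monoid[OF G'[OF that]] monoid.one_closed by metis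
  have k_nontriv: "k R r \<in> carrier (G' R) - {\<one>\<^bsub>G' R\<^esub>}" if "R \<in> \<Delta>" "r \<in> R - {\<one>}" for R r
    using k_in[of R r] f_k[of R r] f_one[of R] that by auto
  interpret K: reflection_system_map W T \<sigma> \<Delta> ?\<Pi> "\<lambda>R r. ?\<iota> R (k R r)"
  proof unfold_locales
    show "?\<iota> R (k R r) \<in> carrier ?\<Pi>" if "R \<in> \<Delta>" "r \<in> R" for R r
      using that k_in by simp
    show "?\<iota> R (k R (r \<otimes> s)) = ?\<iota> R (k R r) \<otimes>\<^bsub>?\<Pi>\<^esub> ?\<iota> R (k R s)" if "R \<in> \<Delta>" "r \<in> R" "s \<in> R" for R r s
      using that k_in k_mult G'.\<iota>_mult by simp
    show "?\<iota> R (k R \<one>) = \<one>\<^bsub>?\<Pi>\<^esub>" if "R \<in> \<Delta>" for R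
      using that k_one by simp
    show "alt_prod ?\<Pi> (refl_label {B, C}) (?\<iota> B (k B b)) (?\<iota> C (k C c))
        = alt_prod ?\<Pi> (refl_label {B, C}) (?\<iota> C (k C c)) (?\<iota> B (k B b))"
      if "{B, C} \<in> refl_edges" "b \<in> B - {\<one>}" "c \<in> C - {\<one>}" for B C b c
      using G'.\<iota>_relation[OF that(1)] k_nontriv refl_edge_gens[OF that(1)] that by blast
  qed
  let ?\<psi> = "K.extension"
  have \<psi>\<phi>: "?\<psi> (\<phi> z) = z" if "z \<in> carrier ?\<Pi>" for z
    using that
  proof (induction rule: G'.P_induct)
    case one
    then show ?case by (simp add: \<phi>(2) K.extension_one)
  next
    case (step R x z)
    have "\<phi> z \<in> carrier W" using hom_in_carrier[OF \<phi>(1)] step by blast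
    moreover have "\<phi> (?\<iota> R x \<otimes>\<^bsub>?\<Pi>\<^esub> z) = f R x \<otimes> \<phi> z"
      using hom_mult[OF \<phi>(1)] \<phi>(3) step by simp
    ultimately show ?case
      using K.extension_letter[OF step(1) f_in[OF step(1,2)]] step k_f by simp
  qed
  have \<phi>\<psi>: "\<phi> (?\<psi> x) = x" if "x \<in> carrier W" for x
    using that
  proof (induction rule: W_induct)
    case one
    then show ?case by (simp add: \<phi>(2) K.extension_one)
  next
    case (step R s x)
    have "?\<psi> (s \<otimes> x) = ?\<iota> R (k R s) \<otimes>\<^bsub>?\<Pi>\<^esub> ?\<psi> x" using K.extension_letter step by blast
    then show ?case
      using hom_mult[OF \<phi>(1)] \<phi>(3) k_in[OF step(1,2)] f_k[OF step(1,2)] K.extension_closed step by simp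
  qed
  have "bij_betw ?\<psi> (carrier W) (carrier ?\<Pi>)"
    by (rule bij_betwI[of _ _ _ \<phi>])
      (use K.extension_closed hom_in_carrier[OF \<phi>(1)] \<psi>\<phi> \<phi>\<psi> in auto)
  then show "W \<cong> ?\<Pi>"
    using K.extension_hom unfolding is_iso_def iso_def by blast
qed

theorem theorem1p6:
  fixes V :: "'v set" and E :: "'v set set" and lab :: "'v set \<Rightarrow> nat"
    and G :: "'v \<Rightarrow> 'a monoid"
    and C :: "('v, 'a) periagroup_elem set set"
  assumes "periagroup_data V E lab G"
    and "C \<subseteq> vertex_conjugates V E lab G"
  shows "\<exists>(V' :: ('v, 'a) periagroup_elem set set) E' lab' (G' :: ('v, 'a) periagroup_elem set \<Rightarrow> 'a monoid).
    periagroup_data V' E' lab' G' \<and>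
    (\<forall>w\<in>V'. \<exists>u\<in>V. G' w = G u) \<and>
    (periagroup V E lab G)\<lparr>carrier := generate (periagroup V E lab G) (\<Union>C)\<rparr>
      \<cong> periagroup V' E' lab' G'"
proof -
  interpret periagroup_data V E lab G by fact
  have C: "C \<subseteq> conjugates" using assms(2) by (simp add: vertex_conjugates_eq)
  let ?W = "P\<lparr>carrier := generate P (\<Union>C)\<rparr>"
  obtain T' \<sigma> \<Delta> where "reflection_system ?W T' \<sigma> \<Delta>" and \<Delta>: "\<Delta> \<subseteq> conjugates"
    using reflection_system_of_conjugates[OF C] .
  then interpret S: reflection_system ?W T' \<sigma> \<Delta> by blast
  \<comment> \<open>One description of each wall as a conjugate is fixed; it selects the
    vertex-group attached to \<open>R\<close> and the isomorphism \<open>f R\<close> onto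
    it.\<close>
  have "\<exists>g u. g \<in> carrier P \<and> u \<in> V \<and> R = conj_set P g (A u)" if "R \<in> \<Delta>" for R
    using that \<Delta> unfolding conjugates_def by blast
  then obtain g u where gu: "g R \<in> carrier P" "u R \<in> V" "R = conj_set P (g R) (A (u R))" if "R \<in> \<Delta>" for R
    by metis
  define f where "f R a = conj_by P (g R) (\<iota> (u R) a)" for R a
  have bij: "bij_betw (f R) (carrier (G (u R))) R" if R: "R \<in> \<Delta>" for R
  proof -
    have "inj_on (f R) (carrier (G (u R)))"
      unfolding f_def using inj_onD[OF P.conj_by_inj] inj_onD[OF \<iota>_inj] gu(1,2)[OF R] \<iota>_closed
      by (intro inj_onI) metis
    moreover have "f R ` carrier (G (u R)) = R"
      by (subst (2) gu(3)[OF R]) (auto simp: f_def conj_set_def A_def)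
    ultimately show ?thesis by (simp add: bij_betw_def)
  qed
  have hom: "f R \<in> hom (G (u R)) ?W" if R: "R \<in> \<Delta>" for R
  proof (rule homI)
    fix x y assume xy: "x \<in> carrier (G (u R))" "y \<in> carrier (G (u R))"
    show "f R x \<in> carrier ?W" using bij_betwE[OF bij[OF R]] S.gen_closed[OF R] xy by blast
    show "f R (x \<otimes>\<^bsub>G (u R)\<^esub> y) = f R x \<otimes>\<^bsub>?W\<^esub> f R y"
      using gu(1,2)[OF R] xy by (simp add: f_def \<iota>_mult P.conj_by_mult)
  qed
  let ?G' = "\<lambda>R. G (u R)"
  have "group (?G' R)" if "R \<in> \<Delta>" for R using gu(2) groups that by blast
  from S.presentation[of ?G' f, OF this hom bij]
  have "periagroup_data \<Delta> S.refl_edges S.refl_label ?G'" "?W \<cong> periagroup \<Delta> S.refl_edges S.refl_label ?G'"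
    by blast+
  moreover have "\<forall>R\<in>\<Delta>. \<exists>v\<in>V. ?G' R = G v" using gu(2) by blast
  ultimately show ?thesis by blast
qed

end
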